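(* Let $a(t)=(t-2+\frac1t)^3$, $g(\varphi)=a(e^{i\varphi})=-\left(2\sin\frac\varphi2\right)^6$ and $q=\frac{n+3}{2}$. Then, as $n\to\infty$ (with remainder terms uniform in $j$): 1. For $j\in\{1,\dots,[\frac{n+1}{2}]\}$, $$\lambda_{2j-1}^{(n)}=g(d_{1,j})+g'(d_{1,j})\frac{2u_1^{\star}}{n+3}+\frac{4u_2^{\star}g'(d_{1,j})+2(u_1^{\star})^2g''(d_{1,j})}{(n+3)^2}+o\left(\frac1{n^2}\right).$$ 2. For $j\in\{1,\dots,[\frac n2]\}$, $$\lambda_{2j}^{(n)}=g(d_{2,j})+g'(d_{2,j})\frac{2w_1^{\star}}{n+3}+\frac{4w_2^{\star}g'(d_{2,j})+2(w_1^{\star})^2g''(d_{2,j})}{(n+3)^2}+o\left(\frac1{n^2}\right).$$ Here $u_1^\star,u_2^\star,w_1^\star,w_2^\star$ (depending on $j$ and $n$) are defined in the context, by one set of formulas if $\frac12e^{\pi(j-1)}>q^2$ and by another if $\frac12e^{\pi(j-1)}\le q^2$.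
   Context: $d_{1,j}=\frac{2\pi j}{n+3}$, $d_{2,j}=\frac{(2j+1)\pi}{n+3}$; $[x]$ is the integer part of $x$. "Uniform in $j$" means that the remainders multiplied by $n^2$ tend to $0$ uniformly in $j$. Eigenvalues. $\beta:[0,\pi]\to\mathbb C$ is the regular branch of $\arccos\bigl(1-(1-\cos\varphi)e^{2\pi i/3}\bigr)$ determined as follows: $\beta$ is continuous, $\beta(0)=0$, $\cos\beta(\varphi)=1-(1-\cos\varphi)e^{2\pi i/3}$, and for $\varphi\in(0,\pi)$ one has $\sin\beta(\varphi)=B_s(\varphi)e^{i\psi_s(\varphi)}$ with $B_s(\varphi)>0$ and $\psi_s(\varphi)\in(\frac{\pi}{4},\frac{\pi}{3})$. For $\varphi\in(0,\pi)$ put $c(\varphi)=\Re\beta(\varphi)$, $b(\varphi)=\Im\beta(\varphi)$, $B(\varphi)=\Re\bigl(\sin(\beta(\varphi))e^{-\pi i/3}\bigr)$, $C(\varphi)=-\Im\bigl(\sin(\beta(\varphi))e^{-\pi i/3}\bigr)$, and $$f(\varphi)=2\,\frac{B(\varphi)\sin((n+3)c(\varphi))+C(\varphi)\sinh((n+3)b(\varphi))}{\sin(\varphi)\,\bigl(\cos((n+3)c(\varphi))+\cosh((n+3)b(\varphi))\bigr)},$$ $$h(\varphi)=2\,\frac{B(\varphi)\sin((n+3)c(\varphi))-C(\varphi)\sinh((n+3)b(\varphi))}{\sin(\varphi)\,\bigl(-\cos((n+3)c(\varphi))+\cosh((n+3)b(\varphi))\bigr)}.$$ For $n$ sufficiently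 large, $\varphi_{2j-1}$ ($1\le j\le[\frac{n+1}{2}]$) denotes the unique root of $\tan(\frac{n+3}{2}\varphi)=f(\varphi)$ in $\left(\frac{\pi(2j-1)}{n+3},\frac{\pi(2j+1)}{n+3}\right)$, and $\varphi_{2j}$ ($1\le j\le[\frac n2]$) denotes the unique root of $\tan(\frac{n+3}{2}\varphi)=\frac1{h(\varphi)}$ in $\left(\frac{2\pi j}{n+3},\frac{2\pi(j+1)}{n+3}\right)$, the latter equation being understood as $\cos(\frac{n+3}{2}\varphi)=h(\varphi)\sin(\frac{n+3}{2}\varphi)$. The numbers $\lambda_m^{(n)}=g(\varphi_m)$, $1\le m\le n$, are the eigenvalues of the $n\times n$ Toeplitz matrix $T_n(a)=(a_{j-k})_{j,k=0}^{n-1}$, $a_l$ being the Fourier coefficients of $a$. Case $\frac12e^{\pi(j-1)}>q^2$. Put, with $d=d_{1,j}$, $$u_1^{\star}=\arctan\left(\frac{2C(d)}{\sin d}\right),\qquad u_2^{\star}=2\,\frac{C'(d)\sin d-C(d)\cos d}{\sin^2d+4C^2(d)}\arctan\left(\frac{2C(d)}{\sin d}\right),$$ and let $w_1^\star,w_2^\star$ be given by the same two formulas with $d=d_{2,j}$. Case $\frac12e^{\pi(j-1)}\le q^2$. Then $u_1^\star$ is the solution in $(-\frac\pi2,\frac\pi2)$ of $u_1=\arctan(Z_1^{(1)}(u_1))$, $u_2^\star=R^{(1)}(u_1^\star)$, $w_1^\star$ is the solution in $(-\frac\pi2,\frac\pi2)$ of $w_1=-\arctan(Z_1^{(2)}(w_1))$,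 $w_2^\star=R^{(2)}(w_1^\star)$ (these solutions exist and are unique for $n$ sufficiently large), with the following functions. Superscript $(1)$ (functions of $u_1$, with $d=d_{1,j}$): $P_a^{(1)}=qd+u_1$, $P_b^{(1)}=\sqrt3(qd+u_1)$, $B_1^{(1)}=1+\frac{3}{16}d^2$, $C_1^{(1)}=\frac{\sqrt3}{16}d^2$, $B_2^{(1)}=\frac{3du_1}{8}$, $C_2^{(1)}=\frac{\sqrt3du_1}{8}$, $Q_a^{(1)}=-\frac18(d^3q^2+3d^2u_1q+3du_1^2)$, $Q_b^{(1)}=-\frac{\sqrt3}{24}(d^3q^2+3d^2u_1q+3du_1^2)$, $$Z_1^{(1)}=2\,\frac{B_1^{(1)}\sin P_a^{(1)}+C_1^{(1)}\sinh P_b^{(1)}}{\cos P_a^{(1)}+\cosh P_b^{(1)}},$$ $$X_1^{(1)}=2\left(\frac{\sin P_a^{(1)}}{\cosh P_b^{(1)}}B_1^{(1)}+\frac{\sinh P_b^{(1)}}{\cosh P_b^{(1)}}C_1^{(1)}\right),$$ $$X_2^{(1)}=2\left(\frac{\sin P_a^{(1)}}{\cosh P_b^{(1)}}B_2^{(1)}+B_1^{(1)}\frac{Q_a^{(1)}\cos P_a^{(1)}}{\cosh P_b^{(1)}}+\frac{\sinh P_b^{(1)}}{\cosh P_b^{(1)}}C_2^{(1)}+C_1^{(1)}Q_b^{(1)}\right),$$ $$X_3^{(1)}=2\left(B_1^{(1)}\frac{\cos P_a^{(1)}}{\cosh P_b^{(1)}}+\sqrt3\,C_1^{(1)}\right),\qquad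 Y_1^{(1)}=1+\frac{\cos P_a^{(1)}}{\cosh P_b^{(1)}},$$ $$Y_2^{(1)}=-\frac{Q_a^{(1)}\sin P_a^{(1)}}{\cosh P_b^{(1)}}+\frac{Q_b^{(1)}\sinh P_b^{(1)}}{\cosh P_b^{(1)}},\qquad Y_3^{(1)}=-\frac{\sin P_a^{(1)}}{\cosh P_b^{(1)}}+\frac{\sqrt3\sinh P_b^{(1)}}{\cosh P_b^{(1)}}.$$ Superscript $(2)$ (functions of $w_1$, with $d=d_{2,j}$): $P_a^{(2)}=qd+w_1$, $P_b^{(2)}=\sqrt3(qd+w_1)$, $B_1^{(2)}=1+\frac{3}{16}d^2$, $C_1^{(2)}=\frac{\sqrt3}{16}d^2$, $B_2^{(2)}=\frac{3dw_1}{8}$, $C_2^{(2)}=\frac{\sqrt3dw_1}{8}$, $Q_a^{(2)}=-\frac18(d^3q^2+3d^2w_1q+3dw_1^2)$, $Q_b^{(2)}=-\frac{\sqrt3}{24}(d^3q^2+3d^2w_1q+3dw_1^2)$, $$Z_1^{(2)}=2\,\frac{B_1^{(2)}\sin P_a^{(2)}-C_1^{(2)}\sinh P_b^{(2)}}{-\cos P_a^{(2)}+\cosh P_b^{(2)}},$$ $$X_1^{(2)}=2\left(-\frac{\sin P_a^{(2)}}{\cosh P_b^{(2)}}B_1^{(2)}+\frac{\sinh P_b^{(2)}}{\cosh P_b^{(2)}}C_1^{(2)}\right),$$ $$X_2^{(2)}=2\left(-\frac{\sin P_a^{(2)}}{\cosh P_b^{(2)}}B_2^{(2)}-B_1^{(2)}\frac{Q_a^{(2)}\cos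 P_a^{(2)}}{\cosh P_b^{(2)}}+\frac{\sinh P_b^{(2)}}{\cosh P_b^{(2)}}C_2^{(2)}+C_1^{(2)}Q_b^{(2)}\right),$$ $$X_3^{(2)}=2\left(-B_1^{(2)}\frac{\cos P_a^{(2)}}{\cosh P_b^{(2)}}+\sqrt3\,C_1^{(2)}\right),\qquad Y_1^{(2)}=1-\frac{\cos P_a^{(2)}}{\cosh P_b^{(2)}},$$ $$Y_2^{(2)}=\frac{Q_a^{(2)}\sin P_a^{(2)}}{\cosh P_b^{(2)}}+\frac{Q_b^{(2)}\sinh P_b^{(2)}}{\cosh P_b^{(2)}},\qquad Y_3^{(2)}=\frac{\sin P_a^{(2)}}{\cosh P_b^{(2)}}+\frac{\sqrt3\sinh P_b^{(2)}}{\cosh P_b^{(2)}}.$$ For $i=1,2$: $$Z_2^{(i)}=\frac{X_2^{(i)}Y_1^{(i)}-X_1^{(i)}Y_2^{(i)}}{(Y_1^{(i)})^2},\qquad Z_3^{(i)}=\frac{X_3^{(i)}Y_1^{(i)}-X_1^{(i)}Y_3^{(i)}}{(Y_1^{(i)})^2},\qquad R^{(i)}=\frac{Z_2^{(i)}}{1+(Z_1^{(i)})^2-Z_3^{(i)}}.$$ *)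

theory Defs
  imports "HOL-Analysis.Analysis" "Jordan_Normal_Form.Char_Poly"
begin

definition symb :: "complex \<Rightarrow> complex" where
  "symb t = (t - 2 + 1 / t) ^ 3"

definition fourier_coeff :: "(complex \<Rightarrow> complex) \<Rightarrow> int \<Rightarrow> complex" where
  "fourier_coeff a l =
     integral {0..2 * pi} (\<lambda>\<theta>. a (cis \<theta>) * cis (- (of_int l * \<theta>))) / of_real (2 * pi)"

definition toeplitz :: "(complex \<Rightarrow> complex) \<Rightarrow> nat \<Rightarrow> complex mat" where
  "toeplitz a n = mat n n (\<lambda>(j, k). fourier_coeff a (int j - int k))"

text \<open>The symbol is real on the unit circle, so taking the real part loses nothing;
  see the two lemmas after the definition.\<close>

definition g :: "real \<Rightarrow> real" where
  "g \<phi> = Re (symb (cis \<phi>))"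

lemma symb_cis: "symb (cis \<phi>) = of_real (- ((2 * sin (\<phi> / 2)) ^ 6))"
proof -
  have c: "cos \<phi> = 1 - 2 * (sin (\<phi> / 2))\<^sup>2"
    using cos_double_sin[of "\<phi> / 2"] by simp
  have "cis \<phi> - 2 + 1 / cis \<phi> = of_real (- ((2 * sin (\<phi> / 2))\<^sup>2))"
    by (auto simp: complex_eq_iff c power_mult_distrib simp flip: inverse_eq_divide)
  then have "symb (cis \<phi>) = (of_real (- ((2 * sin (\<phi> / 2))\<^sup>2))) ^ 3"
    by (simp add: symb_def)
  also have "\<dots> = of_real ((- ((2 * sin (\<phi> / 2))\<^sup>2)) ^ 3)"
    by (simp only: of_real_power)
  also have "(- ((2 * sin (\<phi> / 2))\<^sup>2)) ^ 3 = - ((2 * sin (\<phi> / 2)) ^ 6)"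
    by (simp add: power_mult [symmetric] del: power_mult_distrib)
  finally show ?thesis .
qed

lemma g_eq: "g \<phi> = - ((2 * sin (\<phi> / 2)) ^ 6)"
  and g_symb: "symb (cis \<phi>) = of_real (g \<phi>)"
  by (simp_all only: g_def symb_cis Re_complex_of_real)

definition q :: "nat \<Rightarrow> real" where
  "q n = (real n + 3) / 2"

definition d1 :: "nat \<Rightarrow> nat \<Rightarrow> real" where
  "d1 n j = 2 * pi * real j / (real n + 3)"

definition d2 :: "nat \<Rightarrow> nat \<Rightarrow> real" where
  "d2 n j = (2 * real j + 1) * pi / (real n + 3)"


definition is_beta :: "(real \<Rightarrow> complex) \<Rightarrow> bool" where
  "is_beta \<beta> \<longleftrightarrow>
     continuous_on {0..pi} \<beta> \<and> \<beta> 0 = 0 \<and>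
     (\<forall>\<phi>\<in>{0..pi}. cos (\<beta> \<phi>) = 1 - (1 - of_real (cos \<phi>)) * cis (2 * pi / 3)) \<and>
     (\<forall>\<phi>\<in>{0<..<pi}. \<exists>Bs \<psi>s. Bs > 0 \<and> \<psi>s \<in> {pi / 4<..<pi / 3} \<and>
        sin (\<beta> \<phi>) = of_real Bs * cis \<psi>s)"

text \<open>These conditions determine the branch uniquely on \<open>[0, \<pi>]\<close>: they fix its cosine and sine,
  hence its values up to multiples of \<open>2\<pi>\<close>, and continuity together with the value at 0 does the
  rest. The principal branch \<open>Arccos\<close> satisfies them. Only values in \<open>(0, \<pi>)\<close> are used below,
  so the choice operator is harmless.\<close>

definition beta :: "real \<Rightarrow> complex" where
  "beta = (SOME \<beta>. is_beta \<beta>)"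

definition c_fun :: "real \<Rightarrow> real" where "c_fun \<phi> = Re (beta \<phi>)"
definition b_fun :: "real \<Rightarrow> real" where "b_fun \<phi> = Im (beta \<phi>)"
definition B_fun :: "real \<Rightarrow> real" where "B_fun \<phi> = Re (sin (beta \<phi>) * cis (- (pi / 3)))"
definition C_fun :: "real \<Rightarrow> real" where "C_fun \<phi> = - Im (sin (beta \<phi>) * cis (- (pi / 3)))"

definition f_fun :: "nat \<Rightarrow> real \<Rightarrow> real" where
  "f_fun n \<phi> =
     2 * ((B_fun \<phi> * sin ((real n + 3) * c_fun \<phi>) + C_fun \<phi> * sinh ((real n + 3) * b_fun \<phi>))
        / (sin \<phi> * (cos ((real n + 3) * c_fun \<phi>) + cosh ((real n + 3) * b_fun \<phi>))))"

definition h_fun :: "nat \<Rightarrow> real \<Rightarrow> real" where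
  "h_fun n \<phi> =
     2 * ((B_fun \<phi> * sin ((real n + 3) * c_fun \<phi>) - C_fun \<phi> * sinh ((real n + 3) * b_fun \<phi>))
        / (sin \<phi> * (- cos ((real n + 3) * c_fun \<phi>) + cosh ((real n + 3) * b_fun \<phi>))))"

definition phi_odd :: "nat \<Rightarrow> nat \<Rightarrow> real" where
  "phi_odd n j =
     (THE \<phi>. \<phi> \<in> {pi * (2 * real j - 1) / (real n + 3)<..<pi * (2 * real j + 1) / (real n + 3)} \<and>
             tan ((real n + 3) / 2 * \<phi>) = f_fun n \<phi>)"

definition phi_even :: "nat \<Rightarrow> nat \<Rightarrow> real" where
  "phi_even n j =
     (THE \<phi>. \<phi> \<in> {2 * pi * real j / (real n + 3)<..<2 * pi * (real j + 1) / (real n + 3)} \<and>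
             cos ((real n + 3) / 2 * \<phi>) = h_fun n \<phi> * sin ((real n + 3) / 2 * \<phi>))"

definition phi :: "nat \<Rightarrow> nat \<Rightarrow> real" where
  "phi n m = (if odd m then phi_odd n ((m + 1) div 2) else phi_even n (m div 2))"

definition lam :: "nat \<Rightarrow> nat \<Rightarrow> real" where
  "lam n m = g (phi n m)"


text \<open>The functions with superscripts (1) and (2). Those given by the same formula in both cases
  are defined once; the argument \<open>d\<close> is \<open>d1 n j\<close> for superscript (1) and \<open>d2 n j\<close> for
  superscript (2), and the argument \<open>u\<close> plays the role of \<open>u\<^sub>1\<close>, respectively \<open>w\<^sub>1\<close>.\<close>

definition Pa :: "nat \<Rightarrow> real \<Rightarrow> real \<Rightarrow> real" where "Pa n d u = q n * d + u"
definition Pb :: "nat \<Rightarrow> real \<Rightarrow> real \<Rightarrow> real" where "Pb n d u = sqrt 3 * (q n * d + u)"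
definition B1 :: "real \<Rightarrow> real" where "B1 d = 1 + 3 / 16 * d\<^sup>2"
definition C1 :: "real \<Rightarrow> real" where "C1 d = sqrt 3 / 16 * d\<^sup>2"
definition B2 :: "real \<Rightarrow> real \<Rightarrow> real" where "B2 d u = 3 * d * u / 8"
definition C2 :: "real \<Rightarrow> real \<Rightarrow> real" where "C2 d u = sqrt 3 * d * u / 8"
definition Qa :: "nat \<Rightarrow> real \<Rightarrow> real \<Rightarrow> real" where
  "Qa n d u = - (1 / 8) * (d ^ 3 * (q n)\<^sup>2 + 3 * d\<^sup>2 * u * q n + 3 * d * u\<^sup>2)"
definition Qb :: "nat \<Rightarrow> real \<Rightarrow> real \<Rightarrow> real" where
  "Qb n d u = - (sqrt 3 / 24) * (d ^ 3 * (q n)\<^sup>2 + 3 * d\<^sup>2 * u * q n + 3 * d * u\<^sup>2)"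

definition Z1_1 :: "nat \<Rightarrow> real \<Rightarrow> real \<Rightarrow> real" where
  "Z1_1 n d u = 2 * ((B1 d * sin (Pa n d u) + C1 d * sinh (Pb n d u))
                    / (cos (Pa n d u) + cosh (Pb n d u)))"
definition X1_1 :: "nat \<Rightarrow> real \<Rightarrow> real \<Rightarrow> real" where
  "X1_1 n d u = 2 * (sin (Pa n d u) / cosh (Pb n d u) * B1 d
                   + sinh (Pb n d u) / cosh (Pb n d u) * C1 d)"
definition X2_1 :: "nat \<Rightarrow> real \<Rightarrow> real \<Rightarrow> real" where
  "X2_1 n d u = 2 * (sin (Pa n d u) / cosh (Pb n d u) * B2 d u
                   + B1 d * (Qa n d u * cos (Pa n d u) / cosh (Pb n d u))
                   + sinh (Pb n d u) / cosh (Pb n d u) * C2 d u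
                   + C1 d * Qb n d u)"
definition X3_1 :: "nat \<Rightarrow> real \<Rightarrow> real \<Rightarrow> real" where
  "X3_1 n d u = 2 * (B1 d * (cos (Pa n d u) / cosh (Pb n d u)) + sqrt 3 * C1 d)"
definition Y1_1 :: "nat \<Rightarrow> real \<Rightarrow> real \<Rightarrow> real" where
  "Y1_1 n d u = 1 + cos (Pa n d u) / cosh (Pb n d u)"
definition Y2_1 :: "nat \<Rightarrow> real \<Rightarrow> real \<Rightarrow> real" where
  "Y2_1 n d u = - (Qa n d u * sin (Pa n d u) / cosh (Pb n d u))
                + Qb n d u * sinh (Pb n d u) / cosh (Pb n d u)"
definition Y3_1 :: "nat \<Rightarrow> real \<Rightarrow> real \<Rightarrow> real" where
  "Y3_1 n d u = - (sin (Pa n d u) / cosh (Pb n d u))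
                + sqrt 3 * sinh (Pb n d u) / cosh (Pb n d u)"

definition Z1_2 :: "nat \<Rightarrow> real \<Rightarrow> real \<Rightarrow> real" where
  "Z1_2 n d w = 2 * ((B1 d * sin (Pa n d w) - C1 d * sinh (Pb n d w))
                    / (- cos (Pa n d w) + cosh (Pb n d w)))"
definition X1_2 :: "nat \<Rightarrow> real \<Rightarrow> real \<Rightarrow> real" where
  "X1_2 n d w = 2 * (- (sin (Pa n d w) / cosh (Pb n d w)) * B1 d
                   + sinh (Pb n d w) / cosh (Pb n d w) * C1 d)"
definition X2_2 :: "nat \<Rightarrow> real \<Rightarrow> real \<Rightarrow> real" where
  "X2_2 n d w = 2 * (- (sin (Pa n d w) / cosh (Pb n d w)) * B2 d w
                   - B1 d * (Qa n d w * cos (Pa n d w) / cosh (Pb n d w))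
                   + sinh (Pb n d w) / cosh (Pb n d w) * C2 d w
                   + C1 d * Qb n d w)"
definition X3_2 :: "nat \<Rightarrow> real \<Rightarrow> real \<Rightarrow> real" where
  "X3_2 n d w = 2 * (- (B1 d * (cos (Pa n d w) / cosh (Pb n d w))) + sqrt 3 * C1 d)"
definition Y1_2 :: "nat \<Rightarrow> real \<Rightarrow> real \<Rightarrow> real" where
  "Y1_2 n d w = 1 - cos (Pa n d w) / cosh (Pb n d w)"
definition Y2_2 :: "nat \<Rightarrow> real \<Rightarrow> real \<Rightarrow> real" where
  "Y2_2 n d w = Qa n d w * sin (Pa n d w) / cosh (Pb n d w)
                + Qb n d w * sinh (Pb n d w) / cosh (Pb n d w)"
definition Y3_2 :: "nat \<Rightarrow> real \<Rightarrow> real \<Rightarrow> real" where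
  "Y3_2 n d w = sin (Pa n d w) / cosh (Pb n d w)
                + sqrt 3 * sinh (Pb n d w) / cosh (Pb n d w)"

definition Z2_1 :: "nat \<Rightarrow> real \<Rightarrow> real \<Rightarrow> real" where
  "Z2_1 n d u = (X2_1 n d u * Y1_1 n d u - X1_1 n d u * Y2_1 n d u) / (Y1_1 n d u)\<^sup>2"
definition Z3_1 :: "nat \<Rightarrow> real \<Rightarrow> real \<Rightarrow> real" where
  "Z3_1 n d u = (X3_1 n d u * Y1_1 n d u - X1_1 n d u * Y3_1 n d u) / (Y1_1 n d u)\<^sup>2"
definition R_1 :: "nat \<Rightarrow> real \<Rightarrow> real \<Rightarrow> real" where
  "R_1 n d u = Z2_1 n d u / (1 + (Z1_1 n d u)\<^sup>2 - Z3_1 n d u)"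

definition Z2_2 :: "nat \<Rightarrow> real \<Rightarrow> real \<Rightarrow> real" where
  "Z2_2 n d w = (X2_2 n d w * Y1_2 n d w - X1_2 n d w * Y2_2 n d w) / (Y1_2 n d w)\<^sup>2"
definition Z3_2 :: "nat \<Rightarrow> real \<Rightarrow> real \<Rightarrow> real" where
  "Z3_2 n d w = (X3_2 n d w * Y1_2 n d w - X1_2 n d w * Y3_2 n d w) / (Y1_2 n d w)\<^sup>2"
definition R_2 :: "nat \<Rightarrow> real \<Rightarrow> real \<Rightarrow> real" where
  "R_2 n d w = Z2_2 n d w / (1 + (Z1_2 n d w)\<^sup>2 - Z3_2 n d w)"


definition large_j :: "nat \<Rightarrow> nat \<Rightarrow> bool" where
  "large_j n j \<longleftrightarrow> 1 / 2 * exp (pi * (real j - 1)) > (q n)\<^sup>2"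

definition outer1 :: "real \<Rightarrow> real" where
  "outer1 d = arctan (2 * C_fun d / sin d)"
definition outer2 :: "real \<Rightarrow> real" where
  "outer2 d = 2 * ((deriv C_fun d * sin d - C_fun d * cos d) / ((sin d)\<^sup>2 + 4 * (C_fun d)\<^sup>2))
              * arctan (2 * C_fun d / sin d)"

definition u1 :: "nat \<Rightarrow> nat \<Rightarrow> real" where
  "u1 n j = (if large_j n j then outer1 (d1 n j)
             else (THE u. u \<in> {- (pi / 2)<..<pi / 2} \<and> u = arctan (Z1_1 n (d1 n j) u)))"
definition u2 :: "nat \<Rightarrow> nat \<Rightarrow> real" where
  "u2 n j = (if large_j n j then outer2 (d1 n j) else R_1 n (d1 n j) (u1 n j))"

definition w1 :: "nat \<Rightarrow> nat \<Rightarrow> real" where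
  "w1 n j = (if large_j n j then outer1 (d2 n j)
             else (THE w. w \<in> {- (pi / 2)<..<pi / 2} \<and> w = - arctan (Z1_2 n (d2 n j) w)))"
definition w2 :: "nat \<Rightarrow> nat \<Rightarrow> real" where
  "w2 n j = (if large_j n j then outer2 (d2 n j) else R_2 n (d2 n j) (w1 n j))"

end

theory Submission
  imports Defs
begin

text \<open>
  Write \<open>\<omega> = cis (2 * pi / 3)\<close>, \<open>\<zeta> = cis (pi / 3)\<close> and \<open>N = q n = (n + 3) / 2\<close>.

  \<^bold>\<open>The eigenvalue equation.\<close> Away from the ends of the index range the matrix acts as the third power
  of the second difference. The exponentials \<open>exp (i z y)\<close> that this operator multiplies by \<open>g \<phi>\<close> are
  those with \<open>1 - cos z = \<omega>^r (1 - cos \<phi>)\<close> for \<open>r = 0, 1, 2\<close>, that is \<open>z = \<phi>\<close>, \<open>z = \<beta> \<phi>\<close> and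
  \<open>z = cnj (\<beta> \<phi>)\<close>, up to sign. Centring the index range, so that \<open>y\<close> runs from \<open>2 - N\<close> to
  \<open>N - 2\<close>, and splitting into vectors that are even or odd under reflection, one looks for
  combinations of \<open>cos (z y - \<theta>)\<close> with \<open>\<theta> = 0\<close> or \<open>\<theta> = pi / 2\<close> that vanish at
  \<open>N - 1\<close>, \<open>N\<close> and \<open>N + 1\<close>. Vanishing at \<open>N\<close>, and of the sum of the values at the other two points,
  forces the coefficients to be \<open>\<omega>^r / cos (z N - \<theta>)\<close>; the remaining condition becomes \<open>tan (N \<phi> - \<theta>) = secular N \<theta> \<phi>\<close>, where
  \<open>secular N \<theta> \<phi> = 2 Re (\<sigma> \<phi> tan (N \<beta> - \<theta>))\<close> and \<open>\<sigma> = sin \<beta> / (\<zeta> sin \<phi>)\<close>.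
  For \<open>\<theta> = 0\<close> the right-hand side is \<open>f\<close>, for \<open>\<theta> = pi / 2\<close> it is \<open>- h\<close>, so that odd and even
  indices are treated together throughout.

  \<^bold>\<open>Roots.\<close> With \<open>\<phi> = d + u / N\<close> the equation reads \<open>u = arctan (secular N \<theta> (d + u / N))\<close>,
  which has exactly one solution as soon as \<open>secular_deriv < N (1 + secular\<^sup>2)\<close>
  (\<open>arctan_fixpoint_unique\<close>). The identity \<open>\<sigma> \<beta>' = \<zeta>\<close> gives
  \<open>secular_deriv = 2 Re (\<sigma>' tan (N \<beta> - \<theta>)) + 2 N Re (\<zeta> / cos\<^sup>2 (N \<beta> - \<theta>))\<close>. In the second summand
  the factor of \<open>N\<close> is at most \<open>4 / 5\<close> because \<open>N Im \<beta> \<ge> 5 / 4\<close> on all the intervals in question;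
  the first summand is bounded away from \<open>\<phi> = pi\<close>, and close to \<open>pi\<close> its growth is compensated by
  that of \<open>secular\<^sup>2\<close> (\<open>secular_deriv_less\<close>).

  \<^bold>\<open>Characteristic polynomial.\<close> The \<open>n\<close> eigenvectors obtained in this way are pairwise
  orthogonal: those of equal parity belong to different eigenvalues of a symmetric matrix, those of
  opposite parity are orthogonal by reflection. Hence they diagonalise the matrix, whether or not
  eigenvalues of opposite parity coincide.

  \<^bold>\<open>Expansion.\<close> If \<open>exp (pi (j - 1)) / 2 > N\<^sup>2\<close>, then \<open>tan (N \<beta> - \<theta>) = i + O (1 / N\<^sup>3)\<close> at
  the root, so that \<open>u = \<eta> (d + u / N) + O (1 / N\<^sup>2)\<close> with \<open>\<eta> = arctan (- 2 Im \<sigma>)\<close>. As \<open>\<eta>'\<close>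
  extends continuously to \<open>[0, pi]\<close>, this gives \<open>u = \<eta> d + \<eta>' d \<eta> d / N + o (1 / N)\<close> uniformly
  in \<open>d\<close>, and Taylor's formula for \<open>g\<close> yields the claim. Otherwise \<open>d = O (log N / N)\<close>; since
  \<open>g\<close> vanishes to order six at 0, every single term of the expansion is then
  \<open>O ((log N / N)^4) = o (1 / N\<^sup>2)\<close>, provided that \<open>u\<^sub>1\<close> and \<open>u\<^sub>2\<close> are well defined and bounded.
  That holds because \<open>Z\<^sub>3\<close> is the derivative of \<open>Z\<^sub>1\<close> (of \<open>- Z\<^sub>1\<close> for superscript (2)) and is at most
  \<open>21 / 25\<close>, by the same estimate of \<open>1 / cos\<^sup>2\<close> as above.
\<close>

section \<open>The branch of the arccosine\<close>

text \<open>
  Half-angle form of the branch: \<open>tau \<phi>\<close> is \<open>cos (\<beta> \<phi> / 2)\<close>, while \<open>sin (\<beta> \<phi> / 2)\<close> is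
  \<open>cis (pi / 3) * sin (\<phi> / 2)\<close>. The radicand has positive real part, so the principal root is smooth.
\<close>
definition tau :: "real \<Rightarrow> complex" where
  "tau \<phi> = csqrt (1 - cis (2 * pi / 3) * of_real ((sin (\<phi> / 2))\<^sup>2))"

text \<open>
  This is \<open>sin (\<beta> \<phi>) / (cis (pi / 3) * sin \<phi>)\<close> after cancelling the common factor
  \<open>2 * sin (\<phi> / 2)\<close>; its only singularity on \<open>[0, pi]\<close> is the simple pole at \<open>pi\<close>.
\<close>
definition sigma :: "real \<Rightarrow> complex" where
  "sigma \<phi> = tau \<phi> / of_real (cos (\<phi> / 2))"

definition beta_arcsin :: "real \<Rightarrow> complex" where
  "beta_arcsin \<phi> = 2 * Arcsin (cis (pi / 3) * of_real (sin (\<phi> / 2)))"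

lemma cis_third: "cis (2 * pi / 3) = Complex (- 1 / 2) (sqrt 3 / 2)"
  by (simp add: cis.ctr cos_120 sin_120)

lemma cis_sixth: "cis (pi / 3) = Complex (1 / 2) (sqrt 3 / 2)"
  by (simp add: cis.ctr cos_60 sin_60)

lemma cis_sixth_square: "(cis (pi / 3))\<^sup>2 = cis (2 * pi / 3)"
  by (simp add: power2_eq_square cis_mult)

lemma tau_square: "(tau \<phi>)\<^sup>2 = 1 - cis (2 * pi / 3) * of_real ((sin (\<phi> / 2))\<^sup>2)"
  by (simp add: tau_def)

lemma tau_arg_pos: "Re (1 - cis (2 * pi / 3) * of_real ((sin (\<phi> / 2))\<^sup>2)) > 0"
proof -
  have "Re (1 - cis (2 * pi / 3) * of_real ((sin (\<phi> / 2))\<^sup>2)) = 1 + (sin (\<phi> / 2))\<^sup>2 / 2"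
    unfolding cis_third by simp
  then show ?thesis using zero_le_power2[of "sin (\<phi> / 2)"] by linarith
qed

lemma tau_square_Re: "(Re (tau \<phi>))\<^sup>2 - (Im (tau \<phi>))\<^sup>2 = 1 + (sin (\<phi> / 2))\<^sup>2 / 2"
  and tau_square_Im: "2 * Re (tau \<phi>) * Im (tau \<phi>) = - (sqrt 3 / 2) * (sin (\<phi> / 2))\<^sup>2"
proof -
  have "Re ((tau \<phi>)\<^sup>2) = 1 + (sin (\<phi> / 2))\<^sup>2 / 2"
    unfolding tau_square by (simp add: cis_third)
  then show "(Re (tau \<phi>))\<^sup>2 - (Im (tau \<phi>))\<^sup>2 = 1 + (sin (\<phi> / 2))\<^sup>2 / 2"
    by (simp add: Re_power2)
  have "Im ((tau \<phi>)\<^sup>2) = - (sqrt 3 / 2) * (sin (\<phi> / 2))\<^sup>2"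
    unfolding tau_square by (simp add: cis_third)
  then show "2 * Re (tau \<phi>) * Im (tau \<phi>) = - (sqrt 3 / 2) * (sin (\<phi> / 2))\<^sup>2"
    by (simp add: Im_power2)
qed

lemma Re_tau_ge_1: "Re (tau \<phi>) \<ge> 1"
proof -
  have "Re (tau \<phi>) \<ge> 0" unfolding tau_def by (rule Re_csqrt)
  moreover have "(Re (tau \<phi>))\<^sup>2 \<ge> 1"
    using tau_square_Re[of \<phi>] zero_le_power2[of "sin (\<phi> / 2)"] zero_le_power2[of "Im (tau \<phi>)"]
    by linarith
  ultimately show ?thesis using power2_le_imp_le[of 1 "Re (tau \<phi>)"] by simp
qed

lemma tau_nonzero [simp]: "tau \<phi> \<noteq> 0"
  using Re_tau_ge_1[of \<phi>] by auto

lemma norm_tau_ge_1: "cmod (tau \<phi>) \<ge> 1"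
  using Re_tau_ge_1[of \<phi>] complex_Re_le_cmod[of "tau \<phi>"] by linarith

lemma norm_tau_square_le_2: "(cmod (tau \<phi>))\<^sup>2 \<le> 2"
proof -
  have "(cmod (tau \<phi>))\<^sup>2 = cmod (1 - cis (2 * pi / 3) * of_real ((sin (\<phi> / 2))\<^sup>2))"
    by (simp only: norm_power[symmetric] tau_square)
  also have "\<dots> \<le> cmod 1 + cmod (cis (2 * pi / 3) * of_real ((sin (\<phi> / 2))\<^sup>2))"
    by (rule norm_triangle_ineq4)
  also have "\<dots> \<le> 2" by (simp add: norm_mult abs_square_le_1 norm_power)
  finally show ?thesis .
qed

lemma norm_tau_le: "cmod (tau \<phi>) \<le> 3 / 2"
  by (rule power2_le_imp_le) (use norm_tau_square_le_2[of \<phi>] in \<open>auto simp: power2_eq_square\<close>)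

text \<open>
  The imaginary part of the square is \<open>- (sqrt 3 / 2) sin\<^sup>2 (\<phi> / 2)\<close>, and the real part of \<open>tau\<close>
  is at most \<open>3 / 2\<close>. The bound keeps \<open>Im sigma\<close> away from 0 near \<open>pi\<close>.
\<close>
lemma Im_tau_le: "- Im (tau \<phi>) \<ge> (sin (\<phi> / 2))\<^sup>2 / 4"
proof -
  have s3: "sqrt 3 \<ge> 17 / 10" by (rule real_le_rsqrt) (simp add: power2_eq_square)
  define p where "p = (sin (\<phi> / 2))\<^sup>2"
  define r where "r = Re (tau \<phi>)"
  define y where "y = - Im (tau \<phi>)"
  have p: "p \<ge> 0" by (simp add: p_def)
  have "r * y = sqrt 3 / 4 * p"
    using tau_square_Im[of \<phi>] by (simp add: p_def r_def y_def field_simps)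
  moreover have "sqrt 3 / 4 * p \<ge> 17 / 40 * p" using s3 p by (intro mult_right_mono) auto
  ultimately have ry: "r * y \<ge> 17 / 40 * p" by simp
  have r: "1 \<le> r" "r \<le> 3 / 2" using Re_tau_ge_1[of \<phi>] norm_tau_le[of \<phi>] complex_Re_le_cmod[of "tau \<phi>"]
    by (auto simp: r_def)
  have "r * y \<ge> 0" using ry p by linarith
  then have "y \<ge> 0" using r by (simp add: zero_le_mult_iff)
  then have "r * y \<le> 3 / 2 * y" using r by (intro mult_right_mono) auto
  with ry p have "y \<ge> p / 4" by linarith
  then show ?thesis by (simp add: p_def y_def)
qed

lemma tau_has_vector_derivative:
  "(tau has_vector_derivative
     - (cis (2 * pi / 3) * of_real (sin (\<phi> / 2) * cos (\<phi> / 2))) / (2 * tau \<phi>)) (at \<phi>)"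
proof -
  define A where "A = (\<lambda>\<phi>. 1 - cis (2 * pi / 3) * of_real ((sin (\<phi> / 2))\<^sup>2) :: complex)"
  have 1: "(A has_vector_derivative - (cis (2 * pi / 3) * of_real (sin (\<phi> / 2) * cos (\<phi> / 2)))) (at \<phi>)"
  proof -
    have "((\<lambda>\<phi>. (sin (\<phi> / 2))\<^sup>2) has_real_derivative sin (\<phi> / 2) * cos (\<phi> / 2)) (at \<phi>)"
      by (auto intro!: derivative_eq_intros)
    from has_vector_derivative_diff[OF has_vector_derivative_const
        has_vector_derivative_mult_right[OF has_vector_derivative_of_real[OF this]]]
    show ?thesis unfolding A_def by simp
  qed
  have "A \<phi> \<notin> \<real>\<^sub>\<le>\<^sub>0" using tau_arg_pos[of \<phi>] unfolding A_def by (auto simp: complex_nonpos_Reals_iff)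
  then have 2: "(csqrt has_field_derivative 1 / (2 * csqrt (A \<phi>))) (at (A \<phi>))"
    using has_field_derivative_csqrt by (simp add: field_simps inverse_eq_divide)
  have e: "csqrt \<circ> A = tau" by (auto simp: A_def tau_def)
  show ?thesis using field_vector_diff_chain_at[OF 1 2] unfolding e
    by (simp add: A_def tau_def)
qed

lemma cos_Arcsin_csqrt: "cos (Arcsin z) = csqrt (1 - z\<^sup>2)"
proof -
  have 1: "exp (\<i> * Arcsin z) = \<i> * z + csqrt (1 - z\<^sup>2)"
    by (simp add: Arcsin_def Arcsin_body_lemma)
  have "(csqrt (1 - z\<^sup>2) - \<i> * z) * (\<i> * z + csqrt (1 - z\<^sup>2)) = (csqrt (1 - z\<^sup>2))\<^sup>2 + z\<^sup>2"
    by (simp add: algebra_simps power2_eq_square)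
  then have "inverse (\<i> * z + csqrt (1 - z\<^sup>2)) = csqrt (1 - z\<^sup>2) - \<i> * z"
    by (intro inverse_unique) (simp add: mult.commute)
  then show ?thesis unfolding cos_exp_eq
    by (simp add: exp_minus 1)
qed

lemma beta_arcsin_half: "sin (beta_arcsin \<phi> / 2) = cis (pi / 3) * of_real (sin (\<phi> / 2))"
  "cos (beta_arcsin \<phi> / 2) = tau \<phi>"
  by (simp_all add: beta_arcsin_def cos_Arcsin_csqrt power_mult_distrib cis_sixth_square tau_def)

lemma sin_beta_arcsin: "sin (beta_arcsin \<phi>) = 2 * cis (pi / 3) * of_real (sin (\<phi> / 2)) * tau \<phi>"
  using sin_double[of "beta_arcsin \<phi> / 2"] by (simp add: beta_arcsin_half)

lemma cos_beta_arcsin: "cos (beta_arcsin \<phi>) = 1 - (1 - of_real (cos \<phi>)) * cis (2 * pi / 3)"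
proof -
  have r: "complex_of_real (cos \<phi>) = of_real (1 - 2 * (sin (\<phi> / 2))\<^sup>2)"
    using cos_double_sin[of "\<phi> / 2"] by simp
  have "cos (beta_arcsin \<phi>) = 1 - 2 * (sin (beta_arcsin \<phi> / 2))\<^sup>2"
    using cos_double_sin[of "beta_arcsin \<phi> / 2"] by simp
  also have "\<dots> = 1 - (1 - of_real (cos \<phi>)) * cis (2 * pi / 3)"
    unfolding beta_arcsin_half r by (simp add: power_mult_distrib cis_sixth_square)
  finally show ?thesis .
qed

lemma sin_half_pos: "0 < \<phi> \<Longrightarrow> \<phi> < pi \<Longrightarrow> sin (\<phi> / 2) > 0"
  by (rule sin_gt_zero) auto

lemma cos_half_pos: "0 < \<phi> \<Longrightarrow> \<phi> < pi \<Longrightarrow> cos (\<phi> / 2) > 0"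
  by (rule cos_gt_zero) auto

lemma cos_half_less_1: assumes "0 < \<phi>" "\<phi> < pi" shows "(sin (\<phi> / 2))\<^sup>2 < 1"
  using zero_less_power[OF cos_half_pos[OF assms], of 2] sin_cos_squared_add[of "\<phi> / 2"]
  by linarith

lemma Arcsin_arg_ok:
  "Im (cis (pi / 3) * of_real (sin (\<phi> / 2))) = 0 \<Longrightarrow> \<bar>Re (cis (pi / 3) * of_real (sin (\<phi> / 2)))\<bar> < 1"
  by (auto simp: cis_sixth)

text \<open>
  Multiplied by \<open>sigma\<close> this derivative is the constant \<open>cis (pi / 3)\<close>.
\<close>
lemma beta_arcsin_has_vector_derivative:
  "(beta_arcsin has_vector_derivative cis (pi / 3) * of_real (cos (\<phi> / 2)) / tau \<phi>) (at \<phi>)"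
proof -
  define A where "A = (\<lambda>\<phi>. cis (pi / 3) * of_real (sin (\<phi> / 2)) :: complex)"
  have 1: "(A has_vector_derivative cis (pi / 3) * of_real (cos (\<phi> / 2) / 2)) (at \<phi>)"
  proof -
    have "((\<lambda>\<phi>. sin (\<phi> / 2)) has_real_derivative cos (\<phi> / 2) / 2) (at \<phi>)"
      by (auto intro!: derivative_eq_intros)
    from has_vector_derivative_mult_right[OF has_vector_derivative_of_real[OF this]]
    show ?thesis unfolding A_def by blast
  qed
  have 2: "((\<lambda>z. 2 * Arcsin z) has_field_derivative 2 / tau \<phi>) (at (A \<phi>))"
  proof -
    have "(Arcsin has_field_derivative inverse (cos (Arcsin (A \<phi>)))) (at (A \<phi>))"
      unfolding A_def by (rule has_field_derivative_Arcsin[OF Arcsin_arg_ok])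
    moreover have "cos (Arcsin (A \<phi>)) = tau \<phi>"
      using beta_arcsin_half(2)[of \<phi>] by (simp add: beta_arcsin_def A_def)
    ultimately have "(Arcsin has_field_derivative inverse (tau \<phi>)) (at (A \<phi>))" by simp
    from DERIV_cmult[OF this, of 2] show ?thesis unfolding divide_inverse .
  qed
  have e: "(\<lambda>z. 2 * Arcsin z) \<circ> A = beta_arcsin" by (auto simp: A_def beta_arcsin_def)
  show ?thesis using field_vector_diff_chain_at[OF 1 2] unfolding e
    by (simp add: field_simps)
qed

lemma continuous_on_beta_arcsin: "continuous_on S beta_arcsin"
  by (meson beta_arcsin_has_vector_derivative has_vector_derivative_continuous continuous_at_imp_continuous_on)

text \<open>
  The argument of \<open>sin \<beta>\<close> is that of \<open>w = cis (pi / 3) * tau\<close>. It exceeds \<open>pi / 4\<close> since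
  \<open>Re (w\<^sup>2) < 0\<close>, and it is below \<open>pi / 3\<close> since \<open>Im tau < 0\<close>.
\<close>
lemma sin_beta_arcsin_sector:
  assumes "0 < \<phi>" "\<phi> < pi"
  shows "\<exists>r \<psi>. r > 0 \<and> \<psi> \<in> {pi / 4<..<pi / 3} \<and> sin (beta_arcsin \<phi>) = of_real r * cis \<psi>"
proof -
  define p where "p = (sin (\<phi> / 2))\<^sup>2"
  have p: "0 < p" "p < 1"
    unfolding p_def using zero_less_power[OF sin_half_pos[OF assms], of 2] cos_half_less_1[OF assms] by blast+
  define w where "w = cis (pi / 3) * tau \<phi>"
  have It: "Im (tau \<phi>) < 0" using Im_tau_le[of \<phi>] p unfolding p_def by linarith
  have Rt: "Re (tau \<phi>) > 0" using Re_tau_ge_1[of \<phi>] by simp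
  have w2: "w\<^sup>2 = cis (2 * pi / 3) * (1 - cis (2 * pi / 3) * of_real p)"
    unfolding w_def power_mult_distrib cis_sixth_square tau_square p_def ..
  have Rw: "Re w = Re (tau \<phi>) / 2 - sqrt 3 / 2 * Im (tau \<phi>)"
    unfolding w_def cis_sixth times_complex.sel complex.sel by simp
  have "sqrt 3 / 2 * Im (tau \<phi>) < 0" using It by (intro mult_pos_neg) auto
  then have Rw_pos: "Re w > 0" using Rt unfolding Rw by linarith
  have "w\<^sup>2 = Complex ((p - 1) / 2) (sqrt 3 / 2 * (1 + p))"
    unfolding w2 cis_third by (rule complex_eqI) (simp_all add: algebra_simps)
  then have "Im (w\<^sup>2) = sqrt 3 / 2 * (1 + p)" and Re_w2: "Re (w\<^sup>2) = (p - 1) / 2" by simp_all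
  moreover have "sqrt 3 / 2 * (1 + p) > 0" using p by (intro mult_pos_pos) auto
  ultimately have "Re w * Im w > 0" unfolding Im_power2 by simp
  then have Iw_pos: "Im w > 0" using Rw_pos by (simp add: zero_less_mult_iff)
  have "(p - 1) / 2 < 0" using p by simp
  then have "(Re w)\<^sup>2 < (Im w)\<^sup>2" using Re_w2 unfolding Re_power2 by linarith
  then have lower: "Re w < Im w" using Iw_pos by (simp add: power2_less_imp_less)
  have "tau \<phi> = cis (- (pi / 3)) * w" unfolding w_def mult.assoc[symmetric] cis_mult by simp
  then have "Im (tau \<phi>) = Im w / 2 - sqrt 3 / 2 * Re w"
    by (simp only: times_complex.sel cis.sel cos_minus sin_minus cos_60 sin_60)
  then have upper: "Im w < sqrt 3 * Re w" using It by simp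
  define \<psi> where "\<psi> = arctan (Im w / Re w)"
  have "arctan 1 < \<psi>" unfolding \<psi>_def arctan_less_iff using lower Rw_pos by simp
  moreover have "\<psi> < arctan (sqrt 3)" unfolding \<psi>_def arctan_less_iff using upper Rw_pos by (simp add: field_simps)
  moreover have "arctan (sqrt 3) = pi / 3"
    using arctan_tan[of "pi / 3"] by (simp add: tan_60)
  ultimately have \<psi>: "\<psi> \<in> {pi / 4<..<pi / 3}" by (simp add: arctan_one)
  have ne: "w \<noteq> 0" using Rw_pos by auto
  have "tan \<psi> = Im w / Re w" by (simp add: \<psi>_def tan_arctan)
  moreover have "cos \<psi> > 0" using \<psi> by (intro cos_gt_zero) auto
  ultimately have "sin \<psi> * Re w = Im w * cos \<psi>" using Rw_pos by (simp add: tan_def field_simps)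
  then have "w = of_real (Re w / cos \<psi>) * cis \<psi>"
    using \<open>cos \<psi> > 0\<close> by (simp add: complex_eq_iff field_simps)
  moreover have "sin (beta_arcsin \<phi>) = of_real (2 * sin (\<phi> / 2)) * w"
    by (simp add: sin_beta_arcsin w_def)
  ultimately have "sin (beta_arcsin \<phi>) = of_real (2 * sin (\<phi> / 2) * (Re w / cos \<psi>)) * cis \<psi>"
    by (metis mult.assoc of_real_mult)
  moreover have "2 * sin (\<phi> / 2) * (Re w / cos \<psi>) > 0"
    using sin_half_pos[OF assms] Rw_pos \<open>cos \<psi> > 0\<close> by simp
  ultimately show ?thesis using \<psi> by blast
qed

lemma is_beta_beta_arcsin: "is_beta beta_arcsin"
  unfolding is_beta_def
  using sin_beta_arcsin_sector by (auto simp: continuous_on_beta_arcsin cos_beta_arcsin beta_arcsin_def[of 0])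

text \<open>
  The sector condition fixes the sign of the sine, so two branches have the same cosine and the same
  sine and differ by a multiple of \<open>2 * pi\<close>; by connectedness this multiple is the one at 0.
\<close>
lemma is_beta_unique:
  assumes "is_beta \<beta>" "\<phi> \<in> {0<..<pi}"
  shows "\<beta> \<phi> = beta_arcsin \<phi>"
proof -
  note spec = assms(1)[unfolded is_beta_def]
  note cont = conjunct1[OF spec]
  note zero = conjunct1[OF conjunct2[OF spec]]
  note cosine = conjunct1[OF conjunct2[OF conjunct2[OF spec]]]
  note sine = conjunct2[OF conjunct2[OF conjunct2[OF spec]]]
  \<comment> \<open>integer-valued on \<open>[0, pi)\<close>; the sector condition says nothing at \<open>pi\<close>\<close>
  define D where "D = (\<lambda>\<phi>. (\<beta> \<phi> - beta_arcsin \<phi>) / of_real (2 * pi))"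
  have Re_pos: "Re (of_real r * cis \<psi>) > 0" if "r > 0" "\<psi> \<in> {pi / 4<..<pi / 3}" for r \<psi>
    using that by (auto intro!: mult_pos_pos cos_gt_zero)
  have D_int: "\<exists>k::int. D x = of_int k" if x: "x \<in> {0..<pi}" for x
  proof (cases "x = 0")
    case True
    then show ?thesis using zero by (auto simp: D_def beta_arcsin_def intro!: exI[of _ 0])
  next
    case False
    with x have x': "x \<in> {0<..<pi}" by auto
    have c: "cos (\<beta> x) = cos (beta_arcsin x)" unfolding cos_beta_arcsin
      by (rule bspec[OF cosine]) (use x' in auto)
    from bspec[OF sine x'] obtain r \<psi> where 1: "r > 0" "\<psi> \<in> {pi / 4<..<pi / 3}" "sin (\<beta> x) = of_real r * cis \<psi>"
      by (elim exE conjE)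
    obtain r' \<psi>' where
      2: "r' > 0" "\<psi>' \<in> {pi / 4<..<pi / 3}" "sin (beta_arcsin x) = of_real r' * cis \<psi>'"
      using sin_beta_arcsin_sector[of x] x' unfolding greaterThanLessThan_iff by blast
    have "(sin (\<beta> x))\<^sup>2 = (sin (beta_arcsin x))\<^sup>2" by (simp add: sin_squared_eq c)
    then have "sin (\<beta> x) = sin (beta_arcsin x) \<or> sin (\<beta> x) = - sin (beta_arcsin x)"
      by (simp add: power2_eq_iff)
    moreover have "sin (\<beta> x) \<noteq> - sin (beta_arcsin x)"
      using Re_pos[OF 1(1,2)] Re_pos[OF 2(1,2)] unfolding 1(3)[symmetric] 2(3)[symmetric] by auto
    ultimately have s: "sin (\<beta> x) = sin (beta_arcsin x)" by blast
    have "exp (\<i> * \<beta> x) = exp (\<i> * beta_arcsin x)" by (simp add: exp_Euler c s)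
    then obtain k :: int where k: "\<i> * \<beta> x = \<i> * beta_arcsin x + of_int (2 * k) * of_real pi * \<i>"
      by (auto simp: exp_eq)
    have "\<i> * \<beta> x = \<i> * (beta_arcsin x + of_int (2 * k) * of_real pi)"
      unfolding k by (simp only: ring_distribs mult.commute mult.left_commute)
    then have "\<beta> x = beta_arcsin x + of_int (2 * k) * of_real pi" by simp
    then have "D x = of_int k" by (simp add: D_def)
    then show ?thesis ..
  qed
  have "D constant_on {0..<pi}"
  proof (rule continuous_discrete_range_constant)
    show "continuous_on {0..<pi} D" unfolding D_def
      by (intro continuous_intros continuous_on_beta_arcsin continuous_on_subset[OF cont]) auto
    fix x assume "x \<in> {0..<pi}"
    then obtain k where k: "D x = of_int k" using D_int by blast
    have "1 \<le> norm (D y - D x)" if y: "y \<in> {0..<pi}" "D y \<noteq> D x" for y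
    proof -
      obtain l where l: "D y = of_int l" using D_int[OF y(1)] by blast
      then have "l \<noteq> k" using k y by auto
      moreover have "D y - D x = of_int (l - k)" by (simp add: k l)
      ultimately show ?thesis by (simp only: norm_of_int)
    qed
    then show "\<exists>e>0. \<forall>y. y \<in> {0..<pi} \<and> D y \<noteq> D x \<longrightarrow> e \<le> norm (D y - D x)"
      by (intro exI[of _ 1]) auto
  qed simp
  then have "D \<phi> = D 0" using assms(2) by (auto simp: constant_on_def)
  moreover have "D 0 = 0" using zero by (simp add: D_def beta_arcsin_def)
  ultimately show ?thesis by (simp add: D_def)
qed

lemma beta_eq_beta_arcsin: "0 < \<phi> \<Longrightarrow> \<phi> < pi \<Longrightarrow> beta \<phi> = beta_arcsin \<phi>"
  using is_beta_unique[of beta \<phi>] someI[of is_beta, OF is_beta_beta_arcsin] by (simp add: beta_def)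

text \<open>
  From \<open>exp (- i \<beta> / 2) = cos (\<beta> / 2) - i sin (\<beta> / 2)\<close> the number \<open>exp (Im \<beta> / 2)\<close> is the modulus of
  \<open>tau - i cis (pi / 3) sin (\<phi> / 2)\<close>, whose real part is at least \<open>1 + (sqrt 3 / 2) sin (\<phi> / 2)\<close>.
  The bound is sharp to first order at 0.
\<close>
lemma Im_beta_arcsin_ge: 
  assumes "0 \<le> \<phi>" "\<phi> \<le> pi"
  shows "Im (beta_arcsin \<phi>) \<ge> 2 * ln (1 + sqrt 3 / 2 * sin (\<phi> / 2))"
proof -
  define s where "s = sin (\<phi> / 2)"
  have s: "s \<ge> 0" unfolding s_def using assms by (intro sin_ge_zero) auto
  define w where "w = exp (- (\<i> * (beta_arcsin \<phi> / 2)))"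
  have "w = tau \<phi> - \<i> * (cis (pi / 3) * of_real s)"
    unfolding w_def s_def using exp_minus_Euler[of "beta_arcsin \<phi> / 2"] beta_arcsin_half[of \<phi>] by simp
  then have Rew: "Re w = Re (tau \<phi>) + sqrt 3 / 2 * s" by (simp add: cis_sixth)
  have pos: "1 + sqrt 3 / 2 * s > 0" using s by (simp add: add_pos_nonneg)
  have "1 + sqrt 3 / 2 * s \<le> Re w" using Rew Re_tau_ge_1[of \<phi>] by simp
  also have "\<dots> \<le> cmod w" by (rule complex_Re_le_cmod)
  also have "cmod w = exp (Im (beta_arcsin \<phi>) / 2)" by (simp add: w_def norm_exp_eq_Re)
  finally have "ln (1 + sqrt 3 / 2 * s) \<le> Im (beta_arcsin \<phi>) / 2"
    using pos by (metis ln_exp ln_le_cancel_iff exp_gt_zero)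
  then show ?thesis by (simp add: s_def)
qed

lemma Im_beta_arcsin_mono_bound:
  assumes "0 < \<delta>" "\<delta> \<le> \<phi>" "\<phi> \<le> pi"
  shows "Im (beta_arcsin \<phi>) \<ge> 2 * ln (1 + sqrt 3 / 2 * sin (\<delta> / 2))"
proof -
  have s: "sin (\<delta> / 2) \<le> sin (\<phi> / 2)" using assms by (intro sin_monotone_2pi_le) auto
  have "sin (\<delta> / 2) > 0" using assms by (intro sin_gt_zero) auto
  then have "ln (1 + sqrt 3 / 2 * sin (\<delta> / 2)) \<le> ln (1 + sqrt 3 / 2 * sin (\<phi> / 2))"
    using s by (subst ln_le_cancel_iff) (auto intro!: add_pos_nonneg mult_left_mono)
  then show ?thesis using Im_beta_arcsin_ge[of \<phi>] assms by simp
qed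

text \<open>
  Any slope below \<open>sqrt 3 / 2\<close> would do for small \<open>\<phi>\<close>. The value \<open>4 / 5\<close> is large enough both for
  \<open>N Im \<beta> \<ge> 5 / 4\<close> when \<open>N \<phi> \<ge> pi / 2\<close>, and for \<open>exp (- 2 N Im \<beta>) \<le> 1 / N^3\<close> when
  \<open>N \<phi> \<ge> 2 ln N\<close>.
\<close>
lemma Im_beta_arcsin_small:
  "\<exists>\<delta>>0. \<forall>\<phi>. 0 < \<phi> \<and> \<phi> \<le> \<delta> \<longrightarrow> Im (beta_arcsin \<phi>) \<ge> 4 / 5 * \<phi>"
proof -
  have s3: "sqrt 3 \<ge> 17 / 10" by (rule real_le_rsqrt) (simp add: power2_eq_square)
  \<comment> \<open>the difference of the bounds vanishes at 0 and has positive slope there\<close>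
  define G where "G = (\<lambda>x. 2 * ln (1 + sqrt 3 / 2 * sin (x / 2)) - 4 / 5 * x)"
  have "(G has_real_derivative (sqrt 3 / 2 - 4 / 5)) (at 0)"
    unfolding G_def by (auto intro!: derivative_eq_intros)
  moreover have "sqrt 3 / 2 - 4 / 5 > 0" using s3 by simp
  ultimately obtain d where d: "d > 0" "\<And>h. h > 0 \<Longrightarrow> h < d \<Longrightarrow> G 0 < G (0 + h)"
    using DERIV_pos_inc_right by blast
  have "Im (beta_arcsin \<phi>) \<ge> 4 / 5 * \<phi>" if "0 < \<phi>" "\<phi> \<le> min (d / 2) pi" for \<phi>
  proof -
    have "G 0 < G \<phi>" using d(2)[of \<phi>] d(1) that by auto
    then have "4 / 5 * \<phi> < 2 * ln (1 + sqrt 3 / 2 * sin (\<phi> / 2))" by (simp add: G_def)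
    then show ?thesis using Im_beta_arcsin_ge[of \<phi>] that by auto
  qed
  then show ?thesis using d(1) by (intro exI[of _ "min (d / 2) pi"]) auto
qed

section \<open>The tangent in the upper half-plane\<close>

lemma exp_five_halves: "exp (5 / 2) \<ge> (12 :: real)"
proof -
  \<comment> \<open>\<open>545 / 512 = 1 + x + x\<^sup>2 / 2\<close> at \<open>x = 1 / 16\<close>\<close>
  have "(12 :: real) \<le> (545 / 512) ^ 40" by (simp add: power_divide)
  also have "\<dots> \<le> exp (1 / 16) ^ 40"
    by (intro power_mono) (use exp_lower_Taylor_quadratic[of "1 / 16"] in \<open>simp_all add: power2_eq_square\<close>)
  also have "\<dots> = exp (5 / 2 :: real)" by (simp add: exp_of_nat_mult[symmetric])
  finally show ?thesis .
qed

lemma norm_cos_ge: fixes z :: complex assumes "Im z \<ge> 0" shows "cmod (cos z) \<ge> sinh (Im z)"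
proof -
  have "(sinh (Im z))\<^sup>2 = (exp (Im z) - inverse (exp (Im z)))\<^sup>2 / 4"
    by (simp add: sinh_def scaleR_conv_of_real power_divide exp_minus power2_eq_square field_simps)
  then have "(sinh (Im z))\<^sup>2 \<le> (cmod (cos z))\<^sup>2"
    unfolding norm_cos_squared using zero_le_power2[of "cos (Re z)"] by linarith
  then show ?thesis by (rule power2_le_imp_le) simp
qed

text \<open>
  The threshold \<open>5 / 4\<close> is what the roots with the smallest index offer (\<open>beta_arcsin_growth\<close>); the bound
  \<open>5 / 2\<close> for \<open>sinh\<^sup>2\<close> makes the factor \<open>2 / sinh\<^sup>2\<close> smaller than 1.
\<close>
lemma sinh_ge: fixes y :: real assumes "y \<ge> 5 / 4"
  shows "(sinh y)\<^sup>2 \<ge> 5 / 2" "sinh y \<ge> 2 / 5 * exp y" "exp (- (2 * y)) \<le> 1 / 12" "sinh y > 0"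
proof -
  have "(12::real) \<le> exp (5 / 2)" by (rule exp_five_halves)
  also have "\<dots> \<le> exp (2 * y)" using assms by simp
  finally have e: "exp (2 * y) \<ge> 12" .
  then have "inverse (exp (2 * y)) \<le> inverse 12" by (intro le_imp_inverse_le) auto
  then show m: "exp (- (2 * y)) \<le> 1 / 12" by (simp add: exp_minus inverse_eq_divide)
  have sh: "sinh y = (exp y - exp (- y)) / 2" by (simp add: sinh_def)
  have p: "exp y * exp y = exp (2 * y)" "exp y * exp (- y) = 1" "exp (- y) * exp (- y) = exp (- (2 * y))"
    by (simp_all add: exp_add[symmetric])
  have "(sinh y)\<^sup>2 = (exp y * exp y - 2 * (exp y * exp (- y)) + exp (- y) * exp (- y)) / 4"
    unfolding sh by (simp add: power2_eq_square algebra_simps)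
  also have "\<dots> = (exp (2 * y) - 2 + exp (- (2 * y))) / 4" unfolding p by simp
  finally have "4 * (sinh y)\<^sup>2 = exp (2 * y) - 2 + exp (- (2 * y))" by simp
  then show "(sinh y)\<^sup>2 \<ge> 5 / 2" using e exp_gt_zero[of "- (2 * y)"] by linarith
  have "exp (- y) = exp y * exp (- (2 * y))" by (simp add: exp_add[symmetric])
  also have "\<dots> \<le> exp y * (1 / 12)" using m by (intro mult_left_mono) auto
  finally have k: "exp (- y) \<le> exp y / 12" by simp
  moreover have "2 * sinh y = exp y - exp (- y)" unfolding sh by simp
  ultimately show "sinh y \<ge> 2 / 5 * exp y" using exp_gt_zero[of y] by linarith
  then show "sinh y > 0" using exp_gt_zero[of y] by linarith
qed

lemma cos_nonzero_strip: fixes z :: complex assumes "Im z \<ge> 5 / 4" shows "cos z \<noteq> 0"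
  using norm_cos_ge[of z] sinh_ge(4)[OF assms] assms by auto

lemma norm_inverse_cos_square_le:
  fixes z :: complex assumes "Im z \<ge> 5 / 4" shows "cmod (inverse ((cos z)\<^sup>2)) \<le> 2 / 5"
proof -
  have "5 / 2 \<le> (sinh (Im z))\<^sup>2" by (rule sinh_ge(1)[OF assms])
  also have "\<dots> \<le> (cmod (cos z))\<^sup>2"
    using norm_cos_ge[of z] sinh_ge(4)[OF assms] assms by (intro power_mono) auto
  finally have "inverse ((cmod (cos z))\<^sup>2) \<le> inverse (5 / 2)" by (intro le_imp_inverse_le) auto
  then show ?thesis by (simp add: norm_inverse norm_power)
qed

text \<open>
  Because \<open>tan z - i = - i exp (i z) / cos z\<close>.
\<close>
lemma tan_near_i:
  fixes z :: complex assumes "Im z \<ge> 5 / 4"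
  shows "cmod (tan z - \<i>) \<le> 5 / 2 * exp (- (2 * Im z))" "cmod (tan z) \<le> 5 / 4"
proof -
  have c: "cos z \<noteq> 0" by (rule cos_nonzero_strip[OF assms])
  have "tan z - \<i> = - \<i> * exp (\<i> * z) / cos z"
    unfolding exp_Euler tan_def using c by (simp add: field_simps)
  then have "cmod (tan z - \<i>) = exp (- Im z) / cmod (cos z)"
    by (simp add: norm_divide norm_mult)
  also have "\<dots> \<le> exp (- Im z) / (2 / 5 * exp (Im z))"
    using norm_cos_ge[of z] sinh_ge(2)[OF assms] assms c
    by (intro divide_left_mono mult_pos_pos) auto
  also have "\<dots> = 5 / 2 * (exp (- Im z) * exp (- Im z))"
    by (simp add: exp_minus field_simps)
  also have "exp (- Im z) * exp (- Im z) = exp (- (2 * Im z))" by (simp add: exp_add[symmetric])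
  finally show 1: "cmod (tan z - \<i>) \<le> 5 / 2 * exp (- (2 * Im z))" .
  have "cmod (tan z) \<le> cmod (tan z - \<i>) + cmod \<i>"
    using norm_triangle_ineq[of "tan z - \<i>" \<i>] by simp
  then show "cmod (tan z) \<le> 5 / 4" using 1 sinh_ge(3)[OF assms] by simp
qed

section \<open>The secular function\<close>

lemma sigma_derivative_algebra:
  fixes T :: complex
  assumes "T \<noteq> 0" "c \<noteq> 0"
  shows "T * (s / (2 * c\<^sup>2)) + - (w * (s * c)) / (2 * T) * inverse c
     = s * (T\<^sup>2 - w * c\<^sup>2) / (2 * T * c\<^sup>2)"
  using assms by (simp add: field_simps power2_eq_square)

text \<open>
  The numerator simplifies to a constant multiple of \<open>sin (\<phi> / 2)\<close> because
  \<open>tau\<^sup>2 - \<omega> cos\<^sup>2 (\<phi> / 2) = 1 - \<omega>\<close>.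
\<close>
lemma sigma_has_vector_derivative:
  assumes "0 < \<phi>" "\<phi> < pi"
  shows "(sigma has_vector_derivative
     of_real (sin (\<phi> / 2)) * (1 - cis (2 * pi / 3)) / (2 * tau \<phi> * of_real ((cos (\<phi> / 2))\<^sup>2))) (at \<phi>)"
proof -
  define s where "s = sin (\<phi> / 2)"
  define c where "c = cos (\<phi> / 2)"
  have c: "c > 0" using cos_half_pos[OF assms] by (simp add: c_def)
  have "((\<lambda>\<phi>. inverse (cos (\<phi> / 2))) has_real_derivative s / (2 * c\<^sup>2)) (at \<phi>)"
    using c by (auto intro!: derivative_eq_intros simp: c_def s_def power2_eq_square field_simps)
  from has_vector_derivative_mult[OF tau_has_vector_derivative has_vector_derivative_of_real[OF this]]
  have "((\<lambda>\<phi>. tau \<phi> * of_real (inverse (cos (\<phi> / 2)))) has_vector_derivative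
     tau \<phi> * of_real (s / (2 * c\<^sup>2)) +
     - (cis (2 * pi / 3) * of_real (s * c)) / (2 * tau \<phi>) * of_real (inverse c)) (at \<phi>)"
    by (simp add: s_def c_def)
  moreover have "(\<lambda>\<phi>. tau \<phi> * of_real (inverse (cos (\<phi> / 2)))) = sigma"
    by (rule ext) (simp only: sigma_def divide_inverse of_real_inverse)
  moreover have "tau \<phi> * of_real (s / (2 * c\<^sup>2)) +
     - (cis (2 * pi / 3) * of_real (s * c)) / (2 * tau \<phi>) * of_real (inverse c)
     = of_real s * ((tau \<phi>)\<^sup>2 - cis (2 * pi / 3) * of_real (c\<^sup>2)) / (2 * tau \<phi> * of_real (c\<^sup>2))"
    using sigma_derivative_algebra[of "tau \<phi>" "of_real c" "of_real s"] c by simp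
  moreover have "(tau \<phi>)\<^sup>2 - cis (2 * pi / 3) * of_real (c\<^sup>2)
      = 1 - cis (2 * pi / 3) * of_real (s\<^sup>2 + c\<^sup>2)"
    unfolding tau_square s_def by (simp add: algebra_simps)
  moreover have "s\<^sup>2 + c\<^sup>2 = 1" by (simp add: s_def c_def)
  ultimately show ?thesis by (simp add: s_def c_def)
qed

text \<open>
  The right-hand side of the eigenvalue equation \<open>tan (N \<phi> - \<theta>) = secular N \<theta> \<phi>\<close>: it is \<open>f\<close> for
  \<open>\<theta> = 0\<close> and \<open>- h\<close> for \<open>\<theta> = pi / 2\<close>.
\<close>
definition secular :: "real \<Rightarrow> real \<Rightarrow> real \<Rightarrow> real" where
  "secular N \<theta> \<phi> = 2 * Re (sigma \<phi> * tan (of_real N * beta_arcsin \<phi> - of_real \<theta>))"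

definition secular_deriv :: "real \<Rightarrow> real \<Rightarrow> real \<Rightarrow> real" where
  "secular_deriv N \<theta> \<phi> = 2 * Re (of_real (sin (\<phi> / 2)) * (1 - cis (2 * pi / 3)) / (2 * tau \<phi> * of_real ((cos (\<phi> / 2))\<^sup>2))
         * tan (of_real N * beta_arcsin \<phi> - of_real \<theta>))
     + 2 * N * Re (cis (pi / 3) * inverse ((cos (of_real N * beta_arcsin \<phi> - of_real \<theta>))\<^sup>2))"

lemma secular_has_derivative:
  assumes "0 < \<phi>" "\<phi> < pi" "N * Im (beta_arcsin \<phi>) \<ge> 5 / 4"
  shows "(secular N \<theta> has_real_derivative secular_deriv N \<theta> \<phi>) (at \<phi>)"
proof -
  define z where "z = (\<lambda>\<phi>. of_real N * beta_arcsin \<phi> - of_real \<theta>)"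
  define ds where "ds = of_real (sin (\<phi> / 2)) * (1 - cis (2 * pi / 3)) / (2 * tau \<phi> * of_real ((cos (\<phi> / 2))\<^sup>2))"
  have c: "cos (\<phi> / 2) \<noteq> 0" using cos_half_pos[OF assms(1,2)] by simp
  have "Im (z \<phi>) = N * Im (beta_arcsin \<phi>)" by (simp add: z_def)
  then have cz: "cos (z \<phi>) \<noteq> 0" using assms(3) by (intro cos_nonzero_strip) simp
  have dz: "(z has_vector_derivative of_real N * (cis (pi / 3) * of_real (cos (\<phi> / 2)) / tau \<phi>)) (at \<phi>)"
    using has_vector_derivative_diff[OF has_vector_derivative_mult_right[OF beta_arcsin_has_vector_derivative, of "of_real N" \<phi>]
      has_vector_derivative_const[of "of_real \<theta>"]] unfolding z_def by simp
  have dt: "((tan \<circ> z) has_vector_derivative of_real N * (cis (pi / 3) * of_real (cos (\<phi> / 2)) / tau \<phi>)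
      * inverse ((cos (z \<phi>))\<^sup>2)) (at \<phi>)"
    by (rule field_vector_diff_chain_at[OF dz DERIV_tan[OF cz]])
  have ds: "(sigma has_vector_derivative ds) (at \<phi>)"
    unfolding ds_def by (rule sigma_has_vector_derivative[OF assms(1,2)])
  have "((\<lambda>\<phi>. sigma \<phi> * (tan \<circ> z) \<phi>) has_vector_derivative
      sigma \<phi> * (of_real N * (cis (pi / 3) * of_real (cos (\<phi> / 2)) / tau \<phi>) * inverse ((cos (z \<phi>))\<^sup>2))
      + ds * (tan \<circ> z) \<phi>) (at \<phi>)"
    by (rule has_vector_derivative_mult[OF ds dt])
  also have "sigma \<phi> * (of_real N * (cis (pi / 3) * of_real (cos (\<phi> / 2)) / tau \<phi>) * inverse ((cos (z \<phi>))\<^sup>2))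
     = of_real N * (cis (pi / 3) * inverse ((cos (z \<phi>))\<^sup>2))"
    unfolding sigma_def using c by (simp add: field_simps)
  finally have "((\<lambda>\<phi>. 2 * Re (sigma \<phi> * (tan \<circ> z) \<phi>)) has_real_derivative
      2 * Re (of_real N * (cis (pi / 3) * inverse ((cos (z \<phi>))\<^sup>2)) + ds * (tan \<circ> z) \<phi>)) (at \<phi>)"
    unfolding has_real_derivative_iff_has_vector_derivative
    by (intro has_vector_derivative_mult_right bounded_linear.has_vector_derivative[OF bounded_linear_Re])
  moreover have "(\<lambda>\<phi>. 2 * Re (sigma \<phi> * (tan \<circ> z) \<phi>)) = secular N \<theta>"
    by (auto simp: secular_def z_def)
  moreover have "2 * Re (of_real N * (cis (pi / 3) * inverse ((cos (z \<phi>))\<^sup>2)) + ds * (tan \<circ> z) \<phi>) = secular_deriv N \<theta> \<phi>"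
    unfolding secular_deriv_def ds_def[symmetric] unfolding z_def by (simp only: plus_complex.sel Re_complex_of_real comp_def
       times_complex.sel Im_complex_of_real) (simp only: algebra_simps mult_zero_left diff_zero)
  ultimately show ?thesis by simp
qed

lemma norm_one_minus_omega: "cmod (1 - cis (2 * pi / 3)) \<le> 7 / 4"
proof -
  have "1 - cis (2 * pi / 3) = Complex (3 / 2) (- (sqrt 3 / 2))" 
    unfolding cis_third by (simp add: complex_eq_iff)
  then have "(cmod (1 - cis (2 * pi / 3)))\<^sup>2 = 3"
    unfolding cmod_power2 by (simp add: power_divide)
  then have "(cmod (1 - cis (2 * pi / 3)))\<^sup>2 \<le> (7 / 4)\<^sup>2" by (simp only: power_divide) simp
  then show ?thesis by (rule power2_le_imp_le) simp
qed

text \<open>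
  The part of the derivative that is proportional to \<open>N\<close> is at most \<open>4 / 5 * N\<close>, the rest is at most
  \<open>(11 / 5) / cos\<^sup>2 (\<phi> / 2)\<close>. As long as \<open>cos\<^sup>2 (\<phi> / 2) > 11 / N\<close> this is smaller than \<open>N\<close>. In the
  remaining case \<open>\<phi>\<close> is so close to \<open>pi\<close> that \<open>secular \<ge> 1 / (10 cos (\<phi> / 2))\<close>, and the square
  absorbs the rest.
\<close>
lemma secular_deriv_less:
  assumes \<phi>: "0 < \<phi>" "\<phi> < pi" and y: "N * Im (beta_arcsin \<phi>) \<ge> 5 / 4" and N: "N \<ge> 220"
    and e: "1 / 2 \<le> (sin (\<phi> / 2))\<^sup>2 \<Longrightarrow> exp (- (2 * (N * Im (beta_arcsin \<phi>)))) \<le> 1 / 50"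
  shows "secular_deriv N \<theta> \<phi> < N * (1 + (secular N \<theta> \<phi>)\<^sup>2)"
proof -
  define s where "s = sin (\<phi> / 2)"
  define c where "c = cos (\<phi> / 2)"
  define t where "t = tan (of_real N * beta_arcsin \<phi> - of_real \<theta>)"
  define C where "C = inverse ((cos (of_real N * beta_arcsin \<phi> - of_real \<theta>))\<^sup>2)"
  have c: "c > 0" using cos_half_pos[OF \<phi>] by (simp add: c_def)
  have s: "0 < s" using sin_half_pos[OF \<phi>] by (simp add: s_def)
  have s1: "s \<le> 1" by (simp add: s_def)
  have cs: "c\<^sup>2 + s\<^sup>2 = 1" by (simp add: s_def c_def)
  have Im: "Im (of_real N * beta_arcsin \<phi> - of_real \<theta>) = N * Im (beta_arcsin \<phi>)" by simp
  have t: "cmod t \<le> 5 / 4" "cmod (t - \<i>) \<le> 5 / 2 * exp (- (2 * (N * Im (beta_arcsin \<phi>))))"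
    using tan_near_i[of "of_real N * beta_arcsin \<phi> - of_real \<theta>"] y unfolding Im t_def by auto
  have "cmod C \<le> 2 / 5" unfolding C_def by (rule norm_inverse_cos_square_le) (use y in simp)
  then have C: "Re (cis (pi / 3) * C) \<le> 2 / 5"
    using complex_Re_le_cmod[of "cis (pi / 3) * C"] by (simp add: norm_mult)
  define D where "D = of_real s * (1 - cis (2 * pi / 3)) / (2 * tau \<phi> * of_real (c\<^sup>2))"
  have "cmod D = s * cmod (1 - cis (2 * pi / 3)) / (2 * cmod (tau \<phi>) * c\<^sup>2)"
    using s by (simp add: D_def norm_mult norm_divide norm_power)
  also have "\<dots> \<le> 1 * (7 / 4) / (2 * 1 * c\<^sup>2)"
    using s s1 c norm_one_minus_omega norm_tau_ge_1[of \<phi>]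
    by (intro frac_le mult_mono mult_nonneg_nonneg mult_pos_pos) auto
  finally have D: "cmod D \<le> 7 / 8 / c\<^sup>2" by simp
  have "Re (D * t) \<le> cmod D * cmod t" using complex_Re_le_cmod[of "D * t"] by (simp add: norm_mult)
  also have "\<dots> \<le> (7 / 8 / c\<^sup>2) * (5 / 4)" using D t by (intro mult_mono) auto
  finally have Dt: "2 * Re (D * t) \<le> (11 / 5) / c\<^sup>2" using c by (simp add: field_simps)
  have secular_deriv: "secular_deriv N \<theta> \<phi> = 2 * Re (D * t) + 2 * N * Re (cis (pi / 3) * C)"
    unfolding secular_deriv_def D_def t_def C_def s_def c_def ..
  have "2 * N * Re (cis (pi / 3) * C) \<le> 2 * N * (2 / 5)" using C N by (intro mult_left_mono) auto
  then have secular_deriv_le: "secular_deriv N \<theta> \<phi> \<le> (11 / 5) / c\<^sup>2 + 4 / 5 * N" using Dt unfolding secular_deriv by linarith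
  show ?thesis
  proof (cases "c\<^sup>2 * N > 11")
    case True
    then have "(11 / 5) / c\<^sup>2 < N / 5" using c by (simp add: field_simps)
    moreover have "N * (secular N \<theta> \<phi>)\<^sup>2 \<ge> 0" using N by simp
    ultimately show ?thesis using secular_deriv_le unfolding ring_distribs by linarith
  next
    case False
    have "c\<^sup>2 * 220 \<le> c\<^sup>2 * N" using N by (intro mult_left_mono) auto
    then have "c\<^sup>2 \<le> 1 / 2" using False by linarith
    then have s2: "s\<^sup>2 \<ge> 1 / 2" using cs by linarith
    then have "5 / 2 * exp (- (2 * (N * Im (beta_arcsin \<phi>)))) \<le> 1 / 20" using e unfolding s_def by linarith
    then have ti: "cmod (t - \<i>) \<le> 1 / 20" using t(2) by linarith
    have "\<bar>Re (tau \<phi> * (t - \<i>))\<bar> \<le> cmod (tau \<phi>) * cmod (t - \<i>)"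
      using abs_Re_le_cmod[of "tau \<phi> * (t - \<i>)"] by (simp add: norm_mult)
    also have "\<dots> \<le> 3 / 2 * (1 / 20)" using ti norm_tau_le[of \<phi>] by (intro mult_mono) auto
    finally have R: "Re (tau \<phi> * (t - \<i>)) \<ge> - (3 / 40)" by linarith
    have "tau \<phi> * t = tau \<phi> * (t - \<i>) + tau \<phi> * \<i>" by (simp add: algebra_simps)
    then have "Re (tau \<phi> * t) = Re (tau \<phi> * (t - \<i>)) + Re (tau \<phi> * \<i>)" by (simp only: plus_complex.sel)
    moreover have "Re (tau \<phi> * \<i>) = - Im (tau \<phi>)" by simp
    moreover have "- Im (tau \<phi>) \<ge> 1 / 8" using Im_tau_le[of \<phi>] s2 unfolding s_def by linarith
    ultimately have T: "Re (tau \<phi> * t) \<ge> 1 / 20" using R by linarith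
    have "sigma \<phi> * t = of_real (inverse c) * (tau \<phi> * t)"
      by (simp only: sigma_def c_def divide_inverse of_real_inverse mult_ac)
    then have "secular N \<theta> \<phi> = 2 * (inverse c * Re (tau \<phi> * t))"
      unfolding secular_def t_def[symmetric] by (simp only: times_complex.sel Re_complex_of_real Im_complex_of_real) simp
    moreover have "inverse c * Re (tau \<phi> * t) \<ge> inverse c * (1 / 20)" using T c by (intro mult_left_mono) auto
    ultimately have "secular N \<theta> \<phi> \<ge> (1 / 10) * inverse c" by linarith
    then have "(secular N \<theta> \<phi>)\<^sup>2 \<ge> ((1 / 10) * inverse c)\<^sup>2" using c by (intro power_mono) auto
    moreover have "((1 / 10) * inverse c)\<^sup>2 = (1 / 100) * inverse (c\<^sup>2)"
      unfolding power_mult_distrib power_inverse by (simp add: power_divide)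
    ultimately have "(secular N \<theta> \<phi>)\<^sup>2 \<ge> (1 / 100) * inverse (c\<^sup>2)" by simp
    then have "N * (secular N \<theta> \<phi>)\<^sup>2 \<ge> 220 * ((1 / 100) * inverse (c\<^sup>2))" using N by (intro mult_mono) auto
    then have "N * (secular N \<theta> \<phi>)\<^sup>2 \<ge> (11 / 5) / c\<^sup>2" using c by (simp add: field_simps)
    then show ?thesis using secular_deriv_le N unfolding ring_distribs by linarith
  qed
qed

text \<open>
  All lower bounds for \<open>N Im \<beta>\<close> that are needed: near 0 the linear bound with slope \<open>4 / 5\<close> gives
  them, away from 0 the quantity grows linearly in \<open>N\<close>.
\<close>
lemma beta_arcsin_growth:
  "\<exists>N0. \<forall>N\<ge>N0. \<forall>\<phi>. pi / 2 \<le> N * \<phi> \<and> \<phi> \<le> pi \<longrightarrow>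
      N * Im (beta_arcsin \<phi>) \<ge> 5 / 4 \<and>
      (1 / 2 \<le> (sin (\<phi> / 2))\<^sup>2 \<longrightarrow> exp (- (2 * (N * Im (beta_arcsin \<phi>)))) \<le> 1 / 50) \<and>
      (N * \<phi> \<ge> 2 * ln N \<longrightarrow> exp (- (2 * (N * Im (beta_arcsin \<phi>)))) \<le> 1 / N ^ 3)"
proof -
  obtain \<delta>0 where \<delta>0: "\<delta>0 > 0" "\<And>\<phi>. 0 < \<phi> \<Longrightarrow> \<phi> \<le> \<delta>0 \<Longrightarrow> Im (beta_arcsin \<phi>) \<ge> 4 / 5 * \<phi>"
    using Im_beta_arcsin_small by blast
  \<comment> \<open>below 1, the condition \<open>1 / 2 \<le> sin\<^sup>2 (\<phi> / 2)\<close> is impossible\<close>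
  define \<delta> where "\<delta> = min \<delta>0 1"
  define \<kappa> where "\<kappa> = 2 * ln (1 + sqrt 3 / 2 * sin (\<delta> / 2))"
  have \<delta>: "0 < \<delta>" "\<delta> \<le> \<delta>0" "\<delta> \<le> 1" using \<delta>0 by (auto simp: \<delta>_def)
  have "sin (\<delta> / 2) > 0" using \<delta> pi_gt3 by (intro sin_gt_zero) auto
  then have \<kappa>: "\<kappa> > 0" unfolding \<kappa>_def by (intro mult_pos_pos ln_gt_zero) auto
  have "eventually (\<lambda>N::real. N * \<kappa> \<ge> 3 \<and> 2 * (N * \<kappa>) \<ge> 3 * ln N \<and> N \<ge> 2) at_top"
  proof (intro eventually_conj)
    show "eventually (\<lambda>N::real. N * \<kappa> \<ge> 3) at_top"
      using eventually_ge_at_top[of "3 / \<kappa>"] by eventually_elim (use \<kappa> in \<open>simp add: field_simps\<close>)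
    have "((\<lambda>N::real. ln N / N) \<longlongrightarrow> 0) at_top" by (rule ln_x_over_x_tendsto_0)
    then have "eventually (\<lambda>N. ln N / N < 2 * \<kappa> / 3) at_top" using \<kappa> by (intro order_tendstoD) auto
    then show "eventually (\<lambda>N::real. 2 * (N * \<kappa>) \<ge> 3 * ln N) at_top"
      using eventually_gt_at_top[of 0] by eventually_elim (simp add: field_simps)
    show "eventually (\<lambda>N::real. N \<ge> 2) at_top" by (rule eventually_ge_at_top)
  qed
  then obtain N0 where N0: "\<And>N. N \<ge> N0 \<Longrightarrow> N * \<kappa> \<ge> 3 \<and> 2 * (N * \<kappa>) \<ge> 3 * ln N \<and> N \<ge> 2"
    unfolding eventually_at_top_linorder by blast
  have pi_lb: "pi \<ge> 25 / 8" using pi_approx(1) by simp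
  show ?thesis
  proof (intro exI[of _ N0] allI impI)
    fix N \<phi> assume "N0 \<le> N" and a: "pi / 2 \<le> N * \<phi> \<and> \<phi> \<le> pi"
    note N = N0[OF \<open>N0 \<le> N\<close>]
    have "N * \<phi> > 0" using a pi_gt_zero by linarith
    then have \<phi>: "\<phi> > 0" using N by (simp add: zero_less_mult_iff)
    define y where "y = N * Im (beta_arcsin \<phi>)"
    have e3: "exp (- (2 * y)) \<le> 1 / N ^ 3" if "2 * y \<ge> 3 * ln N"
    proof -
      have "exp (- (2 * y)) \<le> exp (- (3 * ln N))" using that by simp
      also have "\<dots> = 1 / exp (3 * ln N)" by (simp add: exp_minus inverse_eq_divide)
      also have "exp (3 * ln N) = exp (ln N) ^ 3" using exp_of_nat_mult[of 3 "ln N"] by simp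
      also have "exp (ln N) = N" using N by simp
      finally show ?thesis .
    qed
    have "5 / 4 \<le> y \<and> (1 / 2 \<le> (sin (\<phi> / 2))\<^sup>2 \<longrightarrow> exp (- (2 * y)) \<le> 1 / 50) \<and>
       (2 * ln N \<le> N * \<phi> \<longrightarrow> exp (- (2 * y)) \<le> 1 / N ^ 3)"
    proof (cases "\<phi> \<le> \<delta>")
      case True
      have "N * Im (beta_arcsin \<phi>) \<ge> N * (4 / 5 * \<phi>)"
        using \<delta>0(2)[of \<phi>] \<phi> True \<delta> N by (intro mult_left_mono) auto
      then have y: "y \<ge> 4 / 5 * (N * \<phi>)" by (simp add: y_def mult_ac)
      have "sin (\<phi> / 2) \<le> \<phi> / 2" using \<phi> by (intro sin_x_le_x) auto
      also have "\<dots> \<le> 1 / 2" using True \<delta> by simp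
      finally have "(sin (\<phi> / 2))\<^sup>2 \<le> (1 / 2)\<^sup>2" using \<phi> a by (intro power_mono sin_ge_zero) auto
      then have "\<not> 1 / 2 \<le> (sin (\<phi> / 2))\<^sup>2" by (simp add: power2_eq_square)
      moreover have "ln N \<ge> 0" using N by simp
      ultimately show ?thesis using y a pi_lb e3 by auto
    next
      case False
      then have "Im (beta_arcsin \<phi>) \<ge> \<kappa>" using Im_beta_arcsin_mono_bound[of \<delta> \<phi>] \<delta> a by (simp add: \<kappa>_def)
      then have "N * Im (beta_arcsin \<phi>) \<ge> N * \<kappa>" using N by (intro mult_left_mono) auto
      then have y: "y \<ge> N * \<kappa>" by (simp add: y_def)
      then have y3: "y \<ge> 3" using N by linarith
      then have "exp (- (2 * y)) \<le> exp (- (5 / 2 + 5 / 2))" by simp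
      also have "\<dots> = 1 / (exp (5 / 2) * exp (5 / 2))" unfolding exp_add[symmetric] by (simp add: exp_minus inverse_eq_divide)
      also have "\<dots> \<le> 1 / (12 * 12)"
        using exp_five_halves by (intro divide_left_mono mult_mono mult_pos_pos) auto
      finally have "exp (- (2 * y)) \<le> 1 / 50" by simp
      then show ?thesis using y y3 N e3 by auto
    qed
    then show "N * Im (beta_arcsin \<phi>) \<ge> 5 / 4 \<and>
      (1 / 2 \<le> (sin (\<phi> / 2))\<^sup>2 \<longrightarrow> exp (- (2 * (N * Im (beta_arcsin \<phi>)))) \<le> 1 / 50) \<and>
      (N * \<phi> \<ge> 2 * ln N \<longrightarrow> exp (- (2 * (N * Im (beta_arcsin \<phi>)))) \<le> 1 / N ^ 3)"
      unfolding y_def .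
  qed
qed

section \<open>Existence and uniqueness of the roots\<close>

text \<open>
  The function \<open>u - arctan (G u)\<close> is strictly increasing and changes sign on the interval.
\<close>
lemma arctan_fixpoint_unique:
  fixes G G' :: "real \<Rightarrow> real"
  assumes deriv: "\<And>u. u \<in> {- (pi / 2)..pi / 2} \<Longrightarrow> (G has_real_derivative G' u) (at u)"
    and less: "\<And>u. u \<in> {- (pi / 2)..pi / 2} \<Longrightarrow> G' u < 1 + (G u)\<^sup>2"
  shows "\<exists>!u. u \<in> {- (pi / 2)<..<pi / 2} \<and> u = arctan (G u)"
proof -
  define H where "H = (\<lambda>u. u - arctan (G u))"
  have dH: "(H has_real_derivative 1 - inverse (1 + (G u)\<^sup>2) * G' u) (at u)"
    if "u \<in> {- (pi / 2)..pi / 2}" for u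
    unfolding H_def by (intro DERIV_diff DERIV_ident DERIV_chain2[OF DERIV_arctan deriv[OF that]])
  have pos: "1 - inverse (1 + (G u)\<^sup>2) * G' u > 0" if "u \<in> {- (pi / 2)..pi / 2}" for u
  proof -
    have "1 + (G u)\<^sup>2 > 0" by (rule add_pos_nonneg) auto
    then show ?thesis using less[OF that] by (simp add: field_simps)
  qed
  have incr: "H a < H b" if "- (pi / 2) \<le> a" "a < b" "b \<le> pi / 2" for a b
  proof (rule DERIV_pos_imp_increasing[OF that(2)])
    fix x assume x: "a \<le> x" "x \<le> b"
    then have "x \<in> {- (pi / 2)..pi / 2}" using that by auto
    with dH[OF this] pos[OF this] show "\<exists>y. (H has_real_derivative y) (at x) \<and> y > 0" by blast
  qed
  have "\<exists>u\<ge>- (pi / 2). u \<le> pi / 2 \<and> H u = 0"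
  proof (rule IVT')
    show "H (- (pi / 2)) \<le> 0" using arctan_lbound[of "G (- (pi / 2))"] by (simp add: H_def)
    show "0 \<le> H (pi / 2)" using arctan_ubound[of "G (pi / 2)"] by (simp add: H_def)
    show "continuous_on {- (pi / 2)..pi / 2} H"
      by (intro continuous_at_imp_continuous_on ballI DERIV_isCont[OF dH])
  qed auto
  then obtain u where "H u = 0" by blast
  then have u: "u = arctan (G u)" by (simp add: H_def)
  then have u_in: "u \<in> {- (pi / 2)<..<pi / 2}" using arctan[of "G u"] by auto
  show ?thesis
  proof (rule ex1I[of _ u])
    fix v assume v: "v \<in> {- (pi / 2)<..<pi / 2} \<and> v = arctan (G v)"
    then have "H v = H u" using u by (simp add: H_def)
    then show "v = u" using incr[of u v] incr[of v u] v u_in by fastforce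
  qed (use u u_in in blast)
qed

lemma root_unique:
  "\<forall>\<^sub>F N in at_top. \<forall>\<theta> d. pi \<le> N * d \<and> N * d + pi / 2 < N * pi \<longrightarrow>
     (\<exists>!u. u \<in> {- (pi / 2)<..<pi / 2} \<and> u = arctan (secular N \<theta> (d + u / N)))"
proof -
  obtain N0 where N0: "\<And>N \<phi>. N \<ge> N0 \<Longrightarrow> pi / 2 \<le> N * \<phi> \<Longrightarrow> \<phi> \<le> pi \<Longrightarrow>
      N * Im (beta_arcsin \<phi>) \<ge> 5 / 4 \<and>
      (1 / 2 \<le> (sin (\<phi> / 2))\<^sup>2 \<longrightarrow> exp (- (2 * (N * Im (beta_arcsin \<phi>)))) \<le> 1 / 50)"
    using beta_arcsin_growth by blast
  show ?thesis unfolding eventually_at_top_linorder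
  proof (intro exI[of _ "max N0 220"] allI impI)
    fix N \<theta> d assume N: "max N0 220 \<le> N" and d: "pi \<le> N * d \<and> N * d + pi / 2 < N * pi"
    have Npos: "N > 0" using N by simp
    show "\<exists>!u. u \<in> {- (pi / 2)<..<pi / 2} \<and> u = arctan (secular N \<theta> (d + u / N))"
    proof (rule arctan_fixpoint_unique[where G' = "\<lambda>u. secular_deriv N \<theta> (d + u / N) * (1 / N)"])
      fix u :: real assume u: "u \<in> {- (pi / 2)..pi / 2}"
      define \<phi> where "\<phi> = d + u / N"
      have eq: "N * \<phi> = N * d + u" using Npos by (simp add: \<phi>_def field_simps)
      have lo: "pi / 2 \<le> N * \<phi>" using u d unfolding eq by auto
      then have "N * \<phi> > 0" using pi_gt_zero by linarith
      then have pos: "\<phi> > 0" using Npos by (simp add: zero_less_mult_iff)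
      have "N * \<phi> < N * pi" using u d unfolding eq by auto
      then have hi: "\<phi> < pi" using Npos by simp
      note growth = N0[of N \<phi>]
      have y: "N * Im (beta_arcsin \<phi>) \<ge> 5 / 4" using growth N lo hi by simp
      have "((\<lambda>u. d + u / N) has_real_derivative 1 / N) (at u)"
        using Npos by (auto intro!: derivative_eq_intros)
      from DERIV_chain2[OF secular_has_derivative[OF pos hi y, of \<theta>, unfolded \<phi>_def] this]
      show "((\<lambda>u. secular N \<theta> (d + u / N)) has_real_derivative secular_deriv N \<theta> (d + u / N) * (1 / N)) (at u)" .
      have "secular_deriv N \<theta> \<phi> < N * (1 + (secular N \<theta> \<phi>)\<^sup>2)"
        by (rule secular_deriv_less[OF pos hi y]) (use growth N lo hi in auto)
      then show "secular_deriv N \<theta> (d + u / N) * (1 / N) < 1 + (secular N \<theta> (d + u / N))\<^sup>2"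
        using Npos unfolding \<phi>_def by (simp add: field_simps)
    qed
  qed
qed

lemma sinh_complex_of_real: "sinh (complex_of_real y) = of_real (sinh y)"
  and cosh_complex_of_real: "cosh (complex_of_real y) = of_real (cosh y)"
  by (simp_all add: sinh_def cosh_def exp_of_real[symmetric] scaleR_conv_of_real)

text \<open>
  Expand \<open>tan z\<close> by the conjugate of \<open>cos z\<close> and use the product formulas. This passes between the
  complex form of the equations and their real form with hyperbolic functions.
\<close>
lemma Re_mult_tan:
  fixes z :: complex
  assumes "Im z > 0"
  shows "Re (Complex B (- C) * tan z)
    = (B * sin (2 * Re z) + C * sinh (2 * Im z)) / (cos (2 * Re z) + cosh (2 * Im z))"
proof -
  have sz: "z + cnj z = of_real (2 * Re z)" "z - cnj z = \<i> * of_real (2 * Im z)"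
    by (simp_all add: complex_eq_iff)
  define S where "S = (sin (2 * Re z))"
  define D where "D = cos (2 * Re z) + cosh (2 * Im z)"
  have si: "sin (\<i> * of_real (2 * Im z)) = \<i> * of_real (sinh (2 * Im z))"
    using sinh_conv_sin[of "of_real (2 * Im z)"] unfolding sinh_complex_of_real by simp
  have ci: "cos (\<i> * of_real (2 * Im z)) = of_real (cosh (2 * Im z))"
    using cosh_conv_cos[of "of_real (2 * Im z)"] unfolding cosh_complex_of_real by simp
  have "sin z * cos (cnj z) = (of_real S + \<i> * of_real (sinh (2 * Im z))) / 2"
    unfolding sin_times_cos sz si S_def by (simp only: sin_of_real)
  moreover have "cos z * cos (cnj z) = of_real D / 2"
    unfolding cos_times_cos sz ci D_def by (simp only: cos_of_real of_real_add add.commute)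
  moreover have D: "D > 0"
  proof -
    have "cosh (2 * Im z) > 1" using assms cosh_real_strict_mono[of 0 "2 * Im z"] by simp
    then show ?thesis unfolding D_def using cos_ge_minus_one[of "2 * Re z"] by linarith
  qed
  ultimately have "(sin z * cos (cnj z)) / (cos z * cos (cnj z))
      = ((of_real S + \<i> * of_real (sinh (2 * Im z))) / 2) / (of_real D / 2)" and nz: "cos z * cos (cnj z) \<noteq> 0"
    by (simp_all only:) (use D in simp)
  moreover have "tan z = (sin z * cos (cnj z)) / (cos z * cos (cnj z))"
    using nz by (simp add: tan_def)
  moreover have "(a / 2) / (d / 2) = a / d" for a d :: complex by simp
  ultimately have "tan z = (of_real S + \<i> * of_real (sinh (2 * Im z))) / of_real D" by (simp only:)
  then have "tan z = Complex (S / D) (sinh (2 * Im z) / D)"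
    using \<open>D > 0\<close> by (simp add: complex_eq_iff)
  then show ?thesis unfolding S_def[symmetric] D_def[symmetric]
    by (simp add: add_divide_distrib)
qed

lemma B_fun_eq: "0 < \<phi> \<Longrightarrow> \<phi> < pi \<Longrightarrow> B_fun \<phi> = 2 * sin (\<phi> / 2) * Re (tau \<phi>)"
  and C_fun_eq: "0 < \<phi> \<Longrightarrow> \<phi> < pi \<Longrightarrow> C_fun \<phi> = - 2 * sin (\<phi> / 2) * Im (tau \<phi>)"
proof -
  assume "0 < \<phi>" "\<phi> < pi"
  then have "sin (beta \<phi>) * cis (- (pi / 3)) = of_real (2 * sin (\<phi> / 2)) * tau \<phi> * (cis (pi / 3) * cis (- (pi / 3)))"
    by (simp only: beta_eq_beta_arcsin sin_beta_arcsin) simp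
  then have *: "sin (beta \<phi>) * cis (- (pi / 3)) = of_real (2 * sin (\<phi> / 2)) * tau \<phi>"
    by (simp only: cis_mult) simp
  show "B_fun \<phi> = 2 * sin (\<phi> / 2) * Re (tau \<phi>)" "C_fun \<phi> = - 2 * sin (\<phi> / 2) * Im (tau \<phi>)"
    unfolding B_fun_def C_fun_def * by simp_all
qed

lemma secular_eq:
  assumes "0 < \<phi>" "\<phi> < pi" "N * Im (beta_arcsin \<phi>) > 0"
  shows "secular N \<theta> \<phi> = 2 * ((B_fun \<phi> * sin (2 * N * c_fun \<phi> - 2 * \<theta>) + C_fun \<phi> * sinh (2 * N * b_fun \<phi>))
        / (sin \<phi> * (cos (2 * N * c_fun \<phi> - 2 * \<theta>) + cosh (2 * N * b_fun \<phi>))))"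
proof -
  define s where "s = sin (\<phi> / 2)"
  define c where "c = cos (\<phi> / 2)"
  have c: "c > 0" using cos_half_pos[OF assms(1,2)] by (simp add: c_def)
  have s: "s > 0" using sin_half_pos[OF assms(1,2)] by (simp add: s_def)
  have sp: "sin \<phi> = 2 * s * c" using sin_double[of "\<phi> / 2"] by (simp add: s_def c_def)
  have "sigma \<phi> = of_real (1 / sin \<phi>) * Complex (B_fun \<phi>) (- C_fun \<phi>)"
    using s c unfolding B_fun_eq[OF assms(1,2)] C_fun_eq[OF assms(1,2)] sp
    by (simp add: complex_eq_iff sigma_def s_def[symmetric] c_def[symmetric])
  then have "secular N \<theta> \<phi> = 2 * Re (of_real (1 / sin \<phi>) * (Complex (B_fun \<phi>) (- C_fun \<phi>) * tan (of_real N * beta_arcsin \<phi> - of_real \<theta>)))"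
    unfolding secular_def by (simp only: mult.assoc)
  also have "\<dots> = 2 * (1 / sin \<phi> * Re (Complex (B_fun \<phi>) (- C_fun \<phi>) * tan (of_real N * beta_arcsin \<phi> - of_real \<theta>)))"
    by (simp only: times_complex.sel Re_complex_of_real Im_complex_of_real mult_zero_left diff_zero)
  also have "Re (Complex (B_fun \<phi>) (- C_fun \<phi>) * tan (of_real N * beta_arcsin \<phi> - of_real \<theta>)) =
     (B_fun \<phi> * sin (2 * N * c_fun \<phi> - 2 * \<theta>) + C_fun \<phi> * sinh (2 * N * b_fun \<phi>))
        / (cos (2 * N * c_fun \<phi> - 2 * \<theta>) + cosh (2 * N * b_fun \<phi>))"
    using assms by (subst Re_mult_tan) (simp_all add: c_fun_def b_fun_def beta_eq_beta_arcsin right_diff_distrib mult.assoc)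
  finally show ?thesis by simp
qed

text \<open>
  Substituting \<open>\<phi> = d + u / N\<close> turns the unique root of an equation equivalent to
  \<open>tan (N \<phi> - N d) = G \<phi>\<close> in the interval of length \<open>pi / N\<close> around \<open>d\<close> into the unique fixed point.
\<close>
lemma THE_root:
  fixes N d :: real
  assumes N: "N > 0"
    and unique: "\<exists>!u. u \<in> {- (pi / 2)<..<pi / 2} \<and> u = arctan (G (d + u / N))"
    and P: "\<And>\<phi>. d - pi / (2 * N) < \<phi> \<Longrightarrow> \<phi> < d + pi / (2 * N) \<Longrightarrow>
              P \<phi> \<longleftrightarrow> tan (N * \<phi> - N * d) = G \<phi>"
  shows "\<exists>u. u \<in> {- (pi / 2)<..<pi / 2} \<and> u = arctan (G (d + u / N)) \<and>
    (THE \<phi>. \<phi> \<in> {d - pi / (2 * N)<..<d + pi / (2 * N)} \<and> P \<phi>) = d + u / N"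
proof -
  from unique obtain u where u: "u \<in> {- (pi / 2)<..<pi / 2}" "u = arctan (G (d + u / N))"
    and u_eq: "\<And>v. v \<in> {- (pi / 2)<..<pi / 2} \<Longrightarrow> v = arctan (G (d + v / N)) \<Longrightarrow> v = u" by blast
  have iff: "d - pi / (2 * N) < d + v / N \<longleftrightarrow> - (pi / 2) < v"
    "d + v / N < d + pi / (2 * N) \<longleftrightarrow> v < pi / 2" for v
  proof -
    have "d - pi / (2 * N) < d + v / N \<longleftrightarrow> - (pi / 2) / N < v / N"
      unfolding divide_divide_eq_left[symmetric] minus_divide_left[symmetric] by linarith
    then show "d - pi / (2 * N) < d + v / N \<longleftrightarrow> - (pi / 2) < v"
      using N by (simp only: divide_less_cancel) simp
    have "d + v / N < d + pi / (2 * N) \<longleftrightarrow> v / N < (pi / 2) / N"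
      unfolding divide_divide_eq_left[symmetric] by linarith
    then show "d + v / N < d + pi / (2 * N) \<longleftrightarrow> v < pi / 2"
      using N by (simp only: divide_less_cancel) simp
  qed
  have tan_iff: "tan v = G (d + v / N) \<longleftrightarrow> v = arctan (G (d + v / N))" if "v \<in> {- (pi / 2)<..<pi / 2}" for v
    using that arctan_tan[of v] tan_arctan[of "G (d + v / N)"] by auto
  have Nd: "N * (d + v / N) - N * d = v" for v using N by (simp add: field_simps)
  have "(THE \<phi>. \<phi> \<in> {d - pi / (2 * N)<..<d + pi / (2 * N)} \<and> P \<phi>) = d + u / N"
  proof (rule the_equality)
    show "d + u / N \<in> {d - pi / (2 * N)<..<d + pi / (2 * N)} \<and> P (d + u / N)"
      using u tan_iff[of u] P[of "d + u / N"] iff[of u] Nd[of u] by simp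
    fix \<phi> assume \<phi>: "\<phi> \<in> {d - pi / (2 * N)<..<d + pi / (2 * N)} \<and> P \<phi>"
    define v where "v = N * \<phi> - N * d"
    have \<phi>_eq: "\<phi> = d + v / N" using N by (simp add: v_def field_simps)
    have v: "v \<in> {- (pi / 2)<..<pi / 2}" using \<phi> iff[of v] by (simp add: \<phi>_eq)
    have "tan v = G (d + v / N)" using P[of \<phi>] \<phi> Nd[of v] by (simp add: \<phi>_eq)
    then have "v = u" using tan_iff[OF v] u_eq[OF v] by simp
    then show "\<phi> = d + u / N" by (simp add: \<phi>_eq)
  qed
  then show ?thesis using u by blast
qed

lemma Im_beta_arcsin_pos: assumes "0 < \<phi>" "\<phi> \<le> pi" shows "Im (beta_arcsin \<phi>) > 0"
proof -
  have "sin (\<phi> / 2) > 0" using assms pi_gt_zero by (intro sin_gt_zero) linarith+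
  then have "2 * ln (1 + sqrt 3 / 2 * sin (\<phi> / 2)) > 0" by (intro mult_pos_pos ln_gt_zero) auto
  then show ?thesis using Im_beta_arcsin_ge[of \<phi>] assms by linarith
qed

lemma q_pos [simp]: "q n > 0" by (simp add: q_def)

lemma two_q: "2 * q n = real n + 3"
  by (simp add: q_def)

lemma q_d1: "q n * d1 n j = real j * pi" and q_d2: "q n * d2 n j = real j * pi + pi / 2"
  by (simp_all add: q_def d1_def d2_def field_simps)

lemma d1_range:
  assumes "j \<in> {1..(n + 1) div 2}"
  shows "pi \<le> q n * d1 n j" "q n * d1 n j + pi / 2 < q n * pi"
proof -
  have j: "1 \<le> real j" "2 * real j \<le> real n + 1" using assms by auto
  show "pi \<le> q n * d1 n j" unfolding q_d1 using j by simp
  have "(real j + 1 / 2) * pi < q n * pi" using j by (intro mult_strict_right_mono) (auto simp: q_def)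
  then show "q n * d1 n j + pi / 2 < q n * pi" unfolding q_d1 by (simp add: algebra_simps)
qed

lemma d2_range:
  assumes "j \<in> {1..n div 2}"
  shows "pi \<le> q n * d2 n j" "q n * d2 n j + pi / 2 < q n * pi"
proof -
  have j: "1 \<le> real j" "2 * real j \<le> real n" using assms by auto
  have "1 * pi \<le> real j * pi" using j by (intro mult_right_mono) auto
  then show "pi \<le> q n * d2 n j" unfolding q_d2 using pi_gt_zero by linarith
  have "(real j + 1) * pi < q n * pi" using j by (intro mult_strict_right_mono) (auto simp: q_def)
  then show "q n * d2 n j + pi / 2 < q n * pi" unfolding q_d2 by (simp add: algebra_simps)
qed

lemma interval_inside:
  fixes N d \<phi> :: real
  assumes "N > 0" "pi \<le> N * d" "N * d + pi / 2 < N * pi" "d - pi / (2 * N) < \<phi>" "\<phi> < d + pi / (2 * N)"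
  shows "0 < \<phi>" "\<phi> < pi"
proof -
  have "N * d - pi / 2 < N * \<phi>" "N * \<phi> < N * d + pi / 2"
    using assms(1,4,5) by (simp_all add: field_simps)
  then have "0 < N * \<phi>" "N * \<phi> < N * pi" using assms(2,3) pi_gt_zero by linarith+
  then show "0 < \<phi>" "\<phi> < pi" using assms(1) by (simp_all add: zero_less_mult_iff)
qed

lemma f_fun_eq: assumes "0 < \<phi>" "\<phi> < pi" shows "f_fun n \<phi> = secular (q n) 0 \<phi>"
  using secular_eq[OF assms, of "q n" 0] Im_beta_arcsin_pos[of \<phi>] assms by (simp add: f_fun_def two_q)

lemma h_fun_eq: assumes "0 < \<phi>" "\<phi> < pi" shows "- h_fun n \<phi> = secular (q n) (pi / 2) \<phi>"
proof -
  have "secular (q n) (pi / 2) \<phi> = 2 * ((- (B_fun \<phi> * sin ((real n + 3) * c_fun \<phi>) - C_fun \<phi> * sinh ((real n + 3) * b_fun \<phi>)))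
        / (sin \<phi> * (- cos ((real n + 3) * c_fun \<phi>) + cosh ((real n + 3) * b_fun \<phi>))))"
    using secular_eq[OF assms, of "q n" "pi / 2"] Im_beta_arcsin_pos[of \<phi>] assms by (simp add: two_q)
  then show ?thesis unfolding h_fun_def minus_divide_left[symmetric] by simp
qed

lemma phi_odd_root:
  assumes j: "j \<in> {1..(n + 1) div 2}"
    and unique: "\<exists>!u. u \<in> {- (pi / 2)<..<pi / 2} \<and> u = arctan (secular (q n) 0 (d1 n j + u / q n))"
  shows "\<exists>u. u \<in> {- (pi / 2)<..<pi / 2} \<and> u = arctan (secular (q n) 0 (d1 n j + u / q n)) \<and>
    phi_odd n j = d1 n j + u / q n"
proof -
  have ends: "pi * (2 * real j - 1) / (real n + 3) = d1 n j - pi / (2 * q n)"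
    "pi * (2 * real j + 1) / (real n + 3) = d1 n j + pi / (2 * q n)"
    unfolding two_q d1_def add_divide_distrib[symmetric] diff_divide_distrib[symmetric]
    by (simp_all add: algebra_simps)
  have "phi_odd n j = (THE \<phi>. \<phi> \<in> {d1 n j - pi / (2 * q n)<..<d1 n j + pi / (2 * q n)} \<and>
      tan (q n * \<phi>) = f_fun n \<phi>)"
    unfolding phi_odd_def ends q_def[symmetric] ..
  moreover have "tan (q n * \<phi>) = f_fun n \<phi> \<longleftrightarrow> tan (q n * \<phi> - q n * d1 n j) = secular (q n) 0 \<phi>"
    if \<phi>: "d1 n j - pi / (2 * q n) < \<phi>" "\<phi> < d1 n j + pi / (2 * q n)" for \<phi>
  proof -
    have "f_fun n \<phi> = secular (q n) 0 \<phi>"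
      by (rule f_fun_eq) (use interval_inside[OF q_pos d1_range[OF j] \<phi>] in auto)
    moreover have "tan (q n * \<phi>) = tan (q n * \<phi> - q n * d1 n j)"
      using tan_periodic_nat[of "q n * \<phi> - q n * d1 n j" j] unfolding q_d1 by simp
    ultimately show ?thesis by simp
  qed
  ultimately show ?thesis
    using THE_root[OF q_pos unique, where P = "\<lambda>\<phi>. tan (q n * \<phi>) = f_fun n \<phi>"] by simp
qed

lemma phi_even_root:
  assumes j: "j \<in> {1..n div 2}"
    and unique: "\<exists>!u. u \<in> {- (pi / 2)<..<pi / 2} \<and> u = arctan (secular (q n) (pi / 2) (d2 n j + u / q n))"
  shows "\<exists>u. u \<in> {- (pi / 2)<..<pi / 2} \<and> u = arctan (secular (q n) (pi / 2) (d2 n j + u / q n)) \<and>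
    phi_even n j = d2 n j + u / q n"
proof -
  have ends: "2 * pi * real j / (real n + 3) = d2 n j - pi / (2 * q n)"
    "2 * pi * (real j + 1) / (real n + 3) = d2 n j + pi / (2 * q n)"
    unfolding two_q d2_def add_divide_distrib[symmetric] diff_divide_distrib[symmetric]
    by (simp_all add: algebra_simps)
  have "phi_even n j = (THE \<phi>. \<phi> \<in> {d2 n j - pi / (2 * q n)<..<d2 n j + pi / (2 * q n)} \<and>
      cos (q n * \<phi>) = h_fun n \<phi> * sin (q n * \<phi>))"
    unfolding phi_even_def ends q_def[symmetric] ..
  moreover have "cos (q n * \<phi>) = h_fun n \<phi> * sin (q n * \<phi>) \<longleftrightarrow> tan (q n * \<phi> - q n * d2 n j) = secular (q n) (pi / 2) \<phi>"
    if \<phi>: "d2 n j - pi / (2 * q n) < \<phi>" "\<phi> < d2 n j + pi / (2 * q n)" for \<phi>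
  proof -
    define v where "v = q n * \<phi> - q n * d2 n j"
    have h: "- h_fun n \<phi> = secular (q n) (pi / 2) \<phi>"
      by (rule h_fun_eq) (use interval_inside[OF q_pos d2_range[OF j] \<phi>] in auto)
    have "- (pi / 2) < v" "v < pi / 2" using \<phi> q_pos[of n] by (simp_all add: v_def field_simps)
    then have cv: "cos v > 0" by (rule cos_gt_zero_pi)
    have e: "q n * \<phi> = (v + pi / 2) + real j * pi" by (simp add: v_def q_d2)
    have cs: "cos (q n * \<phi>) = (- 1) ^ j * (- sin v)" "sin (q n * \<phi>) = (- 1) ^ j * cos v"
      unfolding e cos_add[of "v + pi / 2"] sin_add[of "v + pi / 2"] cos_npi sin_npi
      by (simp_all add: cos_add sin_add)
    have "cos (q n * \<phi>) = h_fun n \<phi> * sin (q n * \<phi>) \<longleftrightarrow> - sin v = h_fun n \<phi> * cos v"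
      unfolding cs minus_equation_iff[of "sin v"] by (cases "even j") auto
    also have "\<dots> \<longleftrightarrow> tan v = - h_fun n \<phi>" using cv by (auto simp: tan_def field_simps)
    finally show ?thesis unfolding h v_def .
  qed
  ultimately show ?thesis
    using THE_root[OF q_pos unique, where P = "\<lambda>\<phi>. cos (q n * \<phi>) = h_fun n \<phi> * sin (q n * \<phi>)"] by simp
qed

lemma q_at_top: "filterlim q at_top sequentially"
proof -
  have "filterlim (\<lambda>n. 1 / 2 * (3 + real n)) at_top sequentially"
    by (intro filterlim_tendsto_pos_mult_at_top[OF tendsto_const] filterlim_tendsto_add_at_top[OF tendsto_const]
        filterlim_real_sequentially) auto
  moreover have "q = (\<lambda>n. 1 / 2 * (3 + real n))" by (auto simp: q_def)
  ultimately show ?thesis by simp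
qed

text \<open>
  The definite descriptions of the roots denote: each root has the form \<open>d + u / q n\<close>, where \<open>u\<close> solves
  the fixed point equation.
\<close>
definition has_roots :: "nat \<Rightarrow> bool" where
  "has_roots n \<longleftrightarrow>
     (\<forall>j\<in>{1..(n + 1) div 2}. \<exists>u. u \<in> {- (pi / 2)<..<pi / 2} \<and> u = arctan (secular (q n) 0 (d1 n j + u / q n)) \<and>
         phi_odd n j = d1 n j + u / q n) \<and>
     (\<forall>j\<in>{1..n div 2}. \<exists>u. u \<in> {- (pi / 2)<..<pi / 2} \<and> u = arctan (secular (q n) (pi / 2) (d2 n j + u / q n)) \<and>
         phi_even n j = d2 n j + u / q n)"

lemma eventually_roots: "\<forall>\<^sub>F n in sequentially. has_roots n"
  using eventually_compose_filterlim[OF root_unique q_at_top]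
proof eventually_elim
  case (elim n)
  note unique = elim[rule_format, OF conjI]
  show ?case unfolding has_roots_def
    by (intro conjI ballI phi_odd_root phi_even_root unique d1_range d2_range)
qed

section \<open>Eigenfunctions of the difference operator\<close>

text \<open>
  One normalised oscillation; the normalisation at the boundary point \<open>N\<close> is the choice of
  coefficients that two independent combinations of the boundary conditions force.
\<close>
definition mode :: "real \<Rightarrow> real \<Rightarrow> complex \<Rightarrow> real \<Rightarrow> complex" where
  "mode N \<theta> z y = cos (z * of_real y - of_real \<theta>) / cos (z * of_real N - of_real \<theta>)"

text \<open>
  The modes for \<open>\<phi>\<close>, \<open>\<beta>\<close> and \<open>cnj \<beta>\<close> with the coefficients \<open>1\<close>, \<open>\<omega>\<close> and \<open>\<omega>\<^sup>2\<close>; the last two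
  summands are complex conjugates of each other.
\<close>
definition eigenfun :: "real \<Rightarrow> real \<Rightarrow> real \<Rightarrow> real \<Rightarrow> real" where
  "eigenfun N \<theta> \<phi> y = Re (mode N \<theta> (of_real \<phi>) y + 2 * (cis (2 * pi / 3) * mode N \<theta> (beta_arcsin \<phi>) y))"

definition diff2 :: "(real \<Rightarrow> 'a :: ring_1) \<Rightarrow> real \<Rightarrow> 'a" where
  "diff2 f y = f (y + 1) - 2 * f y + f (y - 1)"

lemma diff2_mode: "diff2 (mode N \<theta> z) y = (2 * cos z - 2) * mode N \<theta> z y"
proof -
  define t where "t = z * of_real y - of_real \<theta>"
  have "z * of_real (y + 1) - of_real \<theta> = t + z" "z * of_real (y - 1) - of_real \<theta> = t - z"
    by (simp_all add: t_def algebra_simps)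
  moreover have "cos (t + z) + cos (t - z) = 2 * cos z * cos t" by (simp add: cos_add cos_diff)
  ultimately have "cos (z * of_real (y + 1) - of_real \<theta>) - 2 * cos t + cos (z * of_real (y - 1) - of_real \<theta>)
      = (2 * cos z - 2) * cos t" by (simp add: algebra_simps)
  then show ?thesis unfolding diff2_def mode_def t_def[symmetric]
    by (simp add: add_divide_distrib[symmetric] diff_divide_distrib[symmetric])
qed

lemma omega_cubed: "cis (2 * pi / 3) ^ 3 = 1"
  unfolding Complex.DeMoivre by simp

lemma omega_sum: "1 + cis (2 * pi / 3) + (cis (2 * pi / 3))\<^sup>2 = 0"
proof -
  have "(1 + cis (2 * pi / 3) + (cis (2 * pi / 3))\<^sup>2) * (cis (2 * pi / 3) - 1) = cis (2 * pi / 3) ^ 3 - 1"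
    by (simp add: algebra_simps power2_eq_square power3_eq_cube)
  moreover have "cis (2 * pi / 3) \<noteq> 1" unfolding cis_third by (simp add: complex_eq_iff)
  ultimately show ?thesis unfolding omega_cubed by simp
qed

lemma diff2_Re: "diff2 (\<lambda>y. Re (f y)) y = Re (diff2 f y)"
  by (simp add: diff2_def)

lemma diff2_lin: "diff2 (\<lambda>y. f y + 2 * (c * h y)) y = diff2 f y + 2 * (c * diff2 h y)" for c :: complex
  by (simp add: diff2_def algebra_simps)

lemma diff2_scale: "diff2 (\<lambda>y. c * f y) y = c * diff2 f y" for c :: "'a :: comm_ring_1"
  by (simp add: diff2_def algebra_simps)

text \<open>
  Each second difference multiplies the mode of \<open>\<beta>\<close> by one more factor \<open>\<omega>\<close> than the mode of \<open>\<phi>\<close>;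
  \<open>k\<close> counts these factors, which return to 1 after three steps.
\<close>
definition twist :: "real \<Rightarrow> real \<Rightarrow> real \<Rightarrow> nat \<Rightarrow> real \<Rightarrow> real" where
  "twist N \<theta> \<phi> k y = Re (mode N \<theta> (of_real \<phi>) y + 2 * (cis (2 * pi / 3) ^ Suc k * mode N \<theta> (beta_arcsin \<phi>) y))"

lemma eigenfun_twist: "eigenfun N \<theta> \<phi> = twist N \<theta> \<phi> 0"
  by (simp add: eigenfun_def twist_def fun_eq_iff)

lemma diff2_twist: "diff2 (twist N \<theta> \<phi> k) y = - (2 - 2 * cos \<phi>) * twist N \<theta> \<phi> (Suc k) y"
proof -
  define m where "m = 2 - 2 * cos \<phi>"
  have c1: "2 * cos (complex_of_real \<phi>) - 2 = of_real (- m)" by (simp add: m_def cos_of_real)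
  have c2: "2 * cos (beta_arcsin \<phi>) - 2 = of_real (- m) * cis (2 * pi / 3)"
    unfolding cos_beta_arcsin m_def by (simp add: algebra_simps)
  have "diff2 (twist N \<theta> \<phi> k) y = Re (of_real (- m) * mode N \<theta> (of_real \<phi>) y
      + 2 * (cis (2 * pi / 3) ^ Suc k * (of_real (- m) * cis (2 * pi / 3) * mode N \<theta> (beta_arcsin \<phi>) y)))"
    unfolding twist_def[abs_def] diff2_Re diff2_lin diff2_mode c1 c2 ..
  also have "of_real (- m) * mode N \<theta> (of_real \<phi>) y
      + 2 * (cis (2 * pi / 3) ^ Suc k * (of_real (- m) * cis (2 * pi / 3) * mode N \<theta> (beta_arcsin \<phi>) y))
      = of_real (- m) * (mode N \<theta> (of_real \<phi>) y + 2 * (cis (2 * pi / 3) ^ Suc (Suc k) * mode N \<theta> (beta_arcsin \<phi>) y))"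
    by (simp only: power_Suc distrib_left mult_ac)
  also have "Re \<dots> = - m * twist N \<theta> \<phi> (Suc k) y"
    unfolding twist_def by (simp only: times_complex.sel Re_complex_of_real Im_complex_of_real mult_zero_left diff_zero)
  finally show ?thesis by (simp add: m_def)
qed

lemma twist_3: "twist N \<theta> \<phi> (k + 3) = twist N \<theta> \<phi> k"
proof -
  have "cis (2 * pi / 3) ^ Suc (k + 3) = cis (2 * pi / 3) ^ Suc k"
    by (simp only: power_Suc power_add omega_cubed mult_1_right)
  then show ?thesis unfolding twist_def[abs_def] by (simp only:)
qed

text \<open>
  Since \<open>1 + \<omega> + \<omega>\<^sup>2 = 0\<close>, the three twists isolate the real mode.
\<close>
lemma twist_sum: "twist N \<theta> \<phi> 0 y + twist N \<theta> \<phi> 1 y + twist N \<theta> \<phi> 2 y = 3 * Re (mode N \<theta> (of_real \<phi>) y)"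
proof -
  define M where "M = mode N \<theta> (of_real \<phi>) y"
  define W where "W = mode N \<theta> (beta_arcsin \<phi>) y"
  define w where "w = cis (2 * pi / 3)"
  have "twist N \<theta> \<phi> 0 y + twist N \<theta> \<phi> 1 y + twist N \<theta> \<phi> 2 y
      = Re ((M + 2 * (w ^ Suc 0 * W)) + (M + 2 * (w ^ Suc 1 * W)) + (M + 2 * (w ^ Suc 2 * W)))"
    unfolding twist_def M_def[symmetric] W_def[symmetric] w_def[symmetric] by (simp only: plus_complex.sel)
  also have "(M + 2 * (w ^ Suc 0 * W)) + (M + 2 * (w ^ Suc 1 * W)) + (M + 2 * (w ^ Suc 2 * W))
      = of_real 3 * M + 2 * w * W * (1 + w + w\<^sup>2)"
    by (simp add: algebra_simps power2_eq_square eval_nat_numeral)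
  also have "1 + w + w\<^sup>2 = 0" unfolding w_def by (rule omega_sum)
  also have "Re (of_real 3 * M + 2 * w * W * 0) = 3 * Re M" by simp
  finally show ?thesis unfolding M_def .
qed

lemma g_cos: "g \<phi> = - ((2 - 2 * cos \<phi>) ^ 3)"
proof -
  have "2 - 2 * cos \<phi> = (2 * sin (\<phi> / 2))\<^sup>2"
    using cos_double_sin[of "\<phi> / 2"] by (simp add: power_mult_distrib)
  then show ?thesis unfolding g_eq by (simp add: power_mult[symmetric])
qed

lemma diff2_eigenfun: "diff2 (diff2 (diff2 (eigenfun N \<theta> \<phi>))) y = g \<phi> * eigenfun N \<theta> \<phi> y"
proof -
  define m where "m = - (2 - 2 * cos \<phi>)"
  have 1: "diff2 (twist N \<theta> \<phi> k) = (\<lambda>y. m * twist N \<theta> \<phi> (Suc k) y)" for k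
    unfolding m_def by (rule ext) (rule diff2_twist)
  have 2: "diff2 (\<lambda>y. c * f y) = (\<lambda>y. c * diff2 f y)" for c and f :: "real \<Rightarrow> real"
    by (rule ext) (rule diff2_scale)
  have "diff2 (diff2 (diff2 (twist N \<theta> \<phi> 0))) y = m * (m * (m * twist N \<theta> \<phi> (0 + 3) y))"
    unfolding 1 2 by (simp add: numeral_3_eq_3)
  also have "\<dots> = g \<phi> * twist N \<theta> \<phi> 0 y"
    unfolding twist_3 g_cos m_def by (simp add: power3_eq_cube algebra_simps)
  finally show ?thesis unfolding eigenfun_twist .
qed

lemma mode_reflect:
  assumes "sin (2 * \<theta>) = 0"
  shows "mode N \<theta> z (- y) = of_real (cos (2 * \<theta>)) * mode N \<theta> z y"
proof -
  have s: "sin (2 * complex_of_real \<theta>) = 0" "cos (2 * complex_of_real \<theta>) = of_real (cos (2 * \<theta>))"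
    using sin_of_real[of "2 * \<theta>", where ?'a = complex] cos_of_real[of "2 * \<theta>", where ?'a = complex] assms by simp_all
  have "cos (z * of_real (- y) - of_real \<theta>) = cos (z * of_real y - of_real \<theta> + 2 * of_real \<theta>)"
  proof -
    have "z * of_real (- y) - of_real \<theta> = - (z * of_real y + of_real \<theta>)" by simp
    moreover have "z * of_real y - of_real \<theta> + 2 * of_real \<theta> = z * of_real y + of_real \<theta>" by simp
    ultimately show ?thesis by (simp only: cos_minus)
  qed
  also have "\<dots> = of_real (cos (2 * \<theta>)) * cos (z * of_real y - of_real \<theta>)"
    unfolding cos_add s by (simp add: mult.commute)
  finally show ?thesis by (simp add: mode_def)
qed

lemma eigenfun_reflect:
  assumes "sin (2 * \<theta>) = 0"
  shows "eigenfun N \<theta> \<phi> (- y) = cos (2 * \<theta>) * eigenfun N \<theta> \<phi> y"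
proof -
  have "mode N \<theta> (of_real \<phi>) (- y) + 2 * (cis (2 * pi / 3) * mode N \<theta> (beta_arcsin \<phi>) (- y))
    = of_real (cos (2 * \<theta>)) * (mode N \<theta> (of_real \<phi>) y + 2 * (cis (2 * pi / 3) * mode N \<theta> (beta_arcsin \<phi>) y))"
    unfolding mode_reflect[OF assms] by (simp only: distrib_left mult_ac)
  then show ?thesis unfolding eigenfun_def
    by (simp only: times_complex.sel Re_complex_of_real Im_complex_of_real mult_zero_left diff_zero)
qed

lemma mode_end:
  assumes "cos (z * of_real N - of_real \<theta>) \<noteq> 0"
  shows "mode N \<theta> z N = 1"
    "mode N \<theta> z (N + 1) = cos z - sin z * tan (z * of_real N - of_real \<theta>)"
    "mode N \<theta> z (N - 1) = cos z + sin z * tan (z * of_real N - of_real \<theta>)"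
proof -
  define t where "t = z * of_real N - of_real \<theta>"
  have e: "z * of_real (N + 1) - of_real \<theta> = t + z" "z * of_real (N - 1) - of_real \<theta> = t - z"
    by (simp_all add: t_def algebra_simps)
  have t: "cos t \<noteq> 0" using assms by (simp add: t_def)
  show "mode N \<theta> z N = 1" using assms by (simp add: mode_def)
  show "mode N \<theta> z (N + 1) = cos z - sin z * tan (z * of_real N - of_real \<theta>)"
    unfolding mode_def e t_def[symmetric] cos_add using t by (simp add: tan_def field_simps)
  show "mode N \<theta> z (N - 1) = cos z + sin z * tan (z * of_real N - of_real \<theta>)"
    unfolding mode_def e t_def[symmetric] cos_diff using t by (simp add: tan_def field_simps)
qed

text \<open>
  At \<open>N\<close> the coefficients add up to \<open>1 + \<omega> + \<omega>\<^sup>2 = 0\<close>. At \<open>N + 1\<close> and \<open>N - 1\<close> the addition theorem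
  leaves a cosine part, which vanishes because \<open>cos z\<close> is affine in \<open>\<omega>^r\<close>, and a sine part with the two
  signs, which vanishes by the secular equation.
\<close>
lemma eigenfun_end:
  assumes \<phi>: "0 < \<phi>" "\<phi> < pi" and N: "N > 0"
    and c: "cos (N * \<phi> - \<theta>) \<noteq> 0" and eq: "tan (N * \<phi> - \<theta>) = secular N \<theta> \<phi>"
  shows "eigenfun N \<theta> \<phi> N = 0" "eigenfun N \<theta> \<phi> (N + 1) = 0" "eigenfun N \<theta> \<phi> (N - 1) = 0"
proof -
  define T where "T = tan (beta_arcsin \<phi> * of_real N - of_real \<theta>)"
  have r: "complex_of_real \<phi> * of_real N - of_real \<theta> = of_real (N * \<phi> - \<theta>)" by (simp add: mult.commute)
  have c1: "cos (complex_of_real \<phi> * of_real N - of_real \<theta>) \<noteq> 0" unfolding r cos_of_real using c by simp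
  have t1: "tan (complex_of_real \<phi> * of_real N - of_real \<theta>) = of_real (tan (N * \<phi> - \<theta>))"
    unfolding r tan_def cos_of_real sin_of_real by simp
  have "Im (beta_arcsin \<phi> * of_real N - of_real \<theta>) > 0" using Im_beta_arcsin_pos[of \<phi>] \<phi> N by simp
  then have "sinh (Im (beta_arcsin \<phi> * of_real N - of_real \<theta>)) > 0" by simp
  then have c2: "cos (beta_arcsin \<phi> * of_real N - of_real \<theta>) \<noteq> 0"
    using norm_cos_ge[of "beta_arcsin \<phi> * of_real N - of_real \<theta>"] \<open>Im (beta_arcsin \<phi> * of_real N - of_real \<theta>) > 0\<close> by auto
  note ends1 = mode_end[OF c1, unfolded t1]
  note ends2 = mode_end[OF c2, folded T_def]
  show "eigenfun N \<theta> \<phi> N = 0" unfolding eigenfun_def ends1 ends2 by (simp add: cos_120)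
  have cosine: "Re (cos (of_real \<phi>) + 2 * (cis (2 * pi / 3) * cos (beta_arcsin \<phi>))) = 0"
  proof -
    define w where "w = cis (2 * pi / 3)"
    have w2: "w\<^sup>2 = - 1 - w"
      using omega_sum unfolding w_def[symmetric] by (simp add: eq_neg_iff_add_eq_0 algebra_simps)
    have "w * cos (beta_arcsin \<phi>) = w - of_real (1 - cos \<phi>) * w\<^sup>2"
      unfolding cos_beta_arcsin w_def[symmetric] by (simp add: algebra_simps power2_eq_square)
    moreover have "Re w = - 1 / 2" by (simp add: w_def cos_120)
    ultimately show ?thesis unfolding w2 w_def[symmetric] by (simp add: cos_of_real diff_divide_distrib)
  qed
  have s: "sin \<phi> = 2 * sin (\<phi> / 2) * cos (\<phi> / 2)" using sin_double[of "\<phi> / 2"] by simp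
  have "cis (2 * pi / 3) * sin (beta_arcsin \<phi>) = (cis (2 * pi / 3) * cis (pi / 3)) * (2 * of_real (sin (\<phi> / 2)) * tau \<phi>)"
    unfolding sin_beta_arcsin by (simp only: mult_ac)
  also have "cis (2 * pi / 3) * cis (pi / 3) = - 1" unfolding cis_mult by (simp add: add_divide_distrib[symmetric])
  also have "- 1 * (2 * of_real (sin (\<phi> / 2)) * tau \<phi>) = - (of_real (sin \<phi>) * sigma \<phi>)"
    using cos_half_pos[OF \<phi>] by (simp add: s sigma_def)
  finally have os: "cis (2 * pi / 3) * sin (beta_arcsin \<phi>) = - (of_real (sin \<phi>) * sigma \<phi>)" .
  have sine: "Re (sin (of_real \<phi>) * of_real (tan (N * \<phi> - \<theta>)) + 2 * (cis (2 * pi / 3) * (sin (beta_arcsin \<phi>) * T))) = 0"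
  proof -
    have "cis (2 * pi / 3) * (sin (beta_arcsin \<phi>) * T) = - (of_real (sin \<phi>) * (sigma \<phi> * T))"
      unfolding mult.assoc[symmetric] os by simp
    then have "Re (cis (2 * pi / 3) * (sin (beta_arcsin \<phi>) * T)) = - (sin \<phi> * Re (sigma \<phi> * T))"
      by (simp only: uminus_complex.sel times_complex.sel Re_complex_of_real Im_complex_of_real mult_zero_left diff_zero)
    moreover have "secular N \<theta> \<phi> = 2 * Re (sigma \<phi> * T)" by (simp only: secular_def T_def mult.commute)
    moreover have "Re (sin (of_real \<phi>) * of_real (tan (N * \<phi> - \<theta>))) = sin \<phi> * secular N \<theta> \<phi>"
      unfolding eq sin_of_real by simp
    moreover have "Re (A + 2 * B) = Re A + 2 * Re B" for A B by simp
    ultimately show ?thesis by (simp only:)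
  qed
  have "eigenfun N \<theta> \<phi> (N + 1) = Re (cos (of_real \<phi>) + 2 * (cis (2 * pi / 3) * cos (beta_arcsin \<phi>)))
    - Re (sin (of_real \<phi>) * of_real (tan (N * \<phi> - \<theta>)) + 2 * (cis (2 * pi / 3) * (sin (beta_arcsin \<phi>) * T)))"
    unfolding eigenfun_def ends1 ends2 minus_complex.sel(1)[symmetric] by (rule arg_cong[where f = Re]) (simp only: algebra_simps)
  then show "eigenfun N \<theta> \<phi> (N + 1) = 0" unfolding cosine sine by simp
  have "eigenfun N \<theta> \<phi> (N - 1) = Re (cos (of_real \<phi>) + 2 * (cis (2 * pi / 3) * cos (beta_arcsin \<phi>)))
    + Re (sin (of_real \<phi>) * of_real (tan (N * \<phi> - \<theta>)) + 2 * (cis (2 * pi / 3) * (sin (beta_arcsin \<phi>) * T)))"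
    unfolding eigenfun_def ends1 ends2 plus_complex.sel(1)[symmetric] by (rule arg_cong[where f = Re]) (simp only: algebra_simps)
  then show "eigenfun N \<theta> \<phi> (N - 1) = 0" unfolding cosine sine by simp
qed

text \<open>
  Six consecutive zeros would pass, through second differences, to all three twists at the points
  \<open>N - 1\<close> and \<open>N - 2\<close>, hence to the real mode. Its three-term recurrence would then give 0 at \<open>N\<close>,
  where it equals 1.
\<close>
lemma eigenfun_nonzero:
  assumes \<phi>: "0 < \<phi>" "\<phi> < pi" and c: "cos (N * \<phi> - \<theta>) \<noteq> 0"
    and zero: "\<And>k. k \<in> {0..5} \<Longrightarrow> eigenfun N \<theta> \<phi> (N + 1 - real k) = 0"
  shows False
proof -
  define m where "m = 2 - 2 * cos \<phi>"
  have "cos \<phi> < cos 0" using \<phi> by (intro cos_monotone_0_pi) auto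
  then have m: "m > 0" by (simp add: m_def)
  define x where "x = twist N \<theta> \<phi>"
  have zero': "x 0 (N + 1) = 0" "x 0 N = 0" "x 0 (N - 1) = 0" "x 0 (N - 2) = 0" "x 0 (N - 3) = 0" "x 0 (N - 4) = 0"
    using zero[of 0] zero[of 1] zero[of 2] zero[of 3] zero[of 4] zero[of 5] by (simp_all add: eigenfun_twist x_def)
  have step: "x k (y + 1) - 2 * x k y + x k (y - 1) = - m * x (Suc k) y" for k y
    using diff2_twist[of N \<theta> \<phi> k y] by (simp add: diff2_def x_def m_def)
  have next_zero: "x (Suc k) y = 0" if "x k (y + 1) = 0" "x k y = 0" "x k (y - 1) = 0" for k y
    using step[of k y] that m by simp
  have x1: "x 1 N = 0" "x 1 (N - 1) = 0" "x 1 (N - 2) = 0" "x 1 (N - 3) = 0"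
    using zero' next_zero[of 0 N] next_zero[of 0 "N - 1"] next_zero[of 0 "N - 2"] next_zero[of 0 "N - 3"] by simp_all
  have x2: "x 2 (N - 1) = 0" "x 2 (N - 2) = 0"
    using x1 next_zero[of 1 "N - 1"] next_zero[of 1 "N - 2"] by (simp_all add: numeral_2_eq_2)
  define M where "M = (\<lambda>y. Re (mode N \<theta> (of_real \<phi>) y))"
  have M0: "M (N - 1) = 0" "M (N - 2) = 0"
    using twist_sum[of N \<theta> \<phi> "N - 1"] twist_sum[of N \<theta> \<phi> "N - 2"] zero' x1 x2 by (simp_all add: M_def x_def)
  have "diff2 M (N - 1) = Re ((2 * cos (of_real \<phi>) - 2) * mode N \<theta> (of_real \<phi>) (N - 1))"
    unfolding M_def diff2_Re diff2_mode ..
  also have "\<dots> = (2 * cos \<phi> - 2) * M (N - 1)" unfolding cos_of_real M_def by simp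
  finally have "M N = 0" using M0 by (simp add: diff2_def)
  moreover have "complex_of_real \<phi> * of_real N - of_real \<theta> = of_real (N * \<phi> - \<theta>)" by (simp add: mult.commute)
  then have "cos (complex_of_real \<phi> * of_real N - of_real \<theta>) \<noteq> 0" using c by (simp only: cos_of_real of_real_eq_0_iff) simp
  then have "M N = 1" unfolding M_def by (simp add: mode_end(1))
  ultimately show False by simp
qed

section \<open>The characteristic polynomial\<close>

text \<open>
  Orthogonal non-zero columns have an explicit left inverse, so the matrix of eigenvectors conjugates
  the given matrix to a diagonal one.
\<close>
lemma char_poly_orthogonal_eigenvectors:
  fixes a :: "nat \<Rightarrow> nat \<Rightarrow> real" and x :: "nat \<Rightarrow> nat \<Rightarrow> real" and l :: "nat \<Rightarrow> real"
  assumes eigen: "\<And>m i. m < n \<Longrightarrow> i < n \<Longrightarrow> (\<Sum>k<n. a i k * x m k) = l m * x m i"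
    and orth: "\<And>m m'. m < n \<Longrightarrow> m' < n \<Longrightarrow> m \<noteq> m' \<Longrightarrow> (\<Sum>k<n. x m k * x m' k) = 0"
    and nonzero: "\<And>m. m < n \<Longrightarrow> \<exists>k<n. x m k \<noteq> 0"
  shows "char_poly (mat n n (\<lambda>(i, k). complex_of_real (a i k))) = (\<Prod>m<n. [:- of_real (l m), 1:])"
proof -
  define s where "s = (\<lambda>m. \<Sum>k<n. x m k * x m k)"
  have s: "s m \<noteq> 0" if "m < n" for m
  proof -
    obtain k where k: "k < n" "x m k \<noteq> 0" using nonzero[OF \<open>m < n\<close>] by blast
    have "0 < x m k * x m k" using k(2) by (simp add: zero_less_mult_iff) linarith
    also have "\<dots> \<le> s m" unfolding s_def by (rule member_le_sum) (use k in auto)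
    finally show ?thesis by simp
  qed
  define A where "A = mat n n (\<lambda>(i, k). complex_of_real (a i k))"
  define P where "P = mat n n (\<lambda>(i, m). complex_of_real (x m i))"
  define Q where "Q = mat n n (\<lambda>(m, i). complex_of_real (x m i / s m))"
  define D where "D = mat n n (\<lambda>(i, m). if i = m then complex_of_real (l m) else 0)"
  have carr: "A \<in> carrier_mat n n" "P \<in> carrier_mat n n" "Q \<in> carrier_mat n n" "D \<in> carrier_mat n n"
    by (simp_all add: A_def P_def Q_def D_def)
  have QP: "Q * P = 1\<^sub>m n"
  proof (rule eq_matI)
    fix m m' assume "m < dim_row (1\<^sub>m n :: complex mat)" "m' < dim_col (1\<^sub>m n :: complex mat)"
    then have m: "m < n" "m' < n" by simp_all
    have "(Q * P) $$ (m, m') = (\<Sum>k<n. complex_of_real (x m k / s m * x m' k))"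
      using m by (simp add: Q_def P_def scalar_prod_def atLeast0LessThan)
    also have "\<dots> = of_real ((\<Sum>k<n. x m k * x m' k) / s m)"
      by (simp add: sum_divide_distrib)
    also have "\<dots> = 1\<^sub>m n $$ (m, m')" using m orth[of m m'] s[of m] by (cases "m = m'") (simp_all add: s_def)
    finally show "(Q * P) $$ (m, m') = 1\<^sub>m n $$ (m, m')" .
  qed (simp_all add: P_def Q_def)
  have PQ: "P * Q = 1\<^sub>m n" by (rule mat_mult_left_right_inverse[OF carr(3,2) QP])
  have AP: "A * P = P * D"
  proof (rule eq_matI)
    fix i m assume "i < dim_row (P * D)" "m < dim_col (P * D)"
    then have im: "i < n" "m < n" by (simp_all add: P_def D_def)
    have "(A * P) $$ (i, m) = of_real (\<Sum>k<n. a i k * x m k)"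
      using im by (simp add: A_def P_def scalar_prod_def atLeast0LessThan)
    also have "\<dots> = of_real (l m * x m i)" by (simp only: eigen[OF im(2,1)])
    also have "\<dots> = (\<Sum>k<n. complex_of_real (x k i) * (if k = m then complex_of_real (l m) else 0))"
      using im by (simp add: if_distrib[of "\<lambda>y. _ * y"] sum.delta cong: if_cong)
    also have "\<dots> = (P * D) $$ (i, m)"
      using im by (simp add: P_def D_def scalar_prod_def atLeast0LessThan)
    finally show "(A * P) $$ (i, m) = (P * D) $$ (i, m)" .
  qed (simp_all add: A_def P_def D_def)
  have "A = A * (P * Q)" unfolding PQ using carr by simp
  also have "\<dots> = P * D * Q" unfolding assoc_mult_mat[OF carr(1,2,3), symmetric] AP ..
  finally have "similar_mat_wit A D P Q"
    using carr PQ QP unfolding similar_mat_wit_def Let_def by (auto simp: A_def)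
  then have "similar_mat A D" unfolding similar_mat_def by blast
  then have "char_poly A = char_poly D" by (rule char_poly_similar)
  also have "\<dots> = (\<Prod>c\<leftarrow>diag_mat D. [:- c, 1:])"
    by (rule char_poly_upper_triangular[OF carr(4)]) (auto simp: D_def)
  also have "diag_mat D = map (\<lambda>m. of_real (l m)) [0..<n]"
    unfolding diag_mat_def by (rule nth_equalityI) (auto simp: D_def)
  also have "(\<Prod>c\<leftarrow>map (\<lambda>m. of_real (l m)) [0..<n]. [:- c, 1:]) = (\<Prod>m<n. [:- complex_of_real (l m), 1:])"
    by (simp add: comp_def prod.distinct_set_conv_list[symmetric] atLeast0LessThan)
  finally show ?thesis unfolding A_def .
qed

text \<open>
  The coefficients of \<open>(t - 1)^6 / t^3\<close>, that is of the third power of the second difference.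
\<close>
definition stencil :: "int \<Rightarrow> real" where
  "stencil l = (if l = 0 then - 20 else if \<bar>l\<bar> = 1 then 15 else if \<bar>l\<bar> = 2 then - 6 else if \<bar>l\<bar> = 3 then 1 else 0)"

lemma stencil_minus: "stencil (- l) = stencil l"
  by (simp add: stencil_def)

lemma symb_trig_poly: "symb (cis \<theta>) = (\<Sum>l\<in>{-3..3}. of_real (stencil l) * cis (of_int l * \<theta>))"
proof -
  have e: "{-3..3} = {-3, -2, -1, 0, 1, 2, 3 :: int}" by auto
  define t where "t = cis \<theta>"
  have t: "t \<noteq> 0" by (simp add: t_def)
  have pw: "cis (of_nat k * \<theta>) = t ^ k" "cis (- (of_nat k * \<theta>)) = inverse t ^ k" for k
    unfolding t_def by (simp_all add: Complex.DeMoivre cis_inverse)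
  have "cis (2 * \<theta>) = t ^ 2" "cis (3 * \<theta>) = t ^ 3" "cis (- \<theta>) = inverse t"
    "cis (- (2 * \<theta>)) = inverse t ^ 2" "cis (- (3 * \<theta>)) = inverse t ^ 3"
    using pw[of 2] pw[of 3] pw[of 1] by simp_all
  then have "(\<Sum>l\<in>{-3..3}. of_real (stencil l) * cis (of_int l * \<theta>))
      = inverse t ^ 3 - 6 * inverse t ^ 2 + 15 * inverse t - 20 + 15 * t - 6 * t ^ 2 + t ^ 3"
    unfolding e by (simp add: stencil_def t_def[symmetric])
  also have "\<dots> = (t - 2 + 1 / t) ^ 3"
    using t by (simp add: field_simps power2_eq_square power3_eq_cube)
  finally show ?thesis by (simp add: symb_def t_def)
qed

lemma integral_cis_int:
  "((\<lambda>\<theta>. cis (of_int m * \<theta>)) has_integral (if m = 0 then of_real (2 * pi) else 0)) {0..2 * pi}"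
proof (cases "m = 0")
  case True
  have "((\<lambda>\<theta>::real. 1 :: complex) has_integral (2 * pi - 0) *\<^sub>R 1) {0..2 * pi}"
    by (rule has_integral_const_real[where a = 0 and b = "2 * pi", unfolded content_real[OF less_imp_le[OF mult_pos_pos[OF zero_less_numeral pi_gt_zero]]]])
  then show ?thesis using True by (simp add: scaleR_conv_of_real)
next
  case False
  define f where "f = (\<lambda>\<theta>. cis (of_int m * \<theta>) / (\<i> * of_int m))"
  have "((\<lambda>\<theta>. cis (of_int m * \<theta>)) has_integral f (2 * pi) - f 0) {0..2 * pi}"
  proof (rule fundamental_theorem_of_calculus)
    fix x :: real
    have "((\<lambda>z. exp (\<i> * of_int m * z) / (\<i> * of_int m)) has_field_derivative exp (\<i> * of_int m * of_real x))
        (at (of_real x))"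
      using False by (auto intro!: derivative_eq_intros)
    from has_vector_derivative_real_field[OF this]
    show "(f has_vector_derivative cis (of_int m * x)) (at x within {0..2 * pi})"
      by (simp add: f_def cis_conv_exp mult.assoc)
  qed simp
  moreover have "f (2 * pi) = f 0"
    unfolding f_def using cis_multiple_2pi[of "of_int m"] by (simp add: mult_ac)
  ultimately show ?thesis using False by simp
qed

lemma fourier_coeff_symb: "fourier_coeff symb l = of_real (stencil l)"
proof -
  have "((\<lambda>\<theta>. \<Sum>m\<in>{-3..3}. of_real (stencil m) * cis (of_int (m - l) * \<theta>)) has_integral
      (\<Sum>m\<in>{-3..3}. of_real (stencil m) * (if m - l = 0 then of_real (2 * pi) else 0))) {0..2 * pi}"
    by (intro has_integral_sum has_integral_mult_right integral_cis_int) auto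
  also have "(\<lambda>\<theta>. \<Sum>m\<in>{-3..3}. of_real (stencil m) * cis (of_int (m - l) * \<theta>))
      = (\<lambda>\<theta>. symb (cis \<theta>) * cis (- (of_int l * \<theta>)))"
    unfolding symb_trig_poly sum_distrib_right mult.assoc cis_mult
    by (simp add: algebra_simps)
  also have "(\<Sum>m\<in>{-3..3}. of_real (stencil m) * (if m - l = 0 then of_real (2 * pi) else (0::complex)))
      = (\<Sum>m\<in>{-3..3}. if m = l then of_real (stencil l) * of_real (2 * pi) else 0)"
    by (rule sum.cong) auto
  also have "\<dots> = of_real (stencil l) * of_real (2 * pi)"
    by (auto simp: stencil_def)
  finally have "integral {0..2 * pi} (\<lambda>\<theta>. symb (cis \<theta>) * cis (- (of_int l * \<theta>)))
      = of_real (stencil l) * of_real (2 * pi)" by (rule integral_unique)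
  moreover have "complex_of_real (2 * pi) \<noteq> 0" by simp
  ultimately show ?thesis unfolding fourier_coeff_def by (metis nonzero_mult_div_cancel_right)
qed

lemma toeplitz_symb: "toeplitz symb n = mat n n (\<lambda>(i, k). complex_of_real (stencil (int i - int k)))"
  unfolding toeplitz_def fourier_coeff_symb ..

text \<open>
  Because the sequence vanishes at three places beyond either end, truncating the convolution to the
  index range of the matrix changes nothing.
\<close>
lemma stencil_sum:
  fixes X :: "int \<Rightarrow> real"
  assumes i: "i < n" and zero: "\<And>k. k \<in> {-3..<0} \<union> {int n..<int n + 3} \<Longrightarrow> X k = 0"
  shows "(\<Sum>k<n. stencil (int i - int k) * X (int k))
    = X (int i + 3) - 6 * X (int i + 2) + 15 * X (int i + 1) - 20 * X (int i)
      + 15 * X (int i - 1) - 6 * X (int i - 2) + X (int i - 3)"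
proof -
  have "(\<Sum>k<n. stencil (int i - int k) * X (int k)) = (\<Sum>k\<in>{0..<int n}. stencil (int i - k) * X k)"
    by (rule sum.reindex_bij_witness[of _ nat int]) auto
  also have "\<dots> = (\<Sum>k\<in>{-3..<int n + 3}. stencil (int i - k) * X k)"
    by (rule sum.mono_neutral_left) (auto intro!: zero)
  also have "\<dots> = (\<Sum>k\<in>{int i - 3..int i + 3}. stencil (int i - k) * X k)"
    by (rule sum.mono_neutral_right) (use i in \<open>auto simp: stencil_def\<close>)
  also have "{int i - 3..int i + 3} = {int i - 3, int i - 2, int i - 1, int i, int i + 1, int i + 2, int i + 3}"
    by auto
  also have "(\<Sum>k\<in>\<dots>. stencil (int i - k) * X k) = X (int i + 3) - 6 * X (int i + 2) + 15 * X (int i + 1) - 20 * X (int i)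
      + 15 * X (int i - 1) - 6 * X (int i - 2) + X (int i - 3)"
    by (simp add: stencil_def)
  finally show ?thesis .
qed

lemma diff2_iterate:
  fixes f :: "real \<Rightarrow> real"
  shows "diff2 (diff2 (diff2 f)) y = f (y + 3) - 6 * f (y + 2) + 15 * f (y + 1) - 20 * f y
      + 15 * f (y - 1) - 6 * f (y - 2) + f (y - 3)"
proof -
  have e: "y + 1 + 1 = y + 2" "y + 2 + 1 = y + 3" "y + 1 - 1 = y" "y + 2 - 1 = y + 1"
    "y - 1 - 1 = y - 2" "y - 2 - 1 = y - 3" "y - 1 + 1 = y" "y - 2 + 1 = y - 1" by simp_all
  show ?thesis unfolding diff2_def e by (simp only: algebra_simps)
qed

lemma inj_on_g: "inj_on g {0<..<pi}"
proof (rule inj_onI)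
  fix x y assume x: "x \<in> {0<..<pi}" and y: "y \<in> {0<..<pi}" and eq: "g x = g y"
  have "(2 * sin (x / 2)) ^ 6 = (2 * sin (y / 2)) ^ 6" using eq by (simp add: g_eq)
  then have "2 * sin (x / 2) = 2 * sin (y / 2)"
    by (rule power_eq_imp_eq_base) (use x y sin_half_pos[of x] sin_half_pos[of y] in auto)
  then have "sin (x / 2) = sin (y / 2)" by simp
  then have "x / 2 = y / 2" by (rule sin_inj_pi[rotated 4]) (use x y in auto)
  then show "x = y" by simp
qed

text \<open>
  The odd-numbered eigenvalues belong to vectors that are even under reflection of the index range,
  the even-numbered ones to vectors that are odd.
\<close>
definition shift :: "nat \<Rightarrow> real" where
  "shift m = (if odd m then 0 else pi / 2)"

lemma sin_shift: "sin (2 * shift m) = 0" and cos_shift: "cos (2 * shift m) = (if odd m then 1 else - 1)"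
  by (simp_all add: shift_def)

lemma eventually_phi:
  "\<forall>\<^sub>F n in sequentially. \<forall>m\<in>{1..n}. 0 < phi n m \<and> phi n m < pi \<and>
     cos (q n * phi n m - shift m) \<noteq> 0 \<and> tan (q n * phi n m - shift m) = secular (q n) (shift m) (phi n m) \<and>
     \<bar>q n * phi n m - shift m - real ((m + 1) div 2) * pi\<bar> < pi / 2"
  using eventually_roots
proof (eventually_elim, intro ballI)
  fix n m
  assume roots: "has_roots n"
    and m: "m \<in> {1..n}"
  define j where "j = (m + 1) div 2"
  have mn: "1 \<le> m" "m \<le> n" using m by auto
  have odd_j: "j \<in> {1..(n + 1) div 2}" if "odd m"
    unfolding j_def atLeastAtMost_iff using that mn by presburger
  have even_j: "j \<in> {1..n div 2}" "j = m div 2" if "even m"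
    unfolding j_def atLeastAtMost_iff using that mn by presburger+
  define d where "d = (if odd m then d1 n j else d2 n j)"
  have "\<exists>u. u \<in> {- (pi / 2)<..<pi / 2} \<and> u = arctan (secular (q n) (shift m) (d + u / q n)) \<and> phi n m = d + u / q n"
  proof (cases "odd m")
    case True
    from bspec[OF conjunct1[OF roots[unfolded has_roots_def]] odd_j[OF True]] True show ?thesis
      by (simp add: shift_def d_def phi_def j_def)
  next
    case False
    then have "even m" by simp
    from bspec[OF conjunct2[OF roots[unfolded has_roots_def]] even_j(1)[OF this]] False show ?thesis
      by (simp add: shift_def d_def phi_def even_j(2)[OF \<open>even m\<close>])
  qed
  then obtain u where u: "u \<in> {- (pi / 2)<..<pi / 2}" "u = arctan (secular (q n) (shift m) (d + u / q n))"
    "phi n m = d + u / q n" by blast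
  have d: "q n * d = shift m + real j * pi" by (simp add: d_def shift_def q_d1 q_d2)
  have range: "pi \<le> q n * d" "q n * d + pi / 2 < q n * pi"
    using d1_range[OF odd_j] d2_range[OF even_j(1)] by (auto simp: d_def)
  have eq: "q n * phi n m = q n * d + u" using less_imp_neq[OF q_pos[of n]] unfolding u(3) by (simp add: distrib_left)
  have t: "q n * phi n m - shift m = u + real j * pi" unfolding eq d by simp
  have "0 < q n * phi n m" "q n * phi n m < q n * pi" using range u(1) pi_gt_zero unfolding eq by auto
  then have "0 < phi n m" "phi n m < pi" using q_pos[of n] by (simp_all add: zero_less_mult_iff)
  moreover have "cos (u + real j * pi) \<noteq> 0"
    using cos_gt_zero_pi[of u] u(1) unfolding cos_add cos_npi sin_npi by simp
  moreover have "tan (u + real j * pi) = secular (q n) (shift m) (phi n m)"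
    unfolding tan_periodic_nat u(3) using u(2) tan_arctan by metis
  moreover have "\<bar>u + real j * pi - real j * pi\<bar> < pi / 2" using u(1) by auto
  ultimately show "0 < phi n m \<and> phi n m < pi \<and>
     cos (q n * phi n m - shift m) \<noteq> 0 \<and> tan (q n * phi n m - shift m) = secular (q n) (shift m) (phi n m) \<and>
     \<bar>q n * phi n m - shift m - real ((m + 1) div 2) * pi\<bar> < pi / 2"
    unfolding t j_def by blast
qed

text \<open>
  The reflection symmetry of the eigenfunctions turns the three boundary zeros on the right into three on
  the left, so their restrictions to the index range are eigenvectors. Indices of equal parity have
  different eigenvalues because their phases \<open>q n * phi\<close> lie in disjoint intervals of length \<open>pi\<close> and
  \<open>g\<close> is injective.
\<close>
lemma toeplitz_char_poly:
  assumes "\<forall>m\<in>{1..n}. 0 < phi n m \<and> phi n m < pi \<and>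
     cos (q n * phi n m - shift m) \<noteq> 0 \<and> tan (q n * phi n m - shift m) = secular (q n) (shift m) (phi n m) \<and>
     \<bar>q n * phi n m - shift m - real ((m + 1) div 2) * pi\<bar> < pi / 2"
  shows "char_poly (toeplitz symb n) = (\<Prod>m = 1..n. [:- of_real (lam n m), 1:])"
proof -
  define X where "X = (\<lambda>m k. eigenfun (q n) (shift m) (phi n m) (of_int k - (real n - 1) / 2))"
  define x where "x = (\<lambda>m k. X (Suc m) (int k))"
  define a where "a = (\<lambda>i k. stencil (int i - int k))"
  note root = bspec[OF assms]
  have reflect: "X m (int n - 1 - k) = cos (2 * shift m) * X m k" for m k
  proof -
    have "of_int (int n - 1 - k) - (real n - 1) / 2 = - (of_int k - (real n - 1) / 2)"
      by (simp add: field_simps)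
    then show ?thesis unfolding X_def by (simp only: eigenfun_reflect[OF sin_shift])
  qed
  have right: "X m k = 0" if m: "m \<in> {1..n}" and k: "k \<in> {int n..<int n + 3}" for m k
  proof -
    have e: "of_int (int n) - (real n - 1) / 2 = q n - 1" "of_int (int n + 1) - (real n - 1) / 2 = q n"
      "of_int (int n + 2) - (real n - 1) / 2 = q n + 1" by (simp_all add: q_def field_simps)
    have ends: "eigenfun (q n) (shift m) (phi n m) (q n) = 0"
      "eigenfun (q n) (shift m) (phi n m) (q n + 1) = 0" "eigenfun (q n) (shift m) (phi n m) (q n - 1) = 0"
      using eigenfun_end[of "phi n m" "q n" "shift m"] root[OF m] by simp_all
    consider "k = int n" | "k = int n + 1" | "k = int n + 2" using k by force
    then show ?thesis by cases (simp_all only: X_def e ends)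
  qed
  have left: "X m k = 0" if m: "m \<in> {1..n}" and k: "k \<in> {-3..<0}" for m k
  proof -
    have "X m (int n - 1 - k) = 0" by (rule right[OF m]) (use k in auto)
    then show ?thesis unfolding reflect cos_shift by (simp split: if_splits)
  qed
  have outside: "X m k = 0" if "m \<in> {1..n}" "k \<in> {-3..<0} \<union> {int n..<int n + 3}" for m k
    using left right that by blast
  have eigen: "(\<Sum>k<n. a i k * x m k) = lam n (Suc m) * x m i" if m: "m < n" and i: "i < n" for m i
  proof -
    define y where "y = real i - (real n - 1) / 2"
    have m': "Suc m \<in> {1..n}" using m by simp
    have e: "of_int (int i + c) - (real n - 1) / 2 = y + of_int c" "of_int (int i - c) - (real n - 1) / 2 = y - of_int c" for c
      by (simp_all add: y_def)
    have "(\<Sum>k<n. a i k * x m k) = X (Suc m) (int i + 3) - 6 * X (Suc m) (int i + 2) + 15 * X (Suc m) (int i + 1)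
      - 20 * X (Suc m) (int i) + 15 * X (Suc m) (int i - 1) - 6 * X (Suc m) (int i - 2) + X (Suc m) (int i - 3)"
      unfolding a_def x_def by (rule stencil_sum[OF i outside[OF m']])
    also have "\<dots> = diff2 (diff2 (diff2 (eigenfun (q n) (shift (Suc m)) (phi n (Suc m))))) y"
      unfolding diff2_iterate X_def e using e(1)[of 0] by simp
    also have "\<dots> = lam n (Suc m) * x m i" unfolding diff2_eigenfun by (simp add: lam_def x_def X_def y_def)
    finally show ?thesis .
  qed
  have distinct: "lam n m \<noteq> lam n m'" if m: "m \<in> {1..n}" "m' \<in> {1..n}" "m \<noteq> m'" "odd m \<longleftrightarrow> odd m'" for m m'
  proof
    have inside: "phi n k \<in> {0<..<pi}" if "k \<in> {1..n}" for k
      using root[OF that] unfolding greaterThanLessThan_iff by blast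
    assume "lam n m = lam n m'"
    then have eq: "phi n m = phi n m'"
      unfolding lam_def by (rule inj_onD[OF inj_on_g _ inside[OF m(1)] inside[OF m(2)]])
    define t where "t = q n * phi n m - shift m"
    have t: "t = q n * phi n m' - shift m'" using m(4) by (simp add: t_def eq shift_def)
    have "\<bar>t - real ((m + 1) div 2) * pi\<bar> < pi / 2" "\<bar>t - real ((m' + 1) div 2) * pi\<bar> < pi / 2"
      using root[OF m(1)] root[OF m(2)] unfolding t_def[symmetric] t[symmetric] by blast+
    then have "\<bar>real ((m + 1) div 2) * pi - real ((m' + 1) div 2) * pi\<bar> < pi" by linarith
    also have "\<bar>real ((m + 1) div 2) * pi - real ((m' + 1) div 2) * pi\<bar> = \<bar>real ((m + 1) div 2) - real ((m' + 1) div 2)\<bar> * pi"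
      unfolding left_diff_distrib[symmetric] abs_mult by simp
    finally have "\<bar>real ((m + 1) div 2) - real ((m' + 1) div 2)\<bar> < 1" by simp
    then have "(m + 1) div 2 = (m' + 1) div 2" by linarith
    then show False using m(3,4) by presburger
  qed
  have orth: "(\<Sum>k<n. x m k * x m' k) = 0" if m: "m < n" "m' < n" "m \<noteq> m'" for m m'
  proof (cases "odd (Suc m) \<longleftrightarrow> odd (Suc m')")
    case True
    define S where "S = (\<Sum>k<n. x m k * x m' k)"
    have "lam n (Suc m) * S = (\<Sum>i<n. (lam n (Suc m) * x m i) * x m' i)"
      by (simp add: S_def sum_distrib_left mult.assoc)
    also have "\<dots> = (\<Sum>i<n. \<Sum>k<n. a i k * x m k * x m' i)"
      by (rule sum.cong) (simp_all add: eigen[OF m(1), symmetric] sum_distrib_right)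
    also have "\<dots> = (\<Sum>k<n. \<Sum>i<n. a i k * x m k * x m' i)" by (rule sum.swap)
    also have "\<dots> = (\<Sum>k<n. x m k * (\<Sum>i<n. a k i * x m' i))"
    proof (intro sum.cong refl)
      fix k
      have "a i k = a k i" for i using stencil_minus[of "int i - int k"] by (simp add: a_def)
      then show "(\<Sum>i<n. a i k * x m k * x m' i) = x m k * (\<Sum>i<n. a k i * x m' i)"
        by (simp add: sum_distrib_left mult_ac)
    qed
    also have "\<dots> = lam n (Suc m') * S"
      by (simp add: eigen[OF m(2)] S_def sum_distrib_left mult_ac)
    finally have "(lam n (Suc m) - lam n (Suc m')) * S = 0" by (simp add: left_diff_distrib)
    moreover have "lam n (Suc m) \<noteq> lam n (Suc m')" by (rule distinct) (use m True in auto)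
    ultimately show ?thesis by (simp add: S_def)
  next
    case False
    have flip: "x k (n - Suc i) = cos (2 * shift (Suc k)) * x k i" if "i < n" for k i
      using reflect[of "Suc k" "int i"] that by (simp add: x_def of_nat_diff algebra_simps)
    have "(\<Sum>k<n. x m k * x m' k) = (\<Sum>i<n. x m (n - Suc i) * x m' (n - Suc i))"
      by (rule sum.nat_diff_reindex[symmetric])
    also have "\<dots> = (\<Sum>i<n. - (x m i * x m' i))"
      by (rule sum.cong) (use False in \<open>auto simp: flip cos_shift\<close>)
    finally show ?thesis by (simp add: sum_negf)
  qed
  have nonzero: "\<exists>k<n. x m k \<noteq> 0" if m: "m < n" for m
  proof (rule ccontr)
    assume "\<not> (\<exists>k<n. x m k \<noteq> 0)"
    then have inside: "X (Suc m) (int k) = 0" if "k < n" for k using that by (auto simp: x_def)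
    have m': "Suc m \<in> {1..n}" using m by simp
    have all: "X (Suc m) k = 0" if "k \<in> {-3..<int n + 3}" for k
      using outside[OF m', of k] inside[of "nat k"] that by (cases "k \<in> {0..<int n}") auto
    show False
    proof (rule eigenfun_nonzero[of "phi n (Suc m)" "q n" "shift (Suc m)"])
      fix k :: nat assume k: "k \<in> {0..5}"
      have "of_int (int n + 2 - int k) - (real n - 1) / 2 = q n + 1 - real k" by (simp add: q_def field_simps)
      moreover have "X (Suc m) (int n + 2 - int k) = 0" by (rule all) (use k m in auto)
      ultimately show "eigenfun (q n) (shift (Suc m)) (phi n (Suc m)) (q n + 1 - real k) = 0"
        by (simp only: X_def)
    qed (use root[OF m'] in auto)
  qed
  have "char_poly (toeplitz symb n) = (\<Prod>m<n. [:- of_real (lam n (Suc m)), 1:])"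
    unfolding toeplitz_symb
    using char_poly_orthogonal_eigenvectors[of n a x "\<lambda>m. lam n (Suc m)"] eigen orth nonzero
    unfolding a_def by blast
  also have "\<dots> = (\<Prod>m = 1..n. [:- of_real (lam n m), 1:])"
    by (rule prod.reindex_bij_witness[of _ "\<lambda>m. m - 1" Suc]) auto
  finally show ?thesis .
qed

lemma eventually_char_poly:
  "\<forall>\<^sub>F n in sequentially. char_poly (toeplitz symb n) = (\<Prod>m = 1..n. [:- of_real (lam n m), 1:])"
  using eventually_phi by eventually_elim (rule toeplitz_char_poly)

section \<open>Roots beyond the logarithmic range\<close>

lemma sin_ge_half: fixes x :: real assumes "0 \<le> x" "x \<le> pi / 2" shows "x / 2 \<le> sin x"
proof -
  have small: "5 / 6 * y \<le> sin y" if "0 \<le> y" "y \<le> 1" for y :: real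
  proof -
    have "\<bar>sin y - y\<bar> \<le> y ^ 3 / 6"
      using Maclaurin_sin_bound[of y 3] that by (simp add: sin_coeff_def numeral_3_eq_3 fact_numeral)
    moreover have "y ^ 3 \<le> y" using that power_decreasing[of 1 3 y] by simp
    ultimately show ?thesis by linarith
  qed
  show ?thesis
  proof (cases "x \<le> 1")
    case True
    then show ?thesis using small[of x] assms by simp
  next
    case False
    have "sin 1 \<le> sin x" using False assms by (intro sin_monotone_2pi_le) auto
    moreover have "5 / 6 \<le> sin (1 :: real)" using small[of 1] by simp
    moreover have "pi \<le> 32 / 10" using pi_approx(2) by simp
    ultimately show ?thesis using assms by linarith
  qed
qed

lemma arctan_Lipschitz: "\<bar>arctan a - arctan b\<bar> \<le> \<bar>a - b\<bar>"
proof -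
  have "norm (arctan a - arctan b) \<le> 1 * norm (a - b)"
  proof (rule field_differentiable_bound[where S = UNIV])
    fix x :: real
    show "(arctan has_field_derivative inverse (1 + x\<^sup>2)) (at x within UNIV)"
      using DERIV_arctan by simp
    have "1 \<le> 1 + x\<^sup>2" by simp
    then have "inverse (1 + x\<^sup>2) \<le> 1" by (simp add: inverse_le_1_iff)
    moreover have "inverse (1 + x\<^sup>2) \<ge> 0" using \<open>1 \<le> 1 + x\<^sup>2\<close> by simp
    ultimately show "norm (inverse (1 + x\<^sup>2)) \<le> 1" by simp
  qed auto
  then show ?thesis by simp
qed

text \<open>
  The limit of \<open>arctan (secular N \<theta> \<phi>)\<close> when \<open>tan (N \<beta> - \<theta>)\<close> is replaced by its limit \<open>i\<close>.
\<close>
definition eta :: "real \<Rightarrow> real" where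
  "eta \<phi> = arctan (- 2 * Im (sigma \<phi>))"

text \<open>
  The derivative of \<open>eta\<close>, written without the pole of \<open>sigma\<close> at \<open>pi\<close>, so that it is continuous on
  the closed interval \<open>[0, pi]\<close>.
\<close>
definition eta' :: "real \<Rightarrow> real" where
  "eta' \<phi> = - sin (\<phi> / 2) * Im ((1 - cis (2 * pi / 3)) / tau \<phi>)
      / ((cos (\<phi> / 2))\<^sup>2 + 4 * (Im (tau \<phi>))\<^sup>2)"

definition sigma' :: "real \<Rightarrow> complex" where
  "sigma' \<phi> = of_real (sin (\<phi> / 2)) * (1 - cis (2 * pi / 3)) / (2 * tau \<phi> * of_real ((cos (\<phi> / 2))\<^sup>2))"

lemma Im_sigma: "Im (sigma \<phi>) = Im (tau \<phi>) / cos (\<phi> / 2)"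
  by (simp add: sigma_def)

lemma Im_sigma_has_derivative:
  assumes "0 < \<phi>" "\<phi> < pi"
  shows "((\<lambda>\<phi>. Im (sigma \<phi>)) has_real_derivative Im (sigma' \<phi>)) (at \<phi>)"
  unfolding has_real_derivative_iff_has_vector_derivative sigma'_def
  by (intro bounded_linear.has_vector_derivative[OF bounded_linear_Im] sigma_has_vector_derivative assms)

lemma eta'_denominator_pos: "(cos (\<phi> / 2))\<^sup>2 + 4 * (Im (tau \<phi>))\<^sup>2 > 0"
proof (cases "sin (\<phi> / 2) = 0")
  case True
  then have "(cos (\<phi> / 2))\<^sup>2 = 1" using sin_cos_squared_add[of "\<phi> / 2"] by simp
  then show ?thesis using zero_le_power2[of "Im (tau \<phi>)"] by linarith
next
  case False
  then have "(sin (\<phi> / 2))\<^sup>2 > 0" by simp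
  then have "Im (tau \<phi>) \<noteq> 0" using Im_tau_le[of \<phi>] by auto
  then have "(Im (tau \<phi>))\<^sup>2 > 0" by simp
  then show ?thesis using zero_le_power2[of "cos (\<phi> / 2)"] by linarith
qed

lemma eta'_eq:
  assumes "0 < \<phi>" "\<phi> < pi"
  shows "eta' \<phi> = - 2 * Im (sigma' \<phi>) / (1 + 4 * (Im (sigma \<phi>))\<^sup>2)"
proof -
  define s where "s = sin (\<phi> / 2)"
  define c where "c = cos (\<phi> / 2)"
  define t where "t = Im (tau \<phi>)"
  define W where "W = Im ((1 - cis (2 * pi / 3)) / tau \<phi>)"
  have c: "c > 0" using cos_half_pos[OF assms] by (simp add: c_def)
  have "sigma' \<phi> = of_real (s / (2 * c\<^sup>2)) * ((1 - cis (2 * pi / 3)) / tau \<phi>)"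
    by (simp add: sigma'_def s_def c_def)
  then have "Im (sigma' \<phi>) = s / (2 * c\<^sup>2) * W"
    unfolding W_def by (simp only: times_complex.sel Re_complex_of_real Im_complex_of_real mult_zero_left add_0_right)
  moreover have "Im (sigma \<phi>) = t / c" by (simp add: Im_sigma t_def c_def)
  moreover have "1 + 4 * (t / c)\<^sup>2 = (c\<^sup>2 + 4 * t\<^sup>2) / c\<^sup>2" using c by (simp add: field_simps power_divide)
  moreover have "c\<^sup>2 + 4 * t\<^sup>2 > 0" using eta'_denominator_pos by (simp add: c_def t_def)
  ultimately show ?thesis unfolding eta'_def s_def[symmetric] c_def[symmetric] t_def[symmetric] W_def[symmetric]
    using c by simp
qed

lemma eta_has_derivative:
  assumes "0 < \<phi>" "\<phi> < pi"
  shows "(eta has_real_derivative eta' \<phi>) (at \<phi>)"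
proof -
  have "((\<lambda>\<phi>. - 2 * Im (sigma \<phi>)) has_real_derivative - 2 * Im (sigma' \<phi>)) (at \<phi>)"
    by (rule DERIV_cmult[OF Im_sigma_has_derivative[OF assms]])
  from DERIV_chain2[OF DERIV_arctan this]
  have "(eta has_real_derivative inverse (1 + (- 2 * Im (sigma \<phi>))\<^sup>2) * (- 2 * Im (sigma' \<phi>))) (at \<phi>)"
    unfolding eta_def[abs_def] .
  then show ?thesis unfolding eta'_eq[OF assms] by (simp add: power_mult_distrib field_simps)
qed

lemma continuous_on_eta': "continuous_on S eta'"
proof -
  have "continuous_on S tau"
    by (meson tau_has_vector_derivative has_vector_derivative_continuous continuous_at_imp_continuous_on)
  then show ?thesis unfolding eta'_def
    using eta'_denominator_pos by (intro continuous_intros) (auto simp: less_le)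
qed

lemma C_fun_sigma: "0 < \<phi> \<Longrightarrow> \<phi> < pi \<Longrightarrow> C_fun \<phi> = - Im (sigma \<phi>) * sin \<phi>"
  using sin_double[of "\<phi> / 2"] cos_half_pos[of \<phi>] by (simp add: C_fun_eq Im_sigma)

lemma outer1_eq: assumes "0 < d" "d < pi" shows "outer1 d = eta d"
  using sin_gt_zero[OF assms] by (simp add: outer1_def eta_def C_fun_sigma[OF assms])

lemma outer2_eq: assumes d: "0 < d" "d < pi" shows "outer2 d = eta' d * eta d"
proof -
  define S where "S = sin d"
  have S: "S > 0" using sin_gt_zero[OF d] by (simp add: S_def)
  have "((\<lambda>\<phi>. - Im (sigma \<phi>) * sin \<phi>) has_real_derivative - Im (sigma' d) * S + - Im (sigma d) * cos d) (at d)"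
    unfolding S_def
    by (rule DERIV_cong[OF DERIV_mult[OF DERIV_minus[OF Im_sigma_has_derivative[OF d]] DERIV_sin]]) simp
  then have "(C_fun has_real_derivative - Im (sigma' d) * S + - Im (sigma d) * cos d) (at d)"
    by (rule has_field_derivative_transform_within_open[where S = "{0<..<pi}"])
       (use d C_fun_sigma in auto)
  then have dC: "deriv C_fun d = - Im (sigma' d) * S + - Im (sigma d) * cos d" by (rule DERIV_imp_deriv)
  have "deriv C_fun d * S - C_fun d * cos d = - Im (sigma' d) * S\<^sup>2"
    unfolding dC C_fun_sigma[OF d] S_def[symmetric] by (simp add: algebra_simps power2_eq_square)
  moreover have "S\<^sup>2 + 4 * (C_fun d)\<^sup>2 = S\<^sup>2 * (1 + 4 * (Im (sigma d))\<^sup>2)"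
    unfolding C_fun_sigma[OF d] S_def[symmetric] by (simp add: algebra_simps power_mult_distrib)
  ultimately have "outer2 d = 2 * (- Im (sigma' d) * S\<^sup>2 / (S\<^sup>2 * (1 + 4 * (Im (sigma d))\<^sup>2))) * outer1 d"
    unfolding outer2_def outer1_def S_def by simp
  also have "\<dots> = eta' d * eta d" unfolding eta'_eq[OF d] outer1_eq[OF d] using S by simp
  finally show ?thesis .
qed

text \<open>
  The arctangent is 1-Lipschitz and \<open>tan (N \<beta> - \<theta>)\<close> is exponentially close to \<open>i\<close>.
\<close>
lemma arctan_secular_near_eta:
  assumes \<phi>: "0 < \<phi>" "\<phi> < pi" and y: "N * Im (beta_arcsin \<phi>) \<ge> 5 / 4"
  shows "\<bar>arctan (secular N \<theta> \<phi>) - eta \<phi>\<bar> \<le> 15 / 2 * exp (- (2 * (N * Im (beta_arcsin \<phi>)))) / cos (\<phi> / 2)"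
proof -
  define c where "c = cos (\<phi> / 2)"
  define t where "t = tan (of_real N * beta_arcsin \<phi> - of_real \<theta>)"
  have c: "c > 0" using cos_half_pos[OF \<phi>] by (simp add: c_def)
  have t: "cmod (t - \<i>) \<le> 5 / 2 * exp (- (2 * (N * Im (beta_arcsin \<phi>))))"
    using tan_near_i(1)[of "of_real N * beta_arcsin \<phi> - of_real \<theta>"] y unfolding t_def by simp
  have "sigma \<phi> * t = sigma \<phi> * (t - \<i>) + sigma \<phi> * \<i>" by (simp add: algebra_simps)
  then have "Re (sigma \<phi> * t) = Re (sigma \<phi> * (t - \<i>)) + Re (sigma \<phi> * \<i>)" by (simp only: plus_complex.sel)
  moreover have "Re (sigma \<phi> * \<i>) = - Im (sigma \<phi>)" by simp
  ultimately have "secular N \<theta> \<phi> - (- 2 * Im (sigma \<phi>)) = 2 * Re (sigma \<phi> * (t - \<i>))"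
    unfolding secular_def t_def[symmetric] by linarith
  then have "\<bar>secular N \<theta> \<phi> - (- 2 * Im (sigma \<phi>))\<bar> \<le> 2 * (cmod (sigma \<phi>) * cmod (t - \<i>))"
    using abs_Re_le_cmod[of "sigma \<phi> * (t - \<i>)"] by (simp add: norm_mult)
  also have "cmod (sigma \<phi>) = cmod (tau \<phi>) / c" using c by (simp add: sigma_def norm_divide c_def)
  also have "2 * (cmod (tau \<phi>) / c * cmod (t - \<i>)) \<le> 2 * ((3 / 2) / c * (5 / 2 * exp (- (2 * (N * Im (beta_arcsin \<phi>))))))"
    using t norm_tau_le[of \<phi>] c by (intro mult_left_mono mult_mono divide_right_mono) auto
  also have "\<dots> = 15 / 2 * exp (- (2 * (N * Im (beta_arcsin \<phi>)))) / c" by simp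
  finally show ?thesis using arctan_Lipschitz[of "secular N \<theta> \<phi>" "- 2 * Im (sigma \<phi>)"]
    unfolding eta_def c_def by linarith
qed

lemma eta_mean_value:
  assumes "0 < x" "x < pi" "0 < y" "y < pi"
  shows "\<exists>\<xi>. eta y - eta x = eta' \<xi> * (y - x) \<and> \<xi> \<in> {0<..<pi} \<and> \<bar>\<xi> - x\<bar> \<le> \<bar>y - x\<bar>"
proof -
  have mvt: "\<exists>z>a. z < b \<and> eta b - eta a = (b - a) * eta' z" if "0 < a" "a < b" "b < pi" for a b
    by (rule MVT2[OF that(2)]) (use that in \<open>auto intro!: eta_has_derivative\<close>)
  consider "x = y" | "x < y" | "y < x" by linarith
  then show ?thesis
  proof cases
    case 1
    then show ?thesis using assms by (intro exI[of _ x]) auto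
  next
    case 2
    then obtain z where "x < z" "z < y" "eta y - eta x = (y - x) * eta' z" using mvt assms by blast
    then show ?thesis using assms by (intro exI[of _ z]) (simp add: mult.commute)
  next
    case 3
    then obtain z where z: "y < z" "z < x" "eta x - eta y = (x - y) * eta' z" using mvt assms by blast
    have "eta y - eta x = - ((x - y) * eta' z)" using z(3) by linarith
    also have "\<dots> = eta' z * (y - x)" by (simp add: algebra_simps)
    finally show ?thesis using z assms by (intro exI[of _ z]) simp
  qed
qed

text \<open>
  By the mean value theorem \<open>u - eta d\<close> is \<open>eta' \<xi> * u / N\<close> up to \<open>O (1 / N\<^sup>2)\<close> with \<open>\<xi>\<close> close to
  \<open>d\<close>. Uniform continuity of \<open>eta'\<close> on the compact interval allows replacing \<open>\<xi>\<close> by \<open>d\<close>, and \<open>u\<close> may be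
  replaced by \<open>eta d\<close> as the two differ by \<open>O (1 / N)\<close>. Continuity of \<open>eta'\<close> suffices because the claim
  is only a remainder \<open>o (1 / N)\<close>.
\<close>
lemma root_first_order:
  assumes "\<epsilon> > 0"
  shows "\<exists>N0. \<forall>N\<ge>N0. \<forall>d u. 0 < d \<and> d < pi \<and> 0 < d + u / N \<and> d + u / N < pi \<and> \<bar>u\<bar> \<le> 2 \<and>
     \<bar>u - eta (d + u / N)\<bar> \<le> 24 / N\<^sup>2 \<longrightarrow> \<bar>u - eta d - eta' d * eta d / N\<bar> \<le> \<epsilon> / N"
proof -
  have "compact (eta' ` {0..pi})" by (intro compact_continuous_image continuous_on_eta') auto
  then obtain K where K: "K > 0" "\<And>x. x \<in> {0..pi} \<Longrightarrow> \<bar>eta' x\<bar> \<le> K"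
    using compact_imp_bounded bounded_pos by (metis image_eqI real_norm_def)
  have "uniformly_continuous_on {0..pi} eta'"
    by (intro compact_uniformly_continuous continuous_on_eta') auto
  then obtain \<delta> where \<delta>: "\<delta> > 0"
    "\<And>x y. x \<in> {0..pi} \<Longrightarrow> y \<in> {0..pi} \<Longrightarrow> \<bar>y - x\<bar> < \<delta> \<Longrightarrow> \<bar>eta' y - eta' x\<bar> < \<epsilon> / 6"
    unfolding uniformly_continuous_on_def dist_real_def using assms by (metis divide_pos_pos zero_less_numeral)
  \<comment> \<open>The four thresholds: \<open>1 / N\<^sup>2 \<le> 1 / N\<close>; \<open>\<bar>u / N\<bar> < \<delta>\<close>; and two of the three
    summands of the total error are at most \<open>\<epsilon> / 3\<close>. The third comes from \<open>\<delta>\<close>.\<close>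
  define N0 where "N0 = Max {1, 3 / \<delta>, 72 / \<epsilon>, 3 * K * (24 + 2 * K) / \<epsilon>}"
  show ?thesis
  proof (intro exI[of _ N0] allI impI, elim conjE)
    fix N d u assume N: "N0 \<le> N" and d: "0 < d" "d < pi" "0 < d + u / N" "d + u / N < pi"
      and u: "\<bar>u\<bar> \<le> 2" and near: "\<bar>u - eta (d + u / N)\<bar> \<le> 24 / N\<^sup>2"
    have N1: "1 \<le> N" and N2: "3 / \<delta> \<le> N" and N3: "72 / \<epsilon> \<le> N" and N4: "3 * K * (24 + 2 * K) / \<epsilon> \<le> N"
      using N by (auto simp: N0_def)
    have Npos: "N > 0" using N1 by simp
    have "\<exists>\<xi>. eta (d + u / N) - eta d = eta' \<xi> * (u / N) \<and> \<xi> \<in> {0<..<pi} \<and> \<bar>\<xi> - d\<bar> \<le> \<bar>u / N\<bar>"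
      using eta_mean_value[of d "d + u / N"] d by simp
    then obtain \<xi> where \<xi>: "eta (d + u / N) - eta d = eta' \<xi> * (u / N)" "\<xi> \<in> {0<..<pi}" "\<bar>\<xi> - d\<bar> \<le> \<bar>u / N\<bar>" by blast
    have uN: "\<bar>u / N\<bar> \<le> 2 / N" using u Npos by (simp add: abs_divide divide_right_mono)
    have "2 / N < \<delta>" using N2 Npos \<delta>(1) by (simp add: field_simps)
    then have E: "\<bar>eta' \<xi> - eta' d\<bar> < \<epsilon> / 6"
      using \<delta>(2)[of d \<xi>] \<xi> d uN by (simp add: abs_minus_commute)
    define e where "e = u - eta (d + u / N)"
    have e2: "\<bar>e\<bar> \<le> 24 / N\<^sup>2" using near by (simp add: e_def)
    have e1: "24 / N\<^sup>2 \<le> 24 / N" using N1 by (intro divide_left_mono) (auto simp: power2_eq_square)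
    have u_eta: "u - eta d = e + eta' \<xi> * (u / N)" using \<xi>(1) by (simp add: e_def)
    have "\<bar>eta' \<xi> * (u / N)\<bar> \<le> K * (2 / N)"
      unfolding abs_mult using K(2)[of \<xi>] \<xi>(2) uN K(1) by (intro mult_mono) auto
    then have "\<bar>u - eta d\<bar> \<le> 24 / N + K * (2 / N)" using u_eta e2 e1 by linarith
    also have "\<dots> = (24 + 2 * K) / N" by (simp add: add_divide_distrib)
    finally have ue: "\<bar>u - eta d\<bar> \<le> (24 + 2 * K) / N" .
    have "\<bar>(eta' \<xi> - eta' d) * u\<bar> \<le> \<epsilon> / 6 * 2" unfolding abs_mult using E u assms by (intro mult_mono) auto
    moreover have "\<bar>eta' d * (u - eta d)\<bar> \<le> K * ((24 + 2 * K) / N)"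
      unfolding abs_mult using K(2)[of d] d ue K(1) by (intro mult_mono) auto
    moreover have "K * ((24 + 2 * K) / N) \<le> \<epsilon> / 3" using N4 Npos assms by (simp add: field_simps)
    moreover have eN: "\<bar>e * N\<bar> \<le> \<epsilon> / 3"
    proof -
      have "\<bar>e * N\<bar> \<le> 24 / N\<^sup>2 * N" unfolding abs_mult using e2 Npos by (intro mult_mono) auto
      also have "\<dots> = 24 / N" using Npos by (simp add: power2_eq_square)
      also have "\<dots> \<le> \<epsilon> / 3" using N3 Npos assms by (simp add: field_simps)
      finally show ?thesis .
    qed
    moreover have "(u - eta d - eta' d * eta d / N) * N = e * N + (eta' \<xi> - eta' d) * u + eta' d * (u - eta d)"
    proof -
      have "(u - eta d - eta' d * eta d / N) * N = (u - eta d) * N - eta' d * eta d"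
        using Npos by (simp add: field_simps)
      also have "(u - eta d) * N = e * N + eta' \<xi> * u" unfolding u_eta using Npos by (simp add: field_simps)
      also have "e * N + eta' \<xi> * u - eta' d * eta d = e * N + (eta' \<xi> - eta' d) * u + eta' d * (u - eta d)"
        by (simp add: algebra_simps)
      finally show ?thesis .
    qed
    ultimately have "\<bar>(u - eta d - eta' d * eta d / N) * N\<bar> \<le> \<epsilon>" by linarith
    then show "\<bar>u - eta d - eta' d * eta d / N\<bar> \<le> \<epsilon> / N"
      using Npos by (simp add: abs_mult pos_le_divide_eq)
  qed
qed

section \<open>The fixed point equations in the logarithmic range\<close>

text \<open>
  The function \<open>Z\<^sub>1\<close> of both cases at once: \<open>e = 1\<close> gives superscript (1), and \<open>e = - 1\<close> gives superscript
  (2) up to a sign, which matches the sign in the fixed point equation there.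
\<close>
definition Z_signed :: "real \<Rightarrow> nat \<Rightarrow> real \<Rightarrow> real \<Rightarrow> real" where
  "Z_signed e n d u = 2 * (B1 d * (e * sin (Pa n d u)) + C1 d * sinh (Pb n d u))
      / (e * cos (Pa n d u) + cosh (Pb n d u))"

definition Z_deriv :: "real \<Rightarrow> nat \<Rightarrow> real \<Rightarrow> real \<Rightarrow> real" where
  "Z_deriv e n d u =
     (2 * (B1 d * (e * cos (Pa n d u)) + C1 d * (cosh (Pb n d u) * sqrt 3)) * (e * cos (Pa n d u) + cosh (Pb n d u))
      - 2 * (B1 d * (e * sin (Pa n d u)) + C1 d * sinh (Pb n d u)) * (e * (- sin (Pa n d u)) + sinh (Pb n d u) * sqrt 3))
     / ((e * cos (Pa n d u) + cosh (Pb n d u)) * (e * cos (Pa n d u) + cosh (Pb n d u)))"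

lemma Z1_eq: "Z1_1 n d u = Z_signed 1 n d u" "Z1_2 n d u = - Z_signed (- 1) n d u"
  unfolding Z1_1_def Z1_2_def Z_signed_def minus_divide_left by (simp_all add: algebra_simps)

lemma scaled_quotient:
  fixes h :: real assumes "h \<noteq> 0"
  shows "((a / h) * (v / h) - (u / h) * (w / h)) / (v / h)\<^sup>2 = (a * v - u * w) / (v * v)"
proof -
  have "(a / h) * (v / h) - (u / h) * (w / h) = (a * v - u * w) / (h * h)"
    by (simp add: diff_divide_distrib)
  moreover have "(v / h)\<^sup>2 = (v * v) / (h * h)" by (simp add: power2_eq_square)
  ultimately show ?thesis using assms by simp
qed

text \<open>
  The factors \<open>1 / cosh\<close> in \<open>X\<^sub>1, X\<^sub>3, Y\<^sub>1, Y\<^sub>3\<close> cancel, and what remains is the quotient rule.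
\<close>
lemma Z3_eq: "Z3_1 n d u = Z_deriv 1 n d u" "Z3_2 n d u = Z_deriv (- 1) n d u"
proof -
  define h where "h = cosh (Pb n d u)"
  define S where "S = sin (Pa n d u)"
  define K where "K = cos (Pa n d u)"
  define T where "T = sinh (Pb n d u)"
  have h: "h > 0" by (simp add: h_def)
  note defs = h_def[symmetric] S_def[symmetric] K_def[symmetric] T_def[symmetric]
  have X1: "X1_1 n d u = (2 * (B1 d * (1 * S) + C1 d * T)) / h"
    "X1_2 n d u = (2 * (B1 d * (- 1 * S) + C1 d * T)) / h"
    unfolding X1_1_def X1_2_def defs using h by (simp_all add: field_simps)
  have X3: "X3_1 n d u = (2 * (B1 d * (1 * K) + C1 d * (h * sqrt 3))) / h"
    "X3_2 n d u = (2 * (B1 d * (- 1 * K) + C1 d * (h * sqrt 3))) / h"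
    unfolding X3_1_def X3_2_def defs using h by (simp_all add: field_simps)
  have Y1: "Y1_1 n d u = (1 * K + h) / h" "Y1_2 n d u = (- 1 * K + h) / h"
    unfolding Y1_1_def Y1_2_def defs using h by (simp_all add: field_simps)
  have Y3: "Y3_1 n d u = (1 * (- S) + T * sqrt 3) / h" "Y3_2 n d u = (- 1 * (- S) + T * sqrt 3) / h"
    unfolding Y3_1_def Y3_2_def defs using h by (simp_all add: field_simps)
  have h0: "h \<noteq> 0" using h by simp
  show "Z3_1 n d u = Z_deriv 1 n d u"
    unfolding Z3_1_def X1 X3 Y1 Y3 Z_deriv_def defs by (rule scaled_quotient[OF h0])
  show "Z3_2 n d u = Z_deriv (- 1) n d u"
    unfolding Z3_2_def X1 X3 Y1 Y3 Z_deriv_def defs by (rule scaled_quotient[OF h0])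
qed

lemma Z_signed_denominator_pos:
  assumes "\<bar>e\<bar> \<le> 1" "Pb n d u \<noteq> 0"
  shows "e * cos (Pa n d u) + cosh (Pb n d u) > 0"
proof -
  have "cosh (Pb n d u) > 1"
    using cosh_real_strict_mono[of 0 "\<bar>Pb n d u\<bar>"] assms(2) by simp
  moreover have "\<bar>e * cos (Pa n d u)\<bar> \<le> 1 * 1"
    unfolding abs_mult using assms(1) by (intro mult_mono) auto
  ultimately show ?thesis by linarith
qed

lemma Z_signed_has_derivative:
  assumes "\<bar>e\<bar> \<le> 1" "Pb n d u \<noteq> 0"
  shows "(Z_signed e n d has_real_derivative Z_deriv e n d u) (at u)"
proof -
  define U where "U = (\<lambda>u. 2 * (B1 d * (e * sin (Pa n d u)) + C1 d * sinh (Pb n d u)))"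
  define V where "V = (\<lambda>u. e * cos (Pa n d u) + cosh (Pb n d u))"
  have P: "((\<lambda>u. Pa n d u) has_real_derivative 1) (at u)" "((\<lambda>u. Pb n d u) has_real_derivative sqrt 3) (at u)"
    unfolding Pa_def Pb_def by (auto intro!: derivative_eq_intros)
  have dP: "((\<lambda>u. sin (Pa n d u)) has_real_derivative cos (Pa n d u)) (at u)"
    "((\<lambda>u. cos (Pa n d u)) has_real_derivative - sin (Pa n d u)) (at u)"
    "((\<lambda>u. sinh (Pb n d u)) has_real_derivative cosh (Pb n d u) * sqrt 3) (at u)"
    "((\<lambda>u. cosh (Pb n d u)) has_real_derivative sinh (Pb n d u) * sqrt 3) (at u)"
    using P by (auto intro!: derivative_eq_intros)
  have dU: "(U has_real_derivative 2 * (B1 d * (e * cos (Pa n d u)) + C1 d * (cosh (Pb n d u) * sqrt 3))) (at u)"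
    unfolding U_def by (intro DERIV_cmult DERIV_add dP)
  have dV: "(V has_real_derivative e * (- sin (Pa n d u)) + sinh (Pb n d u) * sqrt 3) (at u)"
    unfolding V_def by (intro DERIV_cmult DERIV_add dP)
  have "V u \<noteq> 0" using Z_signed_denominator_pos[OF assms] by (simp add: V_def)
  from DERIV_divide[OF dU dV this] show ?thesis
    unfolding U_def V_def Z_signed_def[abs_def] Z_deriv_def by simp
qed

lemma Z_signed_complex:
  assumes "sin (2 * \<theta>) = 0" "Pb n d u > 0"
  shows "Z_signed (cos (2 * \<theta>)) n d u
     = 2 * Re (Complex (B1 d) (- C1 d) * tan (cis (pi / 3) * of_real (Pa n d u) - of_real \<theta>))"
proof -
  define z where "z = cis (pi / 3) * of_real (Pa n d u) - of_real \<theta>"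
  have z: "2 * Re z = Pa n d u - 2 * \<theta>" "2 * Im z = Pb n d u"
    by (simp_all add: z_def Pa_def Pb_def cis_sixth)
  have "Im z > 0" using z(2) assms(2) by linarith
  from Re_mult_tan[OF this, of "B1 d" "C1 d"]
  have "Re (Complex (B1 d) (- C1 d) * tan z) = (B1 d * (cos (2 * \<theta>) * sin (Pa n d u)) + C1 d * sinh (Pb n d u))
      / (cos (2 * \<theta>) * cos (Pa n d u) + cosh (Pb n d u))"
    unfolding z sin_diff cos_diff assms(1) by (simp only: mult_zero_right diff_zero add_0_right mult.commute[of _ "cos (2 * \<theta>)"])
  then show ?thesis unfolding z_def[symmetric] Z_signed_def by simp
qed

lemma B1_C1_norm: assumes "0 \<le> d" "d \<le> 1 / 10" shows "cmod (Complex (B1 d) (- C1 d)) \<le> 21 / 20"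
proof -
  have d2: "0 \<le> d\<^sup>2" "d\<^sup>2 \<le> 1 / 100" using power_mono[OF assms(2,1), of 2] by (simp_all add: power_divide)
  have "sqrt 3 \<le> 2" by (rule real_le_lsqrt) auto
  then have "sqrt 3 / 16 * d\<^sup>2 \<le> 2 / 16 * d\<^sup>2" using d2 by (intro mult_right_mono) auto
  moreover have "cmod (Complex (B1 d) (- C1 d)) \<le> \<bar>B1 d\<bar> + \<bar>C1 d\<bar>"
    using cmod_le[of "Complex (B1 d) (- C1 d)"] by simp
  moreover have "\<bar>B1 d\<bar> = 1 + 3 / 16 * d\<^sup>2" "\<bar>C1 d\<bar> = sqrt 3 / 16 * d\<^sup>2"
    using d2 by (simp_all add: B1_def C1_def)
  ultimately show ?thesis using d2 by linarith
qed

lemma Pb_ge: assumes "pi / 2 \<le> Pa n d u" shows "5 / 2 \<le> Pb n d u"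
proof -
  have s3: "sqrt 3 \<ge> 17 / 10" by (rule real_le_rsqrt) (simp add: power2_eq_square)
  have "5 / 2 \<le> 17 / 10 * (3 / 2 :: real)" by simp
  also have "\<dots> \<le> sqrt 3 * Pa n d u" using s3 assms pi_gt3 by (intro mult_mono) auto
  finally show ?thesis by (simp add: Pb_def Pa_def)
qed

text \<open>
  The complex form of \<open>Z\<^sub>1\<close> has the derivative \<open>2 Re (A \<zeta> / cos\<^sup>2)\<close> with \<open>\<bar>A\<bar>\<close> close to 1, so that
  the estimate \<open>1 / \<bar>cos\<bar>\<^sup>2 \<le> 2 / 5\<close> applies once more.
\<close>
lemma Z_deriv_bound:
  assumes "sin (2 * \<theta>) = 0" and d: "0 \<le> d" "d \<le> 1 / 10" and P: "pi / 2 \<le> Pa n d u"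
  shows "Z_deriv (cos (2 * \<theta>)) n d u \<le> 21 / 25"
proof -
  define w where "w = (\<lambda>u. cis (pi / 3) * of_real (Pa n d u) - of_real \<theta>)"
  define A where "A = Complex (B1 d) (- C1 d)"
  have Pb: "5 / 2 \<le> Pb n d u" by (rule Pb_ge[OF P])
  have Im: "Im (w u) \<ge> 5 / 4" using Pb by (simp add: w_def Pa_def Pb_def cis_sixth)
  have cw: "cos (w u) \<noteq> 0" by (rule cos_nonzero_strip[OF Im])
  have "((\<lambda>u. Pa n d u) has_real_derivative 1) (at u)"
    unfolding Pa_def by (auto intro!: derivative_eq_intros)
  from has_vector_derivative_diff[OF has_vector_derivative_mult_right[OF has_vector_derivative_of_real[OF this]]
      has_vector_derivative_const]
  have dw: "(w has_vector_derivative cis (pi / 3)) (at u)" unfolding w_def by (metis (no_types) diff_zero mult_1_right of_real_1)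
  have "((\<lambda>u. 2 * Re (A * (tan \<circ> w) u)) has_vector_derivative 2 * Re (A * (cis (pi / 3) * inverse ((cos (w u))\<^sup>2)))) (at u)"
    by (intro has_vector_derivative_mult_right bounded_linear.has_vector_derivative[OF bounded_linear_Re]
        field_vector_diff_chain_at[OF dw DERIV_tan[OF cw]])
  then have 1: "((\<lambda>u. 2 * Re (A * tan (w u))) has_real_derivative 2 * Re (A * (cis (pi / 3) * inverse ((cos (w u))\<^sup>2)))) (at u)"
    unfolding has_real_derivative_iff_has_vector_derivative comp_def .
  have "open {v. Pb n d v > 0}" unfolding Pb_def by (intro open_Collect_less continuous_intros)
  then have "(Z_signed (cos (2 * \<theta>)) n d has_real_derivative 2 * Re (A * (cis (pi / 3) * inverse ((cos (w u))\<^sup>2)))) (at u)"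
    by (rule has_field_derivative_transform_within_open[OF 1])
       (use Pb Z_signed_complex[OF assms(1)] in \<open>auto simp: A_def w_def\<close>)
  moreover have "(Z_signed (cos (2 * \<theta>)) n d has_real_derivative Z_deriv (cos (2 * \<theta>)) n d u) (at u)"
    by (rule Z_signed_has_derivative) (use Pb in auto)
  ultimately have "Z_deriv (cos (2 * \<theta>)) n d u = 2 * Re (A * (cis (pi / 3) * inverse ((cos (w u))\<^sup>2)))"
    using DERIV_unique by blast
  also have "\<dots> \<le> 2 * cmod (A * (cis (pi / 3) * inverse ((cos (w u))\<^sup>2)))"
    by (intro mult_left_mono complex_Re_le_cmod) simp
  also have "\<dots> = 2 * (cmod A * cmod (inverse ((cos (w u))\<^sup>2)))" by (simp add: norm_mult)
  also have "\<dots> \<le> 2 * ((21 / 20) * (2 / 5))"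
    using B1_C1_norm[OF d] norm_inverse_cos_square_le[OF Im] unfolding A_def
    by (intro mult_left_mono mult_mono) auto
  finally show ?thesis by simp
qed

lemma Z_signed_fixpoint_unique:
  assumes "sin (2 * \<theta>) = 0" and d: "0 \<le> d" "d \<le> 1 / 10" "pi \<le> q n * d"
  shows "\<exists>!u. u \<in> {- (pi / 2)<..<pi / 2} \<and> u = arctan (Z_signed (cos (2 * \<theta>)) n d u)"
proof (rule arctan_fixpoint_unique[where G' = "Z_deriv (cos (2 * \<theta>)) n d"])
  fix u assume "u \<in> {- (pi / 2)..pi / 2}"
  then have P: "pi / 2 \<le> Pa n d u" using d by (auto simp: Pa_def)
  show "(Z_signed (cos (2 * \<theta>)) n d has_real_derivative Z_deriv (cos (2 * \<theta>)) n d u) (at u)"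
    by (rule Z_signed_has_derivative) (use Pb_ge[OF P] in auto)
  show "Z_deriv (cos (2 * \<theta>)) n d u < 1 + (Z_signed (cos (2 * \<theta>)) n d u)\<^sup>2"
    using Z_deriv_bound[OF assms(1) d(1,2) P] zero_le_power2[of "Z_signed (cos (2 * \<theta>)) n d u"] by linarith
qed

lemma Z2_bound:
  fixes s k t :: real
  assumes b: "\<bar>s\<bar> \<le> 1" "\<bar>k\<bar> \<le> 1 / 2" "\<bar>t\<bar> \<le> 1" "\<bar>b1\<bar> \<le> 2" "\<bar>c1\<bar> \<le> 1" "\<bar>b2\<bar> \<le> 1" "\<bar>c2\<bar> \<le> 1"
    "\<bar>qa\<bar> \<le> 1" "\<bar>qb\<bar> \<le> 1"
  shows "\<bar>((2 * (s * b2 + b1 * (qa * k) + t * c2 + c1 * qb)) * (1 + k)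
      - (2 * (s * b1 + t * c1)) * (- (qa * s) + qb * t)) / (1 + k)\<^sup>2\<bar> \<le> 128"
proof -
  have m: "\<bar>x * y\<bar> \<le> a * c" if "\<bar>x\<bar> \<le> a" "\<bar>y\<bar> \<le> c" for x y a c :: real
    unfolding abs_mult using that by (intro mult_mono) auto
  have "\<bar>s * b2 + b1 * (qa * k) + t * c2 + c1 * qb\<bar> \<le> 5"
    using m[OF b(1,6)] m[OF b(4) m[OF b(8,2)]] m[OF b(3,7)] m[OF b(5,9)] by linarith
  moreover have k1: "\<bar>1 + k\<bar> \<le> 2" "1 / 2 \<le> 1 + k" using b(2) by linarith+
  ultimately have "\<bar>(s * b2 + b1 * (qa * k) + t * c2 + c1 * qb) * (1 + k)\<bar> \<le> 5 * 2" by (intro m)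
  moreover have "\<bar>s * b1 + t * c1\<bar> \<le> 3" using m[OF b(1,4)] m[OF b(3,5)] by linarith
  moreover have "\<bar>- (qa * s) + qb * t\<bar> \<le> 2" using m[OF b(8,1)] m[OF b(9,3)] by linarith
  ultimately have num: "\<bar>(2 * (s * b2 + b1 * (qa * k) + t * c2 + c1 * qb)) * (1 + k)
      - (2 * (s * b1 + t * c1)) * (- (qa * s) + qb * t)\<bar> \<le> 32"
    using m[of "s * b1 + t * c1" 3 "- (qa * s) + qb * t" 2] unfolding mult.assoc by linarith
  have "(1 / 2)\<^sup>2 \<le> (1 + k)\<^sup>2" using k1 by (intro power_mono) auto
  then have "\<bar>(2 * (s * b2 + b1 * (qa * k) + t * c2 + c1 * qb)) * (1 + k)
      - (2 * (s * b1 + t * c1)) * (- (qa * s) + qb * t)\<bar> / (1 + k)\<^sup>2 \<le> 32 / (1 / 2)\<^sup>2"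
    using num by (intro frac_le) auto
  then show ?thesis by (simp add: abs_divide power2_eq_square)
qed

text \<open>
  The hypotheses describe the logarithmic range: \<open>d\<close> is at most \<open>L / q n\<close> with \<open>L\<close> of the size of the
  logarithm. There the corrections \<open>Q\<^sub>a, Q\<^sub>b\<close> stay below 1, so \<open>Z\<^sub>2\<close> is bounded,
  and the denominator of \<open>R\<close> is at least \<open>1 - 21 / 25\<close>.
\<close>
lemma R_bound:
  assumes d: "0 \<le> d" "d \<le> 1 / 10" "d * q n \<le> L" "1 \<le> L" "10 * L ^ 3 \<le> q n" "pi / 2 \<le> Pa n d u"
    and u: "\<bar>u\<bar> \<le> 2"
  shows "\<bar>R_1 n d u\<bar> \<le> 1000" "\<bar>R_2 n d u\<bar> \<le> 1000"
proof -
  define N where "N = q n"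
  define h where "h = cosh (Pb n d u)"
  have Pb: "5 / 2 \<le> Pb n d u" by (rule Pb_ge[OF d(6)])
  have "12 \<le> exp (5 / 2 :: real)" by (rule exp_five_halves)
  also have "\<dots> \<le> exp (Pb n d u)" using Pb by simp
  finally have "12 \<le> exp (Pb n d u) + exp (- Pb n d u)" using exp_gt_zero[of "- Pb n d u"] by linarith
  then have "6 \<le> h" unfolding h_def cosh_def by simp
  define s where "s = sin (Pa n d u) / h"
  define k where "k = cos (Pa n d u) / h"
  define t where "t = sinh (Pb n d u) / h"
  have s: "\<bar>s\<bar> \<le> 1" unfolding s_def abs_divide using frac_le[OF _ abs_sin_le_one[of "Pa n d u"] _ \<open>6 \<le> h\<close>] \<open>6 \<le> h\<close> by simp
  have k: "\<bar>k\<bar> \<le> 1 / 2" unfolding k_def abs_divide using frac_le[OF _ abs_cos_le_one[of "Pa n d u"] _ \<open>6 \<le> h\<close>] \<open>6 \<le> h\<close> by simp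
  have "0 \<le> sinh (Pb n d u)" using Pb by simp
  then have t: "\<bar>t\<bar> \<le> 1" unfolding t_def abs_divide h_def by (simp add: divide_le_eq sinh_le_cosh_real)
  have d2: "0 \<le> d\<^sup>2" "d\<^sup>2 \<le> 1 / 100" using power_mono[OF d(2,1), of 2] by (simp_all add: power_divide)
  have s3: "0 \<le> sqrt 3" "sqrt 3 \<le> 2" by (auto intro: real_le_lsqrt)
  have m: "\<bar>x * y\<bar> \<le> a * c" if "\<bar>x\<bar> \<le> a" "\<bar>y\<bar> \<le> c" for x y a c :: real
    unfolding abs_mult using that by (intro mult_mono) auto
  have du: "\<bar>d * u\<bar> \<le> 1 / 10 * 2" by (rule m) (use d u in auto)
  have b1: "\<bar>B1 d\<bar> \<le> 2" using d2 by (simp add: B1_def)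
  have c1: "\<bar>C1 d\<bar> \<le> 1" using m[of "sqrt 3" 2 "d\<^sup>2" "1 / 100"] d2 s3 by (simp add: C1_def abs_mult)
  have b2: "\<bar>B2 d u\<bar> \<le> 1" using du by (simp add: B2_def abs_mult)
  have c2: "\<bar>C2 d u\<bar> \<le> 1" using m[OF _ du, of "sqrt 3" 2] s3 by (simp add: C2_def abs_mult mult.assoc)
  have N: "N > 0" by (simp add: N_def)
  have x: "0 \<le> d * N" "d * N \<le> L" using mult_nonneg_nonneg[OF d(1) less_imp_le[OF N]] d(3) by (simp_all add: N_def)
  have L2: "L ^ 2 \<le> L ^ 3" using d(4) by (intro power_increasing) auto
  have "d ^ 3 * N\<^sup>2 = (d * N) ^ 3 / N" using N by (simp add: power_mult_distrib power2_eq_square power3_eq_cube)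
  also have "\<dots> \<le> L ^ 3 / N" using x N by (intro divide_right_mono power_mono) auto
  also have "\<dots> \<le> 1 / 10" using d(5) N by (simp add: N_def divide_le_eq)
  finally have q1: "d ^ 3 * N\<^sup>2 \<le> 1 / 10" .
  have "d\<^sup>2 * N = (d * N) ^ 2 / N" using N by (simp add: power_mult_distrib power2_eq_square)
  also have "\<dots> \<le> L ^ 3 / N" using N order_trans[OF power_mono[OF x(2,1), of 2] L2] by (intro divide_right_mono) auto
  also have "\<dots> \<le> 1 / 10" using d(5) N by (simp add: N_def divide_le_eq)
  finally have "\<bar>d\<^sup>2 * N\<bar> \<le> 1 / 10" using d2 N by simp
  from m[OF this u] have q2: "\<bar>d\<^sup>2 * N * u\<bar> \<le> 1 / 10 * 2" .
  have q3: "\<bar>d * u * u\<bar> \<le> 1 / 10 * 2 * 2" by (rule m[OF du u])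
  define QQ where "QQ = d ^ 3 * N\<^sup>2 + 3 * d\<^sup>2 * u * N + 3 * d * u\<^sup>2"
  have "QQ = d ^ 3 * N\<^sup>2 + 3 * (d\<^sup>2 * N * u) + 3 * (d * u * u)"
    by (simp add: QQ_def power2_eq_square algebra_simps)
  moreover have "0 \<le> d ^ 3 * N\<^sup>2" using d by simp
  ultimately have QQ: "\<bar>QQ\<bar> \<le> 2" using q1 q2 q3 by linarith
  have qa: "\<bar>Qa n d u\<bar> \<le> 1" using QQ unfolding Qa_def N_def[symmetric] QQ_def[symmetric] by simp
  have qb: "\<bar>Qb n d u\<bar> \<le> 1" using m[of "sqrt 3" 2 QQ 2] QQ s3
    unfolding Qb_def N_def[symmetric] QQ_def[symmetric] by (simp add: abs_mult)
  have Z2_1: "Z2_1 n d u = ((2 * (s * B2 d u + B1 d * (Qa n d u * k) + t * C2 d u + C1 d * Qb n d u)) * (1 + k)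
      - (2 * (s * B1 d + t * C1 d)) * (- (Qa n d u * s) + Qb n d u * t)) / (1 + k)\<^sup>2"
    unfolding Z2_1_def X2_1_def Y1_1_def X1_1_def Y2_1_def s_def k_def t_def h_def by simp
  have Z2_2: "Z2_2 n d u = ((2 * ((- s) * B2 d u + B1 d * (Qa n d u * (- k)) + t * C2 d u + C1 d * Qb n d u)) * (1 + (- k))
      - (2 * ((- s) * B1 d + t * C1 d)) * (- (Qa n d u * (- s)) + Qb n d u * t)) / (1 + (- k))\<^sup>2"
    unfolding Z2_2_def X2_2_def Y1_2_def X1_2_def Y2_2_def s_def k_def t_def h_def by simp
  have 1: "\<bar>Z2_1 n d u\<bar> \<le> 128" unfolding Z2_1 by (rule Z2_bound[OF s k t b1 c1 b2 c2 qa qb])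
  have 2: "\<bar>Z2_2 n d u\<bar> \<le> 128" unfolding Z2_2 
    by (rule Z2_bound[OF _ _ t b1 c1 b2 c2 qa qb]) (use s k in auto)
  have "Z_deriv 1 n d u \<le> 21 / 25" "Z_deriv (- 1) n d u \<le> 21 / 25"
    using Z_deriv_bound[of 0 d n u] Z_deriv_bound[of "pi / 2" d n u] d by simp_all
  then have den: "4 / 25 \<le> 1 + (Z1_1 n d u)\<^sup>2 - Z3_1 n d u" "4 / 25 \<le> 1 + (Z1_2 n d u)\<^sup>2 - Z3_2 n d u"
    using zero_le_power2[of "Z1_1 n d u"] zero_le_power2[of "Z1_2 n d u"] unfolding Z3_eq by linarith+
  have "\<bar>Z2_1 n d u\<bar> / \<bar>1 + (Z1_1 n d u)\<^sup>2 - Z3_1 n d u\<bar> \<le> 128 / (4 / 25)"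
    using 1 den by (intro frac_le) auto
  then show "\<bar>R_1 n d u\<bar> \<le> 1000" unfolding R_1_def abs_divide by simp
  have "\<bar>Z2_2 n d u\<bar> / \<bar>1 + (Z1_2 n d u)\<^sup>2 - Z3_2 n d u\<bar> \<le> 128 / (4 / 25)"
    using 2 den by (intro frac_le) auto
  then show "\<bar>R_2 n d u\<bar> \<le> 1000" unfolding R_2_def abs_divide by simp
qed

section \<open>Expansion of the eigenvalues\<close>

definition g1 :: "real \<Rightarrow> real" where "g1 x = - 192 * sin (x / 2) ^ 5 * cos (x / 2)"
definition g2 :: "real \<Rightarrow> real" where "g2 x = - 480 * sin (x / 2) ^ 4 + 576 * sin (x / 2) ^ 6"
definition g3 :: "real \<Rightarrow> real" where
  "g3 x = (- 960 * sin (x / 2) ^ 3 + 1728 * sin (x / 2) ^ 5) * cos (x / 2)"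

lemma g_has_derivative: "(g has_real_derivative g1 x) (at x)"
proof -
  have "((\<lambda>x. - ((2 * sin (x / 2)) ^ 6)) has_real_derivative g1 x) (at x)"
    by (auto intro!: derivative_eq_intros simp: g1_def power_mult_distrib)
  then show ?thesis unfolding g_eq[abs_def] .
qed

lemma g1_has_derivative: "(g1 has_real_derivative g2 x) (at x)"
proof -
  define s where "s = sin (x / 2)"
  define c where "c = cos (x / 2)"
  have "(g1 has_real_derivative - 192 * (5 * s ^ 4 * (c * (1 / 2)) * c + s ^ 5 * (- (s * (1 / 2))))) (at x)"
    unfolding g1_def[abs_def] s_def c_def by (auto intro!: derivative_eq_intros simp: algebra_simps)
  also have "- 192 * (5 * s ^ 4 * (c * (1 / 2)) * c + s ^ 5 * (- (s * (1 / 2)))) = - 480 * s ^ 4 * c\<^sup>2 + 96 * s ^ 6"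
    by (simp add: algebra_simps power2_eq_square eval_nat_numeral)
  also have "c\<^sup>2 = 1 - s\<^sup>2" unfolding s_def c_def by (rule cos_squared_eq)
  also have "- 480 * s ^ 4 * (1 - s\<^sup>2) + 96 * s ^ 6 = g2 x"
    by (simp add: g2_def s_def[symmetric] algebra_simps power2_eq_square eval_nat_numeral)
  finally show ?thesis .
qed

lemma g2_has_derivative: "(g2 has_real_derivative g3 x) (at x)"
  unfolding g2_def[abs_def] g3_def
  by (auto intro!: derivative_eq_intros simp: algebra_simps)

lemma deriv_g: "deriv g = g1" "deriv (deriv g) = g2"
proof -
  show 1: "deriv g = g1" by (rule ext, rule DERIV_imp_deriv, rule g_has_derivative)
  show "deriv (deriv g) = g2" unfolding 1 by (rule ext, rule DERIV_imp_deriv, rule g1_has_derivative)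
qed

lemma sin_pow_le: "\<bar>sin (x :: real) ^ k\<bar> \<le> 1"
  by (simp add: power_abs power_le_one)

lemma g1_bound: "\<bar>g1 x\<bar> \<le> 192"
proof -
  have "\<bar>sin (x / 2) ^ 5 * cos (x / 2)\<bar> \<le> 1 * 1"
    unfolding abs_mult using sin_pow_le by (intro mult_mono) auto
  then show ?thesis unfolding g1_def mult.assoc by linarith
qed

lemma g2_bound: "\<bar>g2 x\<bar> \<le> 1056"
  using sin_pow_le[of "x / 2" 4] sin_pow_le[of "x / 2" 6] unfolding g2_def by linarith

lemma g3_bound: "\<bar>g3 x\<bar> \<le> 2688"
proof -
  have "\<bar>- 960 * sin (x / 2) ^ 3 + 1728 * sin (x / 2) ^ 5\<bar> \<le> 2688"
    using sin_pow_le[of "x / 2" 3] sin_pow_le[of "x / 2" 5] by linarith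
  then have "\<bar>(- 960 * sin (x / 2) ^ 3 + 1728 * sin (x / 2) ^ 5) * cos (x / 2)\<bar> \<le> 2688 * 1"
    unfolding abs_mult by (intro mult_mono) auto
  then show ?thesis unfolding g3_def by simp
qed

lemma g_Taylor: "\<bar>g (d + h) - (g d + g1 d * h + g2 d * h\<^sup>2 / 2)\<bar> \<le> 448 * \<bar>h\<bar> ^ 3"
proof (cases "h = 0")
  case False
  define D where "D = (\<lambda>m::nat. if m = 0 then g else if m = 1 then g1 else if m = 2 then g2 else g3)"
  have "\<exists>t. (if d + h < d then d + h < t \<and> t < d else d < t \<and> t < d + h) \<and>
    g (d + h) = (\<Sum>m<3. D m d / fact m * (d + h - d) ^ m) + D 3 t / fact 3 * (d + h - d) ^ 3"
  proof (rule Taylor)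
    show "\<forall>m t. m < 3 \<and> d - \<bar>h\<bar> \<le> t \<and> t \<le> d + \<bar>h\<bar> \<longrightarrow> (D m has_real_derivative D (Suc m) t) (at t)"
      by (auto simp: D_def less_Suc_eq numeral_3_eq_3 g_has_derivative g1_has_derivative g2_has_derivative)
  qed (use False in \<open>auto simp: D_def\<close>)
  then obtain t where t: "g (d + h) = (\<Sum>m<3. D m d / fact m * h ^ m) + D 3 t / fact 3 * h ^ 3" by auto
  have "(\<Sum>m<3. D m d / fact m * h ^ m) = g d + g1 d * h + g2 d * h\<^sup>2 / 2"
    by (simp add: D_def numeral_3_eq_3 numeral_2_eq_2)
  then have "g (d + h) - (g d + g1 d * h + g2 d * h\<^sup>2 / 2) = g3 t * h ^ 3 / 6"
    using t by (simp add: D_def fact_numeral)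
  moreover have "\<bar>g3 t * h ^ 3\<bar> \<le> 2688 * \<bar>h\<bar> ^ 3"
    unfolding abs_mult power_abs using g3_bound by (intro mult_right_mono) auto
  ultimately show ?thesis by simp
qed simp

text \<open>
  Taylor's formula of order two at \<open>d\<close>, with the approximation \<open>v + w / N\<close> of \<open>u\<close> inserted: an error
  \<open>e / N\<close> of the approximation contributes \<open>192 * e\<close>, everything else is \<open>O (1 / N)\<close>.
\<close>
lemma expansion_error_bound:
  fixes N u v e w d :: real
  assumes N: "N \<ge> 1" and u: "\<bar>u\<bar> \<le> 2" and v: "\<bar>v\<bar> \<le> 2"
    and w: "\<bar>w\<bar> \<le> K" and near: "\<bar>u - v - w / N\<bar> \<le> e / N" and e: "e \<le> 1"
  shows "N\<^sup>2 * \<bar>g (d + u / N) - (g d + g1 d * v / N + (w * g1 d + v\<^sup>2 * g2 d / 2) / N\<^sup>2)\<bar>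
    \<le> 192 * e + (3584 + 2112 * (1 + K)) / N"
proof -
  define r where "r = u - v - w / N"
  define T where "T = g (d + u / N) - (g d + g1 d * (u / N) + g2 d * (u / N)\<^sup>2 / 2)"
  have Npos: "N > 0" using N by simp
  have "\<bar>T\<bar> \<le> 448 * \<bar>u / N\<bar> ^ 3" unfolding T_def by (rule g_Taylor)
  also have "\<dots> \<le> 448 * (2 / N) ^ 3"
    using u Npos by (intro mult_left_mono power_mono) (auto simp: abs_divide divide_right_mono)
  finally have "N\<^sup>2 * \<bar>T\<bar> \<le> N\<^sup>2 * (448 * (2 / N) ^ 3)" by (intro mult_left_mono) auto
  also have "\<dots> = 3584 / N" using Npos by (simp add: power2_eq_square power3_eq_cube)
  finally have T: "\<bar>N\<^sup>2 * T\<bar> \<le> 3584 / N" by (simp add: abs_mult)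
  have "\<bar>w / N\<bar> \<le> K / N" using w Npos by (simp add: abs_divide divide_right_mono)
  then have "\<bar>u - v\<bar> \<le> e / N + K / N" using near by linarith
  also have "\<dots> \<le> (1 + K) / N" using e Npos by (simp add: add_divide_distrib[symmetric] divide_right_mono)
  finally have uv: "\<bar>u - v\<bar> \<le> (1 + K) / N" .
  have "\<bar>(u - v) * (u + v)\<bar> \<le> ((1 + K) / N) * 4"
    unfolding abs_mult using uv u v by (intro mult_mono) auto
  then have "\<bar>g2 d * ((u - v) * (u + v))\<bar> \<le> 1056 * (((1 + K) / N) * 4)"
    unfolding abs_mult[of "g2 d"] using g2_bound by (intro mult_mono) auto
  moreover have "(u - v) * (u + v) = u\<^sup>2 - v\<^sup>2" by (simp add: power2_eq_square algebra_simps)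
  ultimately have G2: "\<bar>g2 d * (u\<^sup>2 - v\<^sup>2) / 2\<bar> \<le> 2112 * ((1 + K) / N)" by simp
  have rN: "\<bar>r * N\<bar> \<le> e" using near Npos by (simp add: r_def abs_mult pos_le_divide_eq)
  have G1: "\<bar>g1 d * (r * N)\<bar> \<le> 192 * e"
    unfolding abs_mult[of "g1 d"] using g1_bound rN by (intro mult_mono) auto
  have split: "N\<^sup>2 * (y - (a + P + Q)) = N\<^sup>2 * (y - (a + P' + Q')) + N\<^sup>2 * P' + N\<^sup>2 * Q' - N\<^sup>2 * P - N\<^sup>2 * Q"
    for y a P Q P' Q' :: real by (simp add: algebra_simps)
  have terms: "N\<^sup>2 * (g1 d * (u / N)) = g1 d * (u * N)" "N\<^sup>2 * (g2 d * (u / N)\<^sup>2 / 2) = g2 d * u\<^sup>2 / 2"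
    "N\<^sup>2 * (g1 d * v / N) = g1 d * (v * N)"
    "N\<^sup>2 * ((w * g1 d + v\<^sup>2 * g2 d / 2) / N\<^sup>2) = w * g1 d + v\<^sup>2 * g2 d / 2"
    using Npos by (simp_all add: power_divide power2_eq_square)
  have r: "r * N = u * N - v * N - w" using Npos by (simp add: r_def left_diff_distrib)
  have eq: "N\<^sup>2 * (g (d + u / N) - (g d + g1 d * v / N + (w * g1 d + v\<^sup>2 * g2 d / 2) / N\<^sup>2))
     = g1 d * (r * N) + N\<^sup>2 * T + g2 d * (u\<^sup>2 - v\<^sup>2) / 2"
    unfolding split[where P' = "g1 d * (u / N)" and Q' = "g2 d * (u / N)\<^sup>2 / 2"] T_def[symmetric] terms r
    by (simp add: algebra_simps diff_divide_distrib)
  have tri: "\<bar>a + b + c\<bar> \<le> x + y + z" if "\<bar>a\<bar> \<le> x" "\<bar>b\<bar> \<le> y" "\<bar>c\<bar> \<le> z" for a b c x y z :: real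
    using that by linarith
  have "\<bar>N\<^sup>2 * (g (d + u / N) - (g d + g1 d * v / N + (w * g1 d + v\<^sup>2 * g2 d / 2) / N\<^sup>2))\<bar>
      \<le> 192 * e + 3584 / N + 2112 * ((1 + K) / N)" unfolding eq by (rule tri[OF G1 T G2])
  then show ?thesis by (simp add: abs_mult add_divide_distrib)
qed

text \<open>
  The condition \<open>2 * ln N \<le> N * d - pi / 2\<close> is what a large index provides. It makes
  \<open>exp (- 2 N Im \<beta>) \<le> 1 / N^3\<close>; the possible loss of a factor \<open>1 / cos (\<phi> / 2) = O (N)\<close> near
  \<open>pi\<close> still leaves \<open>O (1 / N\<^sup>2)\<close> as required by \<open>root_first_order\<close>.
\<close>
lemma outer_expansion:
  assumes "\<epsilon> > 0"
  shows "\<forall>\<^sub>F N in at_top. \<forall>\<theta> d u. pi \<le> N * d \<and> N * d + pi \<le> N * pi \<and> 2 * ln N \<le> N * d - pi / 2 \<and>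
     u \<in> {- (pi / 2)<..<pi / 2} \<and> u = arctan (secular N \<theta> (d + u / N)) \<longrightarrow>
     N\<^sup>2 * \<bar>g (d + u / N) - (g d + g1 d * outer1 d / N + (outer2 d * g1 d + (outer1 d)\<^sup>2 * g2 d / 2) / N\<^sup>2)\<bar> < \<epsilon>"
proof -
  have "compact (eta' ` {0..pi})" by (intro compact_continuous_image continuous_on_eta') auto
  then obtain K where K: "K > 0" "\<And>x. x \<in> {0..pi} \<Longrightarrow> \<bar>eta' x\<bar> \<le> K"
    using compact_imp_bounded bounded_pos by (metis image_eqI real_norm_def)
  define e where "e = min 1 (\<epsilon> / 400)"
  have e: "e > 0" "e \<le> 1" "192 * e < \<epsilon> / 2" using assms by (auto simp: e_def min_def)
  define M where "M = 3584 + 2112 * (1 + 2 * K)"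
  have M: "M > 0" using K by (simp add: M_def)
  obtain Na where Na: "\<And>N d u. N \<ge> Na \<Longrightarrow> 0 < d \<Longrightarrow> d < pi \<Longrightarrow> 0 < d + u / N \<Longrightarrow> d + u / N < pi \<Longrightarrow>
     \<bar>u\<bar> \<le> 2 \<Longrightarrow> \<bar>u - eta (d + u / N)\<bar> \<le> 24 / N\<^sup>2 \<Longrightarrow> \<bar>u - eta d - eta' d * eta d / N\<bar> \<le> e / N"
    using root_first_order[OF e(1)] by blast
  obtain Nb where Nb: "\<And>N \<phi>. N \<ge> Nb \<Longrightarrow> pi / 2 \<le> N * \<phi> \<Longrightarrow> \<phi> \<le> pi \<Longrightarrow>
      N * Im (beta_arcsin \<phi>) \<ge> 5 / 4 \<and>
      (N * \<phi> \<ge> 2 * ln N \<longrightarrow> exp (- (2 * (N * Im (beta_arcsin \<phi>)))) \<le> 1 / N ^ 3)"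
    using beta_arcsin_growth by blast
  show ?thesis unfolding eventually_at_top_linorder
  proof (intro exI[of _ "Max {Na, Nb, 1, 4 * M / \<epsilon>}"] allI impI, elim conjE)
    fix N \<theta> d u
    assume N: "Max {Na, Nb, 1, 4 * M / \<epsilon>} \<le> N" and d: "pi \<le> N * d" "N * d + pi \<le> N * pi"
      "2 * ln N \<le> N * d - pi / 2" and u: "u \<in> {- (pi / 2)<..<pi / 2}" "u = arctan (secular N \<theta> (d + u / N))"
    have N': "Na \<le> N" "Nb \<le> N" "1 \<le> N" "4 * M / \<epsilon> \<le> N" using N by auto
    have Npos: "N > 0" using N' by simp
    define \<phi> where "\<phi> = d + u / N"
    have eq: "N * \<phi> = N * d + u" using Npos by (simp add: \<phi>_def field_simps)
    have lo: "pi / 2 \<le> N * \<phi>" and lo2: "2 * ln N \<le> N * \<phi>" using u(1) d unfolding eq by auto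
    have "0 < N * \<phi>" using lo pi_gt_zero by linarith
    then have pos: "0 < \<phi>" using Npos by (simp add: zero_less_mult_iff)
    have hi2: "N * \<phi> + pi / 2 \<le> N * pi" using u(1) d unfolding eq by auto
    then have "N * \<phi> < N * pi" using pi_gt_zero by linarith
    then have hi: "\<phi> < pi" using Npos by simp
    have "0 < N * d" "N * d < N * pi" using d pi_gt_zero by linarith+
    then have d0: "0 < d" "d < pi" using Npos by (simp_all add: zero_less_mult_iff)
    have y: "N * Im (beta_arcsin \<phi>) \<ge> 5 / 4" "exp (- (2 * (N * Im (beta_arcsin \<phi>)))) \<le> 1 / N ^ 3"
      using Nb[OF N'(2) lo less_imp_le[OF hi]] lo2 by auto
    \<comment> \<open>the root stays at distance \<open>pi / (2 * N)\<close> from \<open>pi\<close>, so \<open>1 / cos (\<phi> / 2)\<close> is at most of order \<open>N\<close>\<close>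
    have "pi / (4 * N) \<le> (pi - \<phi>) / 2" using hi2 Npos by (simp add: field_simps)
    then have "pi / (4 * N) / 2 \<le> (pi - \<phi>) / 2 / 2" by (rule divide_right_mono) simp
    also have "\<dots> \<le> sin ((pi - \<phi>) / 2)" using pos hi by (intro sin_ge_half) auto
    also have "\<dots> = cos (\<phi> / 2)" by (simp add: cos_sin_eq diff_divide_distrib)
    finally have "pi / (4 * N) / 2 \<le> cos (\<phi> / 2)" .
    moreover have "3 / (8 * N) \<le> pi / (4 * N) / 2" using pi_gt3 Npos by (simp add: field_simps)
    ultimately have c: "3 / (8 * N) \<le> cos (\<phi> / 2)" by linarith
    have "\<bar>u - eta \<phi>\<bar> \<le> 15 / 2 * exp (- (2 * (N * Im (beta_arcsin \<phi>)))) / cos (\<phi> / 2)"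
      using arctan_secular_near_eta[OF pos hi y(1), of \<theta>] u(2) unfolding \<phi>_def by simp
    also have "\<dots> \<le> 15 / 2 * (1 / N ^ 3) / (3 / (8 * N))"
      using y(2) c Npos by (intro frac_le mult_left_mono) auto
    also have "\<dots> = 20 / N\<^sup>2" using Npos by (simp add: field_simps power2_eq_square power3_eq_cube)
    also have "\<dots> \<le> 24 / N\<^sup>2" using Npos by (intro divide_right_mono) auto
    finally have near: "\<bar>u - eta (d + u / N)\<bar> \<le> 24 / N\<^sup>2" unfolding \<phi>_def .
    have u2: "\<bar>u\<bar> \<le> 2" using u(1) pi_less_4 by auto
    have e2: "\<bar>eta d\<bar> \<le> 2" unfolding eta_def using arctan_bounded[of "- 2 * Im (sigma d)"] pi_less_4 by linarith
    have "\<bar>eta' d\<bar> \<le> K" using K(2)[of d] d0 by auto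
    then have w: "\<bar>eta' d * eta d\<bar> \<le> 2 * K"
      using mult_mono[of "\<bar>eta' d\<bar>" K "\<bar>eta d\<bar>" 2] e2 K(1) by (simp add: abs_mult mult.commute)
    have "\<bar>u - eta d - eta' d * eta d / N\<bar> \<le> e / N"
      by (rule Na[OF N'(1) d0 _ _ u2 near]) (use pos hi in \<open>simp_all add: \<phi>_def\<close>)
    from expansion_error_bound[OF N'(3) u2 e2 w this e(2)]
    have "N\<^sup>2 * \<bar>g (d + u / N) - (g d + g1 d * eta d / N + (eta' d * eta d * g1 d + (eta d)\<^sup>2 * g2 d / 2) / N\<^sup>2)\<bar>
      \<le> 192 * e + M / N" by (simp add: M_def)
    also have "M / N \<le> \<epsilon> / 4" using N'(4) Npos assms by (simp add: field_simps)
    finally show "N\<^sup>2 * \<bar>g (d + u / N) - (g d + g1 d * outer1 d / N + (outer2 d * g1 d + (outer1 d)\<^sup>2 * g2 d / 2) / N\<^sup>2)\<bar> < \<epsilon>"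
      unfolding outer1_eq[OF d0] outer2_eq[OF d0] using e(3) assms by linarith
  qed
qed

lemma sin_half_power_le: fixes x :: real assumes "0 \<le> x" "x \<le> D" shows "\<bar>sin (x / 2)\<bar> ^ k \<le> (D / 2) ^ k"
proof (rule power_mono)
  have "\<bar>sin (x / 2)\<bar> \<le> \<bar>x / 2\<bar>" by (rule abs_sin_x_le_abs_x)
  then show "\<bar>sin (x / 2)\<bar> \<le> D / 2" using assms by simp
qed simp

text \<open>
  Near 0 the function \<open>g\<close> behaves like \<open>- x^6\<close>, so each term on its own is \<open>O (D^4)\<close>; no
  cancellation is used.
\<close>
lemma inner_error:
  assumes "0 \<le> d" "d \<le> D" "0 \<le> x" "x \<le> D" "D \<le> 1" "N \<ge> 1" "\<bar>v\<bar> \<le> 2" "\<bar>w\<bar> \<le> 1000"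
  shows "\<bar>g x - (g d + g1 d * v / N + (w * g1 d + v\<^sup>2 * g2 d / 2) / N\<^sup>2)\<bar> \<le> 7000 * D ^ 4"
proof -
  have D: "0 \<le> D" using assms by linarith
  have D4: "D ^ 6 \<le> D ^ 4" "D ^ 5 \<le> D ^ 4" using assms D by (auto intro: power_decreasing)
  have g0: "\<bar>g y\<bar> \<le> D ^ 4" if "0 \<le> y" "y \<le> D" for y
  proof -
    have "\<bar>g y\<bar> = 64 * \<bar>sin (y / 2)\<bar> ^ 6"
      unfolding g_eq power_mult_distrib by (simp add: abs_mult power_abs del: power_even_abs_numeral)
    also have "\<dots> \<le> 64 * (D / 2) ^ 6" by (rule mult_left_mono[OF sin_half_power_le[OF that]]) simp
    also have "\<dots> = D ^ 6" by (simp add: power_divide)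
    finally show ?thesis using D4 by linarith
  qed
  have G1: "\<bar>g1 d\<bar> \<le> 6 * D ^ 4"
  proof -
    have "\<bar>g1 d\<bar> = 192 * (\<bar>sin (d / 2)\<bar> ^ 5 * \<bar>cos (d / 2)\<bar>)" by (simp add: g1_def abs_mult power_abs)
    also have "\<dots> \<le> 192 * ((D / 2) ^ 5 * 1)"
      using D by (intro mult_left_mono mult_mono sin_half_power_le[OF assms(1,2)]) auto
    also have "\<dots> = 6 * D ^ 5" by (simp add: power_divide)
    finally show ?thesis using D4 by linarith
  qed
  have G2: "\<bar>g2 d\<bar> \<le> 39 * D ^ 4"
  proof -
    have "\<bar>g2 d\<bar> \<le> 480 * \<bar>sin (d / 2)\<bar> ^ 4 + 576 * \<bar>sin (d / 2)\<bar> ^ 6"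
      unfolding g2_def power_abs[symmetric] by linarith
    also have "\<dots> \<le> 480 * (D / 2) ^ 4 + 576 * (D / 2) ^ 6"
      by (intro add_mono mult_left_mono sin_half_power_le[OF assms(1,2)]) auto
    also have "\<dots> = 30 * D ^ 4 + 9 * D ^ 6" by (simp add: power_divide)
    finally show ?thesis using D4 by linarith
  qed
  have shrink: "\<bar>a / N\<bar> \<le> \<bar>a\<bar>" "\<bar>a / N\<^sup>2\<bar> \<le> \<bar>a\<bar>" for a :: real
    using divide_left_mono[of 1 N "\<bar>a\<bar>"] divide_left_mono[of 1 "N\<^sup>2" "\<bar>a\<bar>"] assms(6) one_le_power[OF assms(6), of 2]
    by (simp_all add: abs_divide)
  have m: "\<bar>x * y\<bar> \<le> a * c" if "\<bar>x\<bar> \<le> a" "\<bar>y\<bar> \<le> c" for x y a c :: real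
    unfolding abs_mult using that by (intro mult_mono) auto
  have "v\<^sup>2 \<le> 2\<^sup>2" using power_mono[OF assms(7), of 2] by simp
  then have v2: "\<bar>v\<^sup>2\<bar> \<le> 4" by simp
  have "\<bar>g1 d * v / N\<bar> \<le> 6 * D ^ 4 * 2" using shrink(1)[of "g1 d * v"] m[OF G1 assms(7)] by linarith
  moreover have "\<bar>(w * g1 d + v\<^sup>2 * g2 d / 2) / N\<^sup>2\<bar> \<le> 1000 * (6 * D ^ 4) + 4 * (39 * D ^ 4)"
    using shrink(2)[of "w * g1 d + v\<^sup>2 * g2 d / 2"] m[OF assms(8) G1] m[OF v2 G2] by linarith
  ultimately have "\<bar>g x - (g d + g1 d * v / N + (w * g1 d + v\<^sup>2 * g2 d / 2) / N\<^sup>2)\<bar>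
     \<le> D ^ 4 + D ^ 4 + 6 * D ^ 4 * 2 + (1000 * (6 * D ^ 4) + 4 * (39 * D ^ 4))"
    using g0[OF assms(1,2)] g0[OF assms(3,4)] by linarith
  also have "\<dots> \<le> 7000 * D ^ 4" using D by simp
  finally show ?thesis .
qed

text \<open>
  The power 4 matches the bound \<open>D^4\<close> of \<open>inner_error\<close> for \<open>D = L / N\<close>, and \<open>L = 2 * ln N + 8\<close>
  bounds \<open>N * d\<close> and \<open>N * \<phi>\<close> for indices that are not large.
\<close>
lemma log_power_small:
  fixes \<delta> :: real
  assumes "\<delta> > 0"
  shows "\<exists>N0\<ge>1. \<forall>N\<ge>N0. (2 * ln N + 8) ^ 4 \<le> \<delta> * N"
proof (intro exI[of _ "max 1 ((24 ^ 4 / \<delta>)\<^sup>2)"] conjI allI impI)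
  fix N :: real assume N: "max 1 ((24 ^ 4 / \<delta>)\<^sup>2) \<le> N"
  define r where "r = N powr (1 / 8)"
  have N1: "N \<ge> 1" using N by simp
  have r1: "r \<ge> 1" unfolding r_def using N1 by (intro ge_one_powr_ge_zero) auto
  have "ln N \<le> N powr (1 / 8) / (1 / 8)" using N1 by (intro ln_powr_bound) auto
  then have "2 * ln N + 8 \<le> 24 * r" using r1 by (simp add: r_def)
  moreover have "0 \<le> 2 * ln N + 8" using N1 by simp
  ultimately have "(2 * ln N + 8) ^ 4 \<le> (24 * r) ^ 4" by (rule power_mono)
  also have "\<dots> = 24 ^ 4 * r ^ 4" by (rule power_mult_distrib)
  also have "r ^ 4 = sqrt N" using N1
    by (simp add: r_def powr_half_sqrt[symmetric] powr_realpow[symmetric] powr_powr)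
  also have "24 ^ 4 * sqrt N \<le> \<delta> * N"
  proof -
    have "24 ^ 4 / \<delta> \<le> sqrt N" using N assms by (intro real_le_rsqrt) auto
    then have "24 ^ 4 \<le> \<delta> * sqrt N" using assms by (simp add: field_simps)
    then have "24 ^ 4 * sqrt N \<le> \<delta> * sqrt N * sqrt N" using N1 by (intro mult_right_mono) auto
    moreover have "\<delta> * sqrt N * sqrt N = \<delta> * N" unfolding mult.assoc using N1 by simp
    ultimately show ?thesis by simp
  qed
  finally show "(2 * ln N + 8) ^ 4 \<le> \<delta> * N" .
qed simp

text \<open>
  The remainder of the expansion in terms of \<open>q n = (n + 3) / 2\<close>, multiplied by \<open>(q n)\<^sup>2\<close>.
\<close>
definition scaled_error :: "nat \<Rightarrow> real \<Rightarrow> real \<Rightarrow> real \<Rightarrow> real \<Rightarrow> real" where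
  "scaled_error n \<phi> d v w = (q n)\<^sup>2 * \<bar>g \<phi> - (g d + g1 d * v / q n + (w * g1 d + v\<^sup>2 * g2 d / 2) / (q n)\<^sup>2)\<bar>"

lemma large_j_iff: assumes "j \<ge> 1" shows "large_j n j \<longleftrightarrow> pi * (real j - 1) > ln 2 + 2 * ln (q n)"
proof -
  have "large_j n j \<longleftrightarrow> 2 * (q n)\<^sup>2 < exp (pi * (real j - 1))" by (auto simp: large_j_def)
  also have "2 * (q n)\<^sup>2 = exp (ln 2 + 2 * ln (q n))"
    by (simp add: exp_add exp_double)
  finally show ?thesis by simp
qed

text \<open>
  What the roots of both parities have in common: the point \<open>d\<close> is \<open>d1 n j\<close> with \<open>\<theta> = 0\<close> or
  \<open>d2 n j\<close> with \<open>\<theta> = pi / 2\<close>.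
\<close>
definition is_root :: "nat \<Rightarrow> real \<Rightarrow> nat \<Rightarrow> real \<Rightarrow> real \<Rightarrow> bool" where
  "is_root n \<theta> j d u \<longleftrightarrow> 1 \<le> j \<and> q n * d \<in> {real j * pi..real j * pi + pi / 2} \<and>
     q n * d + pi \<le> q n * pi \<and> u \<in> {- (pi / 2)<..<pi / 2} \<and> u = arctan (secular (q n) \<theta> (d + u / q n))"

lemma is_root_range: assumes "is_root n \<theta> j d u" shows "pi \<le> q n * d" "0 < d"
proof -
  have "1 * pi \<le> real j * pi" using assms by (intro mult_right_mono) (auto simp: is_root_def)
  moreover have "real j * pi \<le> q n * d" using assms by (simp add: is_root_def)
  ultimately show 1: "pi \<le> q n * d" by linarith
  then have "0 < q n * d" using pi_gt_zero by linarith
  then show "0 < d" using q_pos[of n] by (simp add: zero_less_mult_iff)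
qed

lemma large_j_error:
  assumes "\<epsilon> > 0"
  shows "\<forall>\<^sub>F n in sequentially. \<forall>\<theta> j d u. is_root n \<theta> j d u \<and> large_j n j \<longrightarrow>
     scaled_error n (d + u / q n) d (outer1 d) (outer2 d) < \<epsilon>"
proof -
  from eventually_compose_filterlim[OF outer_expansion[OF assms] q_at_top] show ?thesis
  proof (eventually_elim, intro allI impI, elim conjE)
    fix n \<theta> j d u
    assume expansion: "\<forall>\<theta> d u. pi \<le> q n * d \<and> q n * d + pi \<le> q n * pi \<and> 2 * ln (q n) \<le> q n * d - pi / 2 \<and>
        u \<in> {- (pi / 2)<..<pi / 2} \<and> u = arctan (secular (q n) \<theta> (d + u / q n)) \<longrightarrow>
        (q n)\<^sup>2 * \<bar>g (d + u / q n) - (g d + g1 d * outer1 d / q n + (outer2 d * g1 d + (outer1 d)\<^sup>2 * g2 d / 2) / (q n)\<^sup>2)\<bar> < \<epsilon>"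
      and r: "is_root n \<theta> j d u" and l: "large_j n j"
    have "1 \<le> j" using r by (simp add: is_root_def)
    from l have "pi * (real j - 1) > ln 2 + 2 * ln (q n)" unfolding large_j_iff[OF \<open>1 \<le> j\<close>] .
    moreover have "ln (2 :: real) > 0" by simp
    moreover have "pi * (real j - 1) = real j * pi - pi" by (simp add: algebra_simps)
    moreover have "real j * pi \<le> q n * d" using r by (simp add: is_root_def)
    ultimately have "2 * ln (q n) \<le> q n * d - pi / 2" using pi_gt_zero by linarith
    then show "scaled_error n (d + u / q n) d (outer1 d) (outer2 d) < \<epsilon>"
      unfolding scaled_error_def using r is_root_range(1)[OF r]
      by (intro expansion[rule_format, of d u \<theta>]) (simp add: is_root_def)
  qed
qed

text \<open>
  An index that is not large satisfies \<open>pi * (j - 1) \<le> ln 2 + 2 * ln (q n)\<close>, so the root and \<open>d\<close> are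
  at most \<open>D = L / q n\<close> with \<open>L = 2 * ln (q n) + 8\<close>: the constant absorbs \<open>ln 2\<close>, the shift of \<open>j\<close>
  and the offsets by multiples of \<open>pi / 2\<close>.
\<close>
lemma small_j_error:
  assumes "\<epsilon> > 0"
  shows "\<forall>\<^sub>F n in sequentially. \<forall>\<theta> j d u. is_root n \<theta> j d u \<and> \<not> large_j n j \<longrightarrow>
     d \<le> 1 / 10 \<and>
     (\<forall>v. \<bar>v\<bar> < pi / 2 \<longrightarrow> scaled_error n (d + u / q n) d v (R_1 n d v) < \<epsilon> \<and> scaled_error n (d + u / q n) d v (R_2 n d v) < \<epsilon>)"
proof -
  define \<delta> where "\<delta> = min (1 / 10) (\<epsilon> / 14000)"
  have \<delta>: "\<delta> > 0" "\<delta> \<le> 1 / 10" "7000 * \<delta> < \<epsilon>" using assms by (auto simp: \<delta>_def min_def)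
  obtain N0 where N0: "N0 \<ge> 1" "\<And>N. N \<ge> N0 \<Longrightarrow> (2 * ln N + 8) ^ 4 \<le> \<delta> * N"
    using log_power_small[OF \<delta>(1)] by blast
  have "\<forall>\<^sub>F n in sequentially. q n \<ge> N0"
    using q_at_top unfolding filterlim_at_top by blast
  then show ?thesis
  proof (eventually_elim, intro allI impI, elim conjE)
    fix n \<theta> j d u assume n: "N0 \<le> q n" and r: "is_root n \<theta> j d u" and l: "\<not> large_j n j"
    define N where "N = q n"
    define L where "L = 2 * ln N + 8"
    have N: "N \<ge> N0" "N \<ge> 1" "N > 0" using n N0(1) by (auto simp: N_def)
    have L: "L \<ge> 8" using N by (simp add: L_def)
    have dpi: "pi \<le> N * d" and d0: "0 < d" using is_root_range[OF r] by (auto simp: N_def)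
    have "1 \<le> j" using r by (simp add: is_root_def)
    from l have "pi * (real j - 1) \<le> ln 2 + 2 * ln N" unfolding large_j_iff[OF \<open>1 \<le> j\<close>] N_def by simp
    moreover have "pi * (real j - 1) = real j * pi - pi" by (simp add: algebra_simps)
    moreover have "ln (2 :: real) \<le> 1" using ln_le_minus_one[of 2] by simp
    moreover have "pi \<le> 35 / 10" using pi_approx(2) by simp
    moreover have "N * d \<le> real j * pi + pi / 2" using r by (simp add: is_root_def N_def)
    ultimately have dL: "N * d + pi / 2 \<le> L" unfolding L_def by linarith
    then have dL': "N * d \<le> L" using pi_gt_zero by linarith
    have L4: "L ^ 4 \<le> \<delta> * N" using N0(2)[OF N(1)] by (simp add: L_def)
    have L34: "L ^ 3 \<le> L ^ 4" "L ^ 1 \<le> L ^ 4" using L by (intro power_increasing; simp)+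
    have "\<delta> * N \<le> 1 / 10 * N" using \<delta> N by (intro mult_right_mono) auto
    then have LN: "10 * L \<le> N" "10 * L ^ 3 \<le> N" using L4 L34 unfolding power_one_right by linarith+
    define D where "D = L / N"
    have D1: "D \<le> 1 / 10" using LN N by (simp add: D_def divide_le_eq)
    have dD: "d \<le> D" using dL' N by (simp add: D_def le_divide_eq mult.commute)
    have u: "u \<in> {- (pi / 2)<..<pi / 2}" using r by (simp add: is_root_def)
    have eq: "N * (d + u / N) = N * d + u" using N by (simp add: field_simps)
    have "0 \<le> N * (d + u / N)" "N * (d + u / N) \<le> L" using u dpi dL pi_gt_zero unfolding eq by auto
    then have x: "0 \<le> d + u / N" "d + u / N \<le> D"
      using N by (simp_all add: D_def le_divide_eq zero_le_mult_iff mult.commute)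
    have err: "scaled_error n (d + u / q n) d v w < \<epsilon>" if "\<bar>v\<bar> \<le> 2" "\<bar>w\<bar> \<le> 1000" for v w
    proof -
      have "N\<^sup>2 * \<bar>g (d + u / N) - (g d + g1 d * v / N + (w * g1 d + v\<^sup>2 * g2 d / 2) / N\<^sup>2)\<bar> \<le> N\<^sup>2 * (7000 * D ^ 4)"
        using d0 dD x D1 N that by (intro mult_left_mono inner_error) auto
      also have "\<dots> = 7000 * L ^ 4 / N\<^sup>2" using N by (simp add: D_def power_divide power2_eq_square eval_nat_numeral)
      also have "\<dots> \<le> 7000 * (\<delta> * N) / N\<^sup>2" using L4 by (intro divide_right_mono) auto
      also have "\<dots> = 7000 * \<delta> / N" using N by (simp add: power2_eq_square)
      also have "\<dots> \<le> 7000 * \<delta>" using divide_left_mono[of 1 N "7000 * \<delta>"] N \<delta> by simp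
      also have "\<dots> < \<epsilon>" by (rule \<delta>)
      finally show ?thesis unfolding scaled_error_def N_def .
    qed
    have d10: "d \<le> 1 / 10" using dD D1 by linarith
    have "scaled_error n (d + u / q n) d v (R_1 n d v) < \<epsilon> \<and> scaled_error n (d + u / q n) d v (R_2 n d v) < \<epsilon>"
      if v: "\<bar>v\<bar> < pi / 2" for v
    proof -
      have v2: "\<bar>v\<bar> \<le> 2" using v pi_less_4 by linarith
      have P: "pi / 2 \<le> Pa n d v" using v dpi by (simp add: Pa_def N_def abs_less_iff)
      have "\<bar>R_1 n d v\<bar> \<le> 1000" "\<bar>R_2 n d v\<bar> \<le> 1000"
        using R_bound[OF less_imp_le[OF d0] d10 _ _ _ P v2, of L] dL' LN L by (simp_all add: N_def mult.commute)
      then show ?thesis using err[OF v2] by blast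
    qed
    with d10 show "d \<le> 1 / 10 \<and> (\<forall>v. \<bar>v\<bar> < pi / 2 \<longrightarrow>
        scaled_error n (d + u / q n) d v (R_1 n d v) < \<epsilon> \<and> scaled_error n (d + u / q n) d v (R_2 n d v) < \<epsilon>)" by blast
  qed
qed

lemma statement_error:
  "(real n)\<^sup>2 * \<bar>g \<phi> - (g d + deriv g d * (2 * v / (real n + 3))
      + (4 * w * deriv g d + 2 * v\<^sup>2 * deriv (deriv g) d) / (real n + 3)\<^sup>2)\<bar> \<le> 4 * scaled_error n \<phi> d v w"
proof -
  define E where "E = g \<phi> - (g d + g1 d * v / q n + (w * g1 d + v\<^sup>2 * g2 d / 2) / (q n)\<^sup>2)"
  have "g1 d * (2 * v / (2 * q n)) = g1 d * v / q n" by simp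
  moreover have "(4 * w * g1 d + 2 * v\<^sup>2 * g2 d) / (2 * q n)\<^sup>2 = (w * g1 d + v\<^sup>2 * g2 d / 2) / (q n)\<^sup>2"
    unfolding power_mult_distrib by (simp add: add_divide_distrib)
  ultimately have eq: "g \<phi> - (g d + deriv g d * (2 * v / (real n + 3))
      + (4 * w * deriv g d + 2 * v\<^sup>2 * deriv (deriv g) d) / (real n + 3)\<^sup>2) = E"
    unfolding deriv_g(2)[unfolded deriv_g(1)] deriv_g(1) two_q[symmetric] E_def by simp
  have "(real n)\<^sup>2 \<le> (2 * q n)\<^sup>2" unfolding two_q by (intro power_mono) auto
  then have "(real n)\<^sup>2 * \<bar>E\<bar> \<le> (2 * q n)\<^sup>2 * \<bar>E\<bar>" by (rule mult_right_mono) simp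
  then show ?thesis unfolding eq scaled_error_def E_def[symmetric] power_mult_distrib by simp
qed

lemma u1_in_range:
  assumes "\<not> large_j n j" "0 \<le> d1 n j" "d1 n j \<le> 1 / 10" "pi \<le> q n * d1 n j"
  shows "\<bar>u1 n j\<bar> < pi / 2"
proof -
  have "\<exists>!u. u \<in> {- (pi / 2)<..<pi / 2} \<and> u = arctan (Z1_1 n (d1 n j) u)"
    using Z_signed_fixpoint_unique[of 0 "d1 n j" n] assms unfolding Z1_eq by simp
  from theI'[OF this] show ?thesis using assms(1) by (auto simp: u1_def)
qed

lemma w1_in_range:
  assumes "\<not> large_j n j" "0 \<le> d2 n j" "d2 n j \<le> 1 / 10" "pi \<le> q n * d2 n j"
  shows "\<bar>w1 n j\<bar> < pi / 2"
proof -
  have "\<exists>!u. u \<in> {- (pi / 2)<..<pi / 2} \<and> u = - arctan (Z1_2 n (d2 n j) u)"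
    using Z_signed_fixpoint_unique[of "pi / 2" "d2 n j" n] assms unfolding Z1_eq arctan_minus by simp
  from theI'[OF this] show ?thesis using assms(1) by (auto simp: w1_def)
qed

lemma odd_expansion:
  assumes "\<epsilon> > 0"
  shows "\<forall>\<^sub>F n in sequentially. \<forall>j\<in>{1..(n + 1) div 2}.
          (real n)\<^sup>2 * \<bar>lam n (2 * j - 1) -
             (g (d1 n j) + deriv g (d1 n j) * (2 * u1 n j / (real n + 3))
              + (4 * u2 n j * deriv g (d1 n j) + 2 * (u1 n j)\<^sup>2 * deriv (deriv g) (d1 n j))
                / (real n + 3)\<^sup>2)\<bar> < \<epsilon>"
    (is "\<forall>\<^sub>F n in _. \<forall>j\<in>?J n. ?E n j < \<epsilon>")
proof -
  have e: "\<epsilon> / 4 > 0" using assms by simp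
  from eventually_roots large_j_error[OF e] small_j_error[OF e] show ?thesis
  proof (eventually_elim, intro ballI)
    fix n j
    assume roots: "has_roots n"
      and large: "\<forall>\<theta> j d u. is_root n \<theta> j d u \<and> large_j n j \<longrightarrow>
        scaled_error n (d + u / q n) d (outer1 d) (outer2 d) < \<epsilon> / 4"
      and small: "\<forall>\<theta> j d u. is_root n \<theta> j d u \<and> \<not> large_j n j \<longrightarrow> d \<le> 1 / 10 \<and>
        (\<forall>v. \<bar>v\<bar> < pi / 2 \<longrightarrow> scaled_error n (d + u / q n) d v (R_1 n d v) < \<epsilon> / 4 \<and>
          scaled_error n (d + u / q n) d v (R_2 n d v) < \<epsilon> / 4)"
      and j: "j \<in> {1..(n + 1) div 2}"
    from bspec[OF conjunct1[OF roots[unfolded has_roots_def]] j] obtain u where u: "u \<in> {- (pi / 2)<..<pi / 2}"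
      "u = arctan (secular (q n) 0 (d1 n j + u / q n))" "phi_odd n j = d1 n j + u / q n" by (elim exE conjE)
    have j1: "1 \<le> j" "2 * real j \<le> real n + 1" using j by auto
    have "(real j + 1) * pi \<le> q n * pi" using j1 by (intro mult_right_mono) (auto simp: q_def)
    then have r: "is_root n 0 j (d1 n j) u" unfolding is_root_def using u(1,2) j1
      by (simp add: q_d1 algebra_simps)
    have "odd (2 * j - 1)" "(2 * j - 1 + 1) div 2 = j" using j1 by auto
    then have lam: "lam n (2 * j - 1) = g (d1 n j + u / q n)" by (simp add: lam_def phi_def u(3))
    have "scaled_error n (d1 n j + u / q n) (d1 n j) (u1 n j) (u2 n j) < \<epsilon> / 4"
    proof (cases "large_j n j")
      case True
      then show ?thesis using large[rule_format, OF conjI[OF r True]] by (simp add: u1_def u2_def)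
    next
      case False
      note s = small[rule_format, OF conjI[OF r False]]
      have "\<bar>u1 n j\<bar> < pi / 2" using u1_in_range[OF False] s is_root_range[OF r] by simp
      then show ?thesis using s False by (simp add: u2_def)
    qed
    then show "?E n j < \<epsilon>"
      using statement_error[of n "d1 n j + u / q n" "d1 n j" "u1 n j" "u2 n j"] unfolding lam by linarith
  qed
qed

lemma even_expansion:
  assumes "\<epsilon> > 0"
  shows "\<forall>\<^sub>F n in sequentially. \<forall>j\<in>{1..n div 2}.
          (real n)\<^sup>2 * \<bar>lam n (2 * j) -
             (g (d2 n j) + deriv g (d2 n j) * (2 * w1 n j / (real n + 3))
              + (4 * w2 n j * deriv g (d2 n j) + 2 * (w1 n j)\<^sup>2 * deriv (deriv g) (d2 n j))
                / (real n + 3)\<^sup>2)\<bar> < \<epsilon>"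
    (is "\<forall>\<^sub>F n in _. \<forall>j\<in>?J n. ?E n j < \<epsilon>")
proof -
  have e: "\<epsilon> / 4 > 0" using assms by simp
  from eventually_roots large_j_error[OF e] small_j_error[OF e] show ?thesis
  proof (eventually_elim, intro ballI)
    fix n j
    assume roots: "has_roots n"
      and large: "\<forall>\<theta> j d u. is_root n \<theta> j d u \<and> large_j n j \<longrightarrow>
        scaled_error n (d + u / q n) d (outer1 d) (outer2 d) < \<epsilon> / 4"
      and small: "\<forall>\<theta> j d u. is_root n \<theta> j d u \<and> \<not> large_j n j \<longrightarrow> d \<le> 1 / 10 \<and>
        (\<forall>v. \<bar>v\<bar> < pi / 2 \<longrightarrow> scaled_error n (d + u / q n) d v (R_1 n d v) < \<epsilon> / 4 \<and>
          scaled_error n (d + u / q n) d v (R_2 n d v) < \<epsilon> / 4)"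
      and j: "j \<in> {1..n div 2}"
    from bspec[OF conjunct2[OF roots[unfolded has_roots_def]] j] obtain u where u: "u \<in> {- (pi / 2)<..<pi / 2}"
      "u = arctan (secular (q n) (pi / 2) (d2 n j + u / q n))" "phi_even n j = d2 n j + u / q n" by (elim exE conjE)
    have j1: "1 \<le> j" "2 * real j \<le> real n" using j by auto
    have "(real j + 3 / 2) * pi \<le> q n * pi" using j1 by (intro mult_right_mono) (auto simp: q_def)
    then have r: "is_root n (pi / 2) j (d2 n j) u" unfolding is_root_def using u(1,2) j1
      by (simp add: q_d2 algebra_simps)
    have lam: "lam n (2 * j) = g (d2 n j + u / q n)" by (simp add: lam_def phi_def u(3))
    have "scaled_error n (d2 n j + u / q n) (d2 n j) (w1 n j) (w2 n j) < \<epsilon> / 4"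
    proof (cases "large_j n j")
      case True
      then show ?thesis using large[rule_format, OF conjI[OF r True]] by (simp add: w1_def w2_def)
    next
      case False
      note s = small[rule_format, OF conjI[OF r False]]
      have "\<bar>w1 n j\<bar> < pi / 2" using w1_in_range[OF False] s is_root_range[OF r] by simp
      then show ?thesis using s False by (simp add: w2_def)
    qed
    then show "?E n j < \<epsilon>"
      using statement_error[of n "d2 n j + u / q n" "d2 n j" "w1 n j" "w2 n j"] unfolding lam by linarith
  qed
qed

theorem theorem2p5:
  shows "(\<forall>\<^sub>F n in sequentially.
            char_poly (toeplitz symb n) = (\<Prod>m = 1..n. [:- of_real (lam n m), 1:]))
    \<and> (\<forall>\<epsilon>>0. \<forall>\<^sub>F n in sequentially. \<forall>j\<in>{1..(n + 1) div 2}.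
          (real n)\<^sup>2 * \<bar>lam n (2 * j - 1) -
             (g (d1 n j) + deriv g (d1 n j) * (2 * u1 n j / (real n + 3))
              + (4 * u2 n j * deriv g (d1 n j) + 2 * (u1 n j)\<^sup>2 * deriv (deriv g) (d1 n j))
                / (real n + 3)\<^sup>2)\<bar> < \<epsilon>)
    \<and> (\<forall>\<epsilon>>0. \<forall>\<^sub>F n in sequentially. \<forall>j\<in>{1..n div 2}.
          (real n)\<^sup>2 * \<bar>lam n (2 * j) -
             (g (d2 n j) + deriv g (d2 n j) * (2 * w1 n j / (real n + 3))
              + (4 * w2 n j * deriv g (d2 n j) + 2 * (w1 n j)\<^sup>2 * deriv (deriv g) (d2 n j))
                / (real n + 3)\<^sup>2)\<bar> < \<epsilon>)"
  using eventually_char_poly odd_expansion even_expansion by blast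

end
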